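(* Let $G$ be a finite graph and let $f\colon G\to G$ be a continuous piecewise monotone graph map with topological entropy $h(f)=\log\beta>0$. Then there exist a finite graph $G'$, a continuous piecewise monotone graph map $g\colon G'\to G'$ with constant slope $\beta$, and a continuous monotone surjection $\psi\colon G\to G'$ such that $\psi\circ f=g\circ\psi$. Moreover, if $f$ is transitive, then this semiconjugacy is actually a conjugacy (i.e. $\psi$ is a homeomorphism).
   Context: A graph map is a continuous map from a finite (topological) graph into itself. If $J$ is a connected subset of a graph, a map is monotone on $J$ if the preimages of points under its restriction to $J$ are connected. A graph map is piecewise monotone if the graph can be divided into finitely many connected pieces such that the map is monotone on each of them. A map $\psi\colon G\to G'$ is monotone if preimages of points are connected. The graph $G'$ need not be equal to $G$, since $\psi$ may collapse some connected sets to points. A graph map $g\colon G'\to G'$ has constant slope $\beta$ if, with suitable parametrizations of the edges of $G'$ by intervals of the real line (so that each edge has a length), $g$ is piecewise affine with finitely many pieces and $|g'|=\beta$ wherever $g$ is differentiable. Transitive means that some point has a dense trajectory. $h(f)$ is the usual topological entropy of a continuous map of a compact space. *)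

theory Defs
  imports "HOL-Analysis.Analysis"
begin

section \<open>Finite topological graphs\<close>

text \<open>
  A finite topological graph is presented as a finite one-dimensional CW complex with metrized
  edges. An edge is a pair \<open>(l, \<gamma>)\<close> of a length \<open>l > 0\<close> and a parametrization of the closed edge by
  the interval \<open>{0..l}\<close>; values of \<open>\<gamma>\<close> outside this interval are irrelevant. Loops and multiple
  edges are allowed, and neither connectedness nor the absence of isolated vertices is required.
\<close>

type_synonym 'a graph_edge = "real \<times> (real \<Rightarrow> 'a)"

definition open_edge :: "'a graph_edge \<Rightarrow> 'a set"
  where "open_edge e = (case e of (l, \<gamma>) \<Rightarrow> \<gamma> ` {0<..<l})"

text \<open>
  Compactness of \<open>X\<close> is automatic, and since \<open>X\<close> is Hausdorff its topology is
  the quotient topology induced by the vertices and the edge parametrizations. At least one edge is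
  required: a finite discrete space is not counted as a graph, since on such a space
  the constant slope condition below would be vacuous.
\<close>

definition graph_parametrization :: "'a topology \<Rightarrow> 'a set \<Rightarrow> 'a graph_edge set \<Rightarrow> bool"
  where "graph_parametrization X V E \<longleftrightarrow>
    Hausdorff_space X \<and> finite V \<and> V \<subseteq> topspace X \<and> finite E \<and> E \<noteq> {} \<and>
    (\<forall>(l, \<gamma>)\<in>E. 0 < l \<and> continuous_map (top_of_set {0..l}) X \<gamma> \<and> inj_on \<gamma> {0<..<l} \<and>
       \<gamma> 0 \<in> V \<and> \<gamma> l \<in> V \<and> \<gamma> ` {0<..<l} \<inter> V = {}) \<and>
    pairwise (\<lambda>e e'. disjnt (open_edge e) (open_edge e')) E \<and>
    topspace X = V \<union> (\<Union>e\<in>E. open_edge e)"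

definition finite_graph :: "'a topology \<Rightarrow> bool"
  where "finite_graph X \<longleftrightarrow> (\<exists>V E. graph_parametrization X V E)"


section \<open>Piecewise monotone maps and constant slope\<close>

definition monotone_on_piece :: "'a topology \<Rightarrow> 'b topology \<Rightarrow> ('a \<Rightarrow> 'b) \<Rightarrow> 'a set \<Rightarrow> bool"
  where "monotone_on_piece X Y f J \<longleftrightarrow> monotone_map (subtopology X J) Y f"

text \<open>The pieces cover the graph; they may share points (e.g. common endpoints).\<close>

definition piecewise_monotone :: "'a topology \<Rightarrow> ('a \<Rightarrow> 'a) \<Rightarrow> bool"
  where "piecewise_monotone X f \<longleftrightarrow>
    (\<exists>\<J>. finite \<J> \<and> \<Union>\<J> = topspace X \<and>
      (\<forall>J\<in>\<J>. connectedin X J \<and> monotone_on_piece X X f J))"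

text \<open>
  In the coordinates given by the edge parametrizations \<open>E\<close>: every edge is divided by a finite set
  \<open>T\<close> such that each piece between consecutive points of \<open>T\<close> is mapped into one closed edge
  by an affine function.
\<close>

definition piecewise_affine :: "'a graph_edge set \<Rightarrow> ('a \<Rightarrow> 'a) \<Rightarrow> bool"
  where "piecewise_affine E g \<longleftrightarrow>
    (\<forall>(l, \<gamma>)\<in>E. \<exists>T. finite T \<and> {0, l} \<subseteq> T \<and> T \<subseteq> {0..l} \<and>
      (\<forall>s\<in>T. \<forall>t\<in>T. s < t \<and> {s<..<t} \<inter> T = {} \<longrightarrow>
        (\<exists>(l', \<gamma>')\<in>E. \<exists>a b. \<forall>u\<in>{s..t}. a * u + b \<in> {0..l'} \<and> g (\<gamma> u) = \<gamma>' (a * u + b))))"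

text \<open>
  \<open>g\<close> has derivative \<open>d\<close> at the point with coordinate \<open>t\<close> in the interior of the edge
  \<open>(l, \<gamma>)\<close>: near \<open>t\<close>, some function \<open>\<phi>\<close> with derivative \<open>d\<close> at \<open>t\<close> expresses \<open>g\<close> in the
  coordinates of one closed edge. The image point may be a vertex, so a map that is locally constant
  on an edge, with value a vertex, has derivative \<open>0\<close> there.
\<close>

definition graph_map_has_deriv ::
    "'a graph_edge set \<Rightarrow> ('a \<Rightarrow> 'a) \<Rightarrow> 'a graph_edge \<Rightarrow> real \<Rightarrow> real \<Rightarrow> bool"
  where "graph_map_has_deriv E g e t d \<longleftrightarrow>
    (\<exists>(l', \<gamma>')\<in>E. \<exists>\<phi>.
      (\<forall>\<^sub>F u in nhds t. \<phi> u \<in> {0..l'} \<and> g (snd e u) = \<gamma>' (\<phi> u)) \<and>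
      (\<phi> has_real_derivative d) (at t))"

definition constant_slope :: "'a topology \<Rightarrow> ('a \<Rightarrow> 'a) \<Rightarrow> real \<Rightarrow> bool"
  where "constant_slope X g \<beta> \<longleftrightarrow>
    (\<exists>V E. graph_parametrization X V E \<and> piecewise_affine E g \<and>
      (\<forall>e\<in>E. \<forall>t d. 0 < t \<and> t < fst e \<and> graph_map_has_deriv E g e t d \<longrightarrow> \<bar>d\<bar> = \<beta>))"


section \<open>Topological dynamics\<close>

definition transitive_map :: "'a topology \<Rightarrow> ('a \<Rightarrow> 'a) \<Rightarrow> bool"
  where "transitive_map X f \<longleftrightarrow>
    (\<exists>x\<in>topspace X. X closure_of (range (\<lambda>n. (f ^^ n) x)) = topspace X)"

text \<open>Topological entropy of a self-map of a compact space, by open covers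
  (Adler, Konheim and McAndrew).\<close>

definition open_cover :: "'a topology \<Rightarrow> 'a set set \<Rightarrow> bool"
  where "open_cover X \<U> \<longleftrightarrow> (\<forall>U\<in>\<U>. openin X U) \<and> \<Union>\<U> = topspace X"

definition subcover_number :: "'a topology \<Rightarrow> 'a set set \<Rightarrow> nat"
  where "subcover_number X \<U> = Inf (card ` {\<V>. finite \<V> \<and> \<V> \<subseteq> \<U> \<and> \<Union>\<V> = topspace X})"

text \<open>The common refinement of the covers \<open>\<U>, f\<inverse> \<U>, \<dots>\<close> pulled back along the first \<open>n\<close>
  iterates of \<open>f\<close>, starting from the identity.\<close>

definition iterated_join :: "'a topology \<Rightarrow> ('a \<Rightarrow> 'a) \<Rightarrow> 'a set set \<Rightarrow> nat \<Rightarrow> 'a set set"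
  where "iterated_join X f \<U> n =
    {{x \<in> topspace X. \<forall>i<n. (f ^^ i) x \<in> U i} | U. \<forall>i<n. U i \<in> \<U>}"

text \<open>By subadditivity the limit superior is a limit when \<open>X\<close> is compact and \<open>f\<close> continuous.\<close>

definition cover_entropy :: "'a topology \<Rightarrow> ('a \<Rightarrow> 'a) \<Rightarrow> 'a set set \<Rightarrow> ereal"
  where "cover_entropy X f \<U> =
    limsup (\<lambda>n. ereal (ln (real (subcover_number X (iterated_join X f \<U> n))) / real n))"

definition topological_entropy :: "'a topology \<Rightarrow> ('a \<Rightarrow> 'a) \<Rightarrow> ereal"
  where "topological_entropy X f = (SUP \<U>\<in>{\<U>. open_cover X \<U>}. cover_entropy X f \<U>)"

end

theory Submission
  imports Defs
begin

text \<open>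
  Cut \<open>f\<close> into finitely many branches that run monotonically through single edges. On families of
  nondecreasing functions on the edges these branches define a positive transfer operator, which sends
  a monotone function to the variation of its pullback under \<open>f\<close>. Let \<open>1 / \<sigma>\<close> be the radius of
  convergence of the generating function of the numbers of preimages of the cut points. Counting
  preimages bounds the entropy by \<open>ln \<sigma>\<close>, so \<open>\<sigma> > 1\<close>, and the normalized resolvents of the transfer
  operator accumulate at an eigenfunction \<open>u\<close> with eigenvalue \<open>\<sigma>\<close>; it is continuous because jumps would
  grow. Collapsing the segments on which \<open>u\<close> is constant and measuring lengths by \<open>u\<close> turns \<open>f\<close> into a
  map of constant slope \<open>\<sigma>\<close>. Finally a Lebesgue measure estimate shows that such a map has
  entropy at least \<open>ln \<sigma>\<close>, and entropy does not increase under factors, so \<open>\<sigma> = \<beta>\<close>.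
\<close>


section \<open>Transfer operators of piecewise monotone interval systems\<close>

text \<open>The number \<open>\<sigma>\<close> is never computed from the entropy but pinned down by
  two one-sided estimates: the counting bound gives only \<open>\<beta> \<le> \<sigma>\<close>, and
  the entropy of the quotient, dominated by that of \<open>f\<close>, gives the converse. The
  delicate point is that the normalized resolvents have a nonzero limit solving the homogeneous
  equation. With U(z) the sum of z^n times the n-th transfer of the cut count w, one has U(z) = w +
  z times the transfer of U(z). Dividing by the mass S(z) removes w in the limit only if S(z) is
  unbounded near the radius r. This follows from growth(n + m) \<le> (K + growth 0 + ... + growth (m
  - 1)) growth n and r < 1: a bounded S would make the bracket times r^m less than 1 for some m, and
  the series would converge beyond r. Positive entropy enters through r < 1; hence also \<sigma> >
  1, which excludes jumps. The other obstacle is that a connected set may meet an edge in an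
  interval or in the complement of one, as it can close up through the rest of the graph. The
  cutting into branches has to handle both shapes.\<close>

lemma finite_avoid:
  fixes T :: "real set"
  assumes "finite T" "0 < v"
  obtains \<epsilon> where "0 < \<epsilon>" "\<epsilon> \<le> v" "\<And>c. c \<in> T \<Longrightarrow> c \<noteq> x \<Longrightarrow> \<epsilon> \<le> \<bar>c - x\<bar>"
proof -
  let ?A = "insert v ((\<lambda>c. \<bar>c - x\<bar>) ` (T - {x}))"
  have "finite ?A" using assms by simp
  then have "0 < Min ?A" "Min ?A \<le> v" "\<And>c. c \<in> T \<Longrightarrow> c \<noteq> x \<Longrightarrow> Min ?A \<le> \<bar>c - x\<bar>"
    using assms(2) by (auto simp: Min_gr_iff intro: Min_le)
  then show ?thesis using that by blast
qed

definition clip :: "real \<Rightarrow> real \<Rightarrow> real \<Rightarrow> real"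
  where "clip a b x = max a (min b x)"

locale interval_system =
  fixes I :: "'i set" and L :: "'i \<Rightarrow> real" and P :: "'p set"
    and src tgt :: "'p \<Rightarrow> 'i" and lo hi :: "'p \<Rightarrow> real" and \<phi> :: "'p \<Rightarrow> real \<Rightarrow> real"
  assumes finite_I: "finite I" and finite_P: "finite P"
    and L_nonneg: "i \<in> I \<Longrightarrow> 0 \<le> L i"
    and src: "p \<in> P \<Longrightarrow> src p \<in> I" and tgt: "p \<in> P \<Longrightarrow> tgt p \<in> I"
    and lo: "p \<in> P \<Longrightarrow> 0 \<le> lo p" and lo_hi: "p \<in> P \<Longrightarrow> lo p < hi p"
    and hi: "p \<in> P \<Longrightarrow> hi p \<le> L (src p)"
    and \<phi>_cont: "p \<in> P \<Longrightarrow> continuous_on {lo p..hi p} (\<phi> p)"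
    and \<phi>_into: "p \<in> P \<Longrightarrow> x \<in> {lo p..hi p} \<Longrightarrow> \<phi> p x \<in> {0..L (tgt p)}"
    and \<phi>_mono: "p \<in> P \<Longrightarrow> mono_on {lo p..hi p} (\<phi> p) \<or> antimono_on {lo p..hi p} (\<phi> p)"
    and disjoint: "p \<in> P \<Longrightarrow> q \<in> P \<Longrightarrow> p \<noteq> q \<Longrightarrow> src p = src q \<Longrightarrow> hi p \<le> lo q \<or> hi q \<le> lo p"
    and cover: "i \<in> I \<Longrightarrow> 0 \<le> x \<Longrightarrow> x < y \<Longrightarrow> y \<le> L i \<Longrightarrow>
       (\<And>p. p \<in> P \<Longrightarrow> src p = i \<Longrightarrow> lo p \<notin> {x<..<y} \<and> hi p \<notin> {x<..<y}) \<Longrightarrow>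
       \<exists>p\<in>P. src p = i \<and> lo p \<le> x \<and> y \<le> hi p"
begin

definition monotone_family :: "('i \<Rightarrow> real \<Rightarrow> real) \<Rightarrow> bool"
  where "monotone_family u \<longleftrightarrow> (\<forall>i\<in>I. mono_on {0..L i} (u i))"

text \<open>The variation over \<open>{0..x}\<close> of the pullback of \<open>u\<close> along the
  branches. Clipping makes a branch to the right of \<open>x\<close> contribute 0 and one to the
  left of \<open>x\<close> its full variation. If \<open>u\<close> is read as a distribution
  function of measures, this is the transfer operator on measures.\<close>

definition transfer :: "('i \<Rightarrow> real \<Rightarrow> real) \<Rightarrow> 'i \<Rightarrow> real \<Rightarrow> real"
  where "transfer u i x = (\<Sum>p | p \<in> P \<and> src p = i.
    \<bar>u (tgt p) (\<phi> p (clip (lo p) (hi p) x)) - u (tgt p) (\<phi> p (lo p))\<bar>)"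

definition mass :: "('i \<Rightarrow> real \<Rightarrow> real) \<Rightarrow> real"
  where "mass u = (\<Sum>i\<in>I. u i (L i) - u i 0)"

lemma clip_mem: "p \<in> P \<Longrightarrow> clip (lo p) (hi p) x \<in> {lo p..hi p}"
  using lo_hi[of p] by (auto simp: clip_def)

lemma clip_mono: "x \<le> y \<Longrightarrow> clip a b x \<le> clip a b y"
  by (auto simp: clip_def)

lemma clip_id: "x \<in> {a..b} \<Longrightarrow> clip a b x = x"
  by (auto simp: clip_def)

lemma monotone_familyD:
  "monotone_family u \<Longrightarrow> i \<in> I \<Longrightarrow> 0 \<le> x \<Longrightarrow> x \<le> y \<Longrightarrow> y \<le> L i \<Longrightarrow> u i x \<le> u i y"
  unfolding monotone_family_def by (meson atLeastAtMost_iff mono_onD order_trans)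

lemma branch_mono:
  assumes "monotone_family u" "p \<in> P"
  shows "mono_on {lo p..hi p} (\<lambda>t. u (tgt p) (\<phi> p t)) \<or> antimono_on {lo p..hi p} (\<lambda>t. u (tgt p) (\<phi> p t))"
  using \<phi>_mono[OF assms(2)]
proof
  assume m: "mono_on {lo p..hi p} (\<phi> p)"
  have "mono_on {lo p..hi p} (\<lambda>t. u (tgt p) (\<phi> p t))"
  proof (rule mono_onI)
    fix r s assume "r \<in> {lo p..hi p}" "s \<in> {lo p..hi p}" "r \<le> s"
    then show "u (tgt p) (\<phi> p r) \<le> u (tgt p) (\<phi> p s)"
      using \<phi>_into[OF assms(2), of r] \<phi>_into[OF assms(2), of s] mono_onD[OF m, of r s]
      by (intro monotone_familyD[OF assms(1) tgt[OF assms(2)]]) auto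
  qed
  then show ?thesis ..
next
  assume m: "antimono_on {lo p..hi p} (\<phi> p)"
  have "antimono_on {lo p..hi p} (\<lambda>t. u (tgt p) (\<phi> p t))"
  proof (rule monotone_onI)
    fix r s assume "r \<in> {lo p..hi p}" "s \<in> {lo p..hi p}" "r \<le> s"
    then show "u (tgt p) (\<phi> p s) \<le> u (tgt p) (\<phi> p r)"
      using \<phi>_into[OF assms(2), of r] \<phi>_into[OF assms(2), of s] monotone_onD[OF m, of r s]
      by (intro monotone_familyD[OF assms(1) tgt[OF assms(2)]]) auto
  qed
  then show ?thesis ..
qed

text \<open>Along a monotone function the variation measured from the left end is additive, so the
  absolute values telescope.\<close>

lemma branch_diff:
  assumes "monotone_family u" "p \<in> P" "lo p \<le> x" "x \<le> y" "y \<le> hi p"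
  shows "\<bar>u (tgt p) (\<phi> p y) - u (tgt p) (\<phi> p (lo p))\<bar> - \<bar>u (tgt p) (\<phi> p x) - u (tgt p) (\<phi> p (lo p))\<bar>
    = \<bar>u (tgt p) (\<phi> p y) - u (tgt p) (\<phi> p x)\<bar>"
  using branch_mono[OF assms(1,2)]
proof
  assume m: "mono_on {lo p..hi p} (\<lambda>t. u (tgt p) (\<phi> p t))"
  show ?thesis
    using mono_onD[OF m, of "lo p" x] mono_onD[OF m, of x y] assms by auto
next
  assume m: "antimono_on {lo p..hi p} (\<lambda>t. u (tgt p) (\<phi> p t))"
  show ?thesis
    using monotone_onD[OF m, of "lo p" x] monotone_onD[OF m, of x y] assms by auto
qed

lemma transfer_diff_sum:
  "transfer u i y - transfer u i x = (\<Sum>p | p \<in> P \<and> src p = i.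
    \<bar>u (tgt p) (\<phi> p (clip (lo p) (hi p) y)) - u (tgt p) (\<phi> p (lo p))\<bar> -
    \<bar>u (tgt p) (\<phi> p (clip (lo p) (hi p) x)) - u (tgt p) (\<phi> p (lo p))\<bar>)"
  by (simp add: transfer_def sum_subtractf)

lemma transfer_mono:
  assumes "monotone_family u" shows "monotone_family (transfer u)"
proof -
  have "transfer u i x \<le> transfer u i y" if "x \<le> y" for i x y
  proof -
    have "0 \<le> transfer u i y - transfer u i x"
      unfolding transfer_diff_sum
    proof (rule sum_nonneg)
      fix p assume "p \<in> {p \<in> P. src p = i}"
      then have p: "p \<in> P" by simp
      show "0 \<le> \<bar>u (tgt p) (\<phi> p (clip (lo p) (hi p) y)) - u (tgt p) (\<phi> p (lo p))\<bar> -
        \<bar>u (tgt p) (\<phi> p (clip (lo p) (hi p) x)) - u (tgt p) (\<phi> p (lo p))\<bar>"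
        using branch_diff[OF assms p, of "clip (lo p) (hi p) x" "clip (lo p) (hi p) y"]
          clip_mem[OF p, of x] clip_mem[OF p, of y] clip_mono[OF that] by auto
    qed
    then show ?thesis by simp
  qed
  then show ?thesis unfolding monotone_family_def by (auto intro: mono_onI)
qed

lemma transfer_pow_mono: "monotone_family u \<Longrightarrow> monotone_family ((transfer ^^ n) u)"
  by (induction n) (auto simp: transfer_mono)

text \<open>By disjointness every other branch over the same segment is clipped to the same end at
  \<open>x\<close> and at \<open>y\<close> and cancels. For an eigenfunction this identity becomes
  the constant slope equation.\<close>

lemma transfer_diff:
  assumes "monotone_family u" "p \<in> P" "lo p \<le> x" "x \<le> y" "y \<le> hi p"
  shows "transfer u (src p) y - transfer u (src p) x = \<bar>u (tgt p) (\<phi> p y) - u (tgt p) (\<phi> p x)\<bar>"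
proof -
  have "transfer u (src p) y - transfer u (src p) x =
    (\<Sum>q | q \<in> P \<and> src q = src p. if q = p then \<bar>u (tgt p) (\<phi> p y) - u (tgt p) (\<phi> p x)\<bar> else 0)"
    unfolding transfer_diff_sum
  proof (rule sum.cong[OF refl])
    fix q assume "q \<in> {q \<in> P. src q = src p}"
    then have q: "q \<in> P" "src q = src p" by auto
    show "\<bar>u (tgt q) (\<phi> q (clip (lo q) (hi q) y)) - u (tgt q) (\<phi> q (lo q))\<bar> -
        \<bar>u (tgt q) (\<phi> q (clip (lo q) (hi q) x)) - u (tgt q) (\<phi> q (lo q))\<bar> =
        (if q = p then \<bar>u (tgt p) (\<phi> p y) - u (tgt p) (\<phi> p x)\<bar> else 0)"
    proof (cases "q = p")
      case True
      then show ?thesis using branch_diff[OF assms] assms by (simp add: clip_id)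
    next
      case False
      then have "clip (lo q) (hi q) y = clip (lo q) (hi q) x"
        using disjoint[OF q(1) assms(2) False q(2)] assms lo_hi[OF q(1)] by (auto simp: clip_def)
      then show ?thesis using False by simp
    qed
  qed
  also have "\<dots> = \<bar>u (tgt p) (\<phi> p y) - u (tgt p) (\<phi> p x)\<bar>"
    using assms(2) finite_P by (simp add: sum.delta')
  finally show ?thesis .
qed

lemma transfer_0: "transfer u i 0 = 0"
proof -
  have "clip (lo p) (hi p) 0 = lo p" if "p \<in> P" for p
    using lo[OF that] lo_hi[OF that] by (auto simp: clip_def)
  then show ?thesis by (simp add: transfer_def)
qed

text \<open>The distribution function of the counting measure on the cuts, so that its iterated
  transfers count preimages of cuts, up to end effects. The strict inequality makes it vanish at 0
  when all cuts are nonnegative.\<close>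

definition cut_count :: "('i \<Rightarrow> real set) \<Rightarrow> 'i \<Rightarrow> real \<Rightarrow> real"
  where "cut_count C i x = real (card {c \<in> C i. c < x})"

lemma cut_count_mono:
  assumes "\<And>i. i \<in> I \<Longrightarrow> finite (C i)" shows "monotone_family (cut_count C)"
  unfolding monotone_family_def cut_count_def using assms
  by (auto intro!: mono_onI card_mono)

text \<open>This is applied to the oscillation of the iterated transfer of a bounded family, and to the number
  of sets of an iterated cover that are needed to cover a segment.\<close>

lemma counting:
  fixes R :: "nat \<Rightarrow> 'i \<Rightarrow> real \<Rightarrow> real \<Rightarrow> real \<Rightarrow> bool"
  assumes C: "\<And>i. i \<in> I \<Longrightarrow> finite (C i)" "\<And>p. p \<in> P \<Longrightarrow> lo p \<in> C (src p) \<and> hi p \<in> C (src p)"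
    and mono: "\<And>n i x y k k'. R n i x y k \<Longrightarrow> k \<le> k' \<Longrightarrow> R n i x y k'"
    and start: "\<And>i x y. i \<in> I \<Longrightarrow> 0 \<le> x \<Longrightarrow> x \<le> y \<Longrightarrow> y \<le> L i \<Longrightarrow> R 0 i x y 1"
    and point: "\<And>n i x. i \<in> I \<Longrightarrow> 0 \<le> x \<Longrightarrow> x \<le> L i \<Longrightarrow> R n i x x 1"
    and split: "\<And>n i x c y k k'. i \<in> I \<Longrightarrow> 0 \<le> x \<Longrightarrow> x < c \<Longrightarrow> c < y \<Longrightarrow> y \<le> L i \<Longrightarrow>
       R n i x c k \<Longrightarrow> R n i c y k' \<Longrightarrow> R n i x y (k + k')"
    and step: "\<And>n p x y k. p \<in> P \<Longrightarrow> lo p \<le> x \<Longrightarrow> x < y \<Longrightarrow> y \<le> hi p \<Longrightarrow> {x<..<y} \<inter> C (src p) = {} \<Longrightarrow>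
       R n (tgt p) (min (\<phi> p x) (\<phi> p y)) (max (\<phi> p x) (\<phi> p y)) k \<Longrightarrow> R (Suc n) (src p) x y k"
  shows "i \<in> I \<Longrightarrow> 0 \<le> x \<Longrightarrow> x \<le> y \<Longrightarrow> y \<le> L i \<Longrightarrow>
    R n i x y (1 + (\<Sum>k<n. (transfer ^^ k) (cut_count C) i y - (transfer ^^ k) (cut_count C) i x))"
proof (induction n arbitrary: i x y)
  case 0
  then show ?case using start by simp
next
  case (Suc n)
  define w where "w = cut_count C"
  note IH = Suc.IH[folded w_def]
  have mw: "monotone_family ((transfer ^^ k) w)" for k
    unfolding w_def by (intro transfer_pow_mono cut_count_mono C)
  \<comment> \<open>Inner induction on the number \<open>m\<close> of cuts strictly inside. A gap
    lies in one branch and inherits the bound of its image; splitting at a cut adds the constants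
    \<open>1 + m1\<close> and \<open>1 + m2\<close>, and the cut itself pays for the second
    1.\<close>
  have *: "R (Suc n) i x y (1 + real m + (\<Sum>k<n. (transfer ^^ Suc k) w i y - (transfer ^^ Suc k) w i x))"
    if "i \<in> I" "0 \<le> x" "x \<le> y" "y \<le> L i" "card (C i \<inter> {x<..<y}) = m" for i x y m
    using that
  proof (induction m arbitrary: x y rule: less_induct)
    case (less m)
    have fin: "finite (C i \<inter> A)" for A using C(1)[OF less.prems(1)] by blast
    consider "x = y" | "x < y" "m = 0" | "x < y" "m > 0" using less.prems by linarith
    then show ?case
    proof cases
      case 1
      then show ?thesis using point[of i x "Suc n"] less.prems by simp
    next
      case 2
      then have e: "C i \<inter> {x<..<y} = {}" using fin less.prems by auto
      have "\<exists>p\<in>P. src p = i \<and> lo p \<le> x \<and> y \<le> hi p"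
      proof (rule cover)
        fix p assume "p \<in> P" "src p = i"
        then show "lo p \<notin> {x<..<y} \<and> hi p \<notin> {x<..<y}" using e C(2)[of p] by blast
      qed (use less.prems 2 in auto)
      then obtain p where p: "p \<in> P" "src p = i" "lo p \<le> x" "y \<le> hi p" by blast
      have d: "(transfer ^^ k) w (tgt p) (max (\<phi> p x) (\<phi> p y)) - (transfer ^^ k) w (tgt p) (min (\<phi> p x) (\<phi> p y))
          = (transfer ^^ Suc k) w i y - (transfer ^^ Suc k) w i x" for k
      proof -
        have "(transfer ^^ Suc k) w i y - (transfer ^^ Suc k) w i x =
          \<bar>(transfer ^^ k) w (tgt p) (\<phi> p y) - (transfer ^^ k) w (tgt p) (\<phi> p x)\<bar>"
          using transfer_diff[OF mw[of k] p(1,3) _ p(4)] p(2) 2 by simp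
        moreover have "(transfer ^^ k) w (tgt p) (min (\<phi> p x) (\<phi> p y)) \<le> (transfer ^^ k) w (tgt p) (max (\<phi> p x) (\<phi> p y))"
          using \<phi>_into[OF p(1), of x] \<phi>_into[OF p(1), of y] p 2
          by (intro monotone_familyD[OF mw tgt[OF p(1)]]) auto
        ultimately show ?thesis by (auto simp: min_def max_def split: if_splits)
      qed
      have "R n (tgt p) (min (\<phi> p x) (\<phi> p y)) (max (\<phi> p x) (\<phi> p y))
         (1 + (\<Sum>k<n. (transfer ^^ Suc k) w i y - (transfer ^^ Suc k) w i x))"
        unfolding d[symmetric]
        using \<phi>_into[OF p(1), of x] \<phi>_into[OF p(1), of y] p 2
        by (intro IH tgt p(1)) auto
      then have "R (Suc n) (src p) x y (1 + (\<Sum>k<n. (transfer ^^ Suc k) w i y - (transfer ^^ Suc k) w i x))"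
        using e p 2 by (intro step) auto
      then show ?thesis using 2 p by simp
    next
      case 3
      then obtain c where c: "c \<in> C i" "x < c" "c < y"
        using less.prems by (metis card_gt_0_iff disjoint_iff greaterThanLessThan_iff)
      define m1 m2 where "m1 = card (C i \<inter> {x<..<c})" and "m2 = card (C i \<inter> {c<..<y})"
      have "C i \<inter> {x<..<y} = insert c ((C i \<inter> {x<..<c}) \<union> (C i \<inter> {c<..<y}))"
        using c by auto
      then have m: "m = Suc (m1 + m2)"
        unfolding m1_def m2_def less.prems(5)[symmetric] using fin
        by (subst card_Un_disjoint[symmetric]) auto
      have "R (Suc n) i x c (1 + real m1 + (\<Sum>k<n. (transfer ^^ Suc k) w i c - (transfer ^^ Suc k) w i x))"
        using less.prems c m by (intro less.IH) (auto simp: m1_def)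
      moreover have "R (Suc n) i c y (1 + real m2 + (\<Sum>k<n. (transfer ^^ Suc k) w i y - (transfer ^^ Suc k) w i c))"
        using less.prems c m by (intro less.IH) (auto simp: m2_def)
      ultimately have "R (Suc n) i x y ((1 + real m1 + (\<Sum>k<n. (transfer ^^ Suc k) w i c - (transfer ^^ Suc k) w i x))
         + (1 + real m2 + (\<Sum>k<n. (transfer ^^ Suc k) w i y - (transfer ^^ Suc k) w i c)))"
        by (rule split[OF less.prems(1,2) c(2,3) less.prems(4)])
      then show ?thesis
        by (rule mono) (simp add: m sum_subtractf)
    qed
  qed
  \<comment> \<open>The inner cuts are charged to the term \<open>k = 0\<close> of the sum. The
    difference of \<open>w\<close> also counts a cut at \<open>x\<close> itself, hence only an
    inequality.\<close>
  have "real (card (C i \<inter> {x<..<y})) \<le> w i y - w i x"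
  proof -
    have f: "finite (C i)" using C Suc.prems by auto
    have "card {c \<in> C i. c < y} = card {c \<in> C i. c < x} + card {c \<in> C i. x \<le> c \<and> c < y}"
      using Suc.prems f by (subst card_Un_disjoint[symmetric]) (auto intro!: arg_cong[where f=card])
    moreover have "card (C i \<inter> {x<..<y}) \<le> card {c \<in> C i. x \<le> c \<and> c < y}"
      using f by (intro card_mono) auto
    ultimately show ?thesis by (simp add: w_def cut_count_def)
  qed
  moreover have "(\<Sum>k<Suc n. (transfer ^^ k) w i y - (transfer ^^ k) w i x) =
      w i y - w i x + (\<Sum>k<n. (transfer ^^ Suc k) w i y - (transfer ^^ Suc k) w i x)"
    by (subst sum.lessThan_Suc_shift) simp
  ultimately show ?case
    unfolding w_def[symmetric]
    by (intro mono[OF *[OF Suc.prems refl]]) linarith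
qed

lemma mass_ge_0: "monotone_family u \<Longrightarrow> 0 \<le> mass u"
  unfolding mass_def by (intro sum_nonneg) (simp add: monotone_familyD L_nonneg)

lemma osc_le_mass:
  assumes "monotone_family u" "i \<in> I" shows "u i (L i) - u i 0 \<le> mass u"
  unfolding mass_def using finite_I assms
  by (intro member_le_sum) (auto simp: monotone_familyD L_nonneg)

text \<open>On an interval that stays free of cuts for \<open>n\<close> steps the iterate is a
  composition of branches, so the iterated transfer oscillates there as \<open>u\<close> does on the
  image, by at most \<open>mass u\<close>. Then \<open>counting\<close> bounds the number of such
  intervals; \<open>card I\<close> collects the constant 1 of each segment.\<close>

lemma mass_transfer_pow_le:
  assumes C: "\<And>i. i \<in> I \<Longrightarrow> finite (C i)" "\<And>p. p \<in> P \<Longrightarrow> lo p \<in> C (src p) \<and> hi p \<in> C (src p)"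
    and u: "monotone_family u"
  shows "mass ((transfer ^^ n) u) \<le> mass u * (real (card I) + (\<Sum>k<n. mass ((transfer ^^ k) (cut_count C))))"
proof -
  have M: "mass u \<ge> 0" using mass_ge_0[OF u] .
  have mu: "monotone_family ((transfer ^^ k) u)" for k by (intro transfer_pow_mono u)
  have *: "(transfer ^^ n) u i (L i) - (transfer ^^ n) u i 0 \<le>
    mass u * (1 + (\<Sum>k<n. (transfer ^^ k) (cut_count C) i (L i) - (transfer ^^ k) (cut_count C) i 0))"
    if "i \<in> I" for i
  proof (rule counting[where R = "\<lambda>n i x y k. (transfer ^^ n) u i y - (transfer ^^ n) u i x \<le> mass u * k" and C=C])
    fix n :: nat and i x y k k' assume "(transfer ^^ n) u i y - (transfer ^^ n) u i x \<le> mass u * k" "k \<le> k'"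
    then show "(transfer ^^ n) u i y - (transfer ^^ n) u i x \<le> mass u * k'"
      using M mult_left_mono[of k k' "mass u"] by linarith
  next
    fix i x y assume a: "i \<in> I" "(0::real) \<le> x" "x \<le> y" "y \<le> L i"
    then have "u i 0 \<le> u i x" "u i y \<le> u i (L i)" using monotone_familyD[OF u a(1)] by auto
    then show "(transfer ^^ 0) u i y - (transfer ^^ 0) u i x \<le> mass u * 1"
      using osc_le_mass[OF u a(1)] by simp
  next
    fix n p x y k assume a: "p \<in> P" "lo p \<le> x" "x < y" "y \<le> hi p"
       "(transfer ^^ n) u (tgt p) (max (\<phi> p x) (\<phi> p y)) - (transfer ^^ n) u (tgt p) (min (\<phi> p x) (\<phi> p y)) \<le> mass u * k"
    have "(transfer ^^ Suc n) u (src p) y - (transfer ^^ Suc n) u (src p) x =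
       \<bar>(transfer ^^ n) u (tgt p) (\<phi> p y) - (transfer ^^ n) u (tgt p) (\<phi> p x)\<bar>"
      using transfer_diff[OF mu[of n] a(1,2) _ a(4)] a by simp
    moreover have "(transfer ^^ n) u (tgt p) (min (\<phi> p x) (\<phi> p y)) \<le> (transfer ^^ n) u (tgt p) (max (\<phi> p x) (\<phi> p y))"
          using \<phi>_into[OF a(1), of x] \<phi>_into[OF a(1), of y] a
          by (intro monotone_familyD[OF mu tgt[OF a(1)]]) auto
    ultimately show "(transfer ^^ Suc n) u (src p) y - (transfer ^^ Suc n) u (src p) x \<le> mass u * k"
      using a(5) by (auto simp: min_def max_def split: if_splits)
  qed (use C M that L_nonneg in \<open>auto simp: algebra_simps\<close>)
  have "mass ((transfer ^^ n) u) \<le> (\<Sum>i\<in>I. mass u * (1 + (\<Sum>k<n. (transfer ^^ k) (cut_count C) i (L i) - (transfer ^^ k) (cut_count C) i 0)))"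
    unfolding mass_def[of "(transfer ^^ n) u"] by (intro sum_mono *)
  also have "\<dots> = mass u * (real (card I) + (\<Sum>i\<in>I. \<Sum>k<n. (transfer ^^ k) (cut_count C) i (L i) - (transfer ^^ k) (cut_count C) i 0))"
    by (simp add: sum_distrib_left[symmetric] sum.distrib)
  also have "(\<Sum>i\<in>I. \<Sum>k<n. (transfer ^^ k) (cut_count C) i (L i) - (transfer ^^ k) (cut_count C) i 0) =
     (\<Sum>k<n. mass ((transfer ^^ k) (cut_count C)))"
    unfolding mass_def by (rule sum.swap)
  finally show ?thesis .
qed

end

section \<open>Power series: the radius of convergence and divergence near it; cluster
  points\<close>

text \<open>A ratio test with step \<open>m\<close>. A partial sum S satisfies S \<le> B + q S,
  where B is the sum of the first \<open>m\<close> terms, hence S \<le> B / (1 - q).\<close>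

lemma summable_shift_contract:
  fixes x :: "nat \<Rightarrow> real"
  assumes nn: "\<And>n. 0 \<le> x n" and q: "0 \<le> q" "q < 1" and le: "\<And>n. x (n + m) \<le> q * x n"
  shows "summable x"
proof (rule bounded_imp_summable[OF nn])
  fix N
  let ?S = "\<lambda>N. \<Sum>n\<le>N. x n" and ?B = "\<Sum>n<m. x n"
  have "?S N \<le> ?B + (\<Sum>n\<le>N. x (n + m))"
  proof -
    have "?S N \<le> (\<Sum>n<m + Suc N. x n)"
      using nn by (intro sum_mono2) auto
    also have "\<dots> = ?B + (\<Sum>n\<in>{m..<m + Suc N}. x n)"
      by (metis atLeast0LessThan le_add1 le0 sum.atLeastLessThan_concat)
    also have "(\<Sum>n\<in>{m..<m + Suc N}. x n) = (\<Sum>n\<le>N. x (n + m))"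
      using sum.shift_bounds_nat_ivl[of x 0 m "Suc N"] by (simp add: atLeast0LessThan lessThan_Suc_atMost add.commute)
    finally show ?thesis .
  qed
  also have "(\<Sum>n\<le>N. x (n + m)) \<le> q * ?S N"
    unfolding sum_distrib_left by (intro sum_mono le)
  finally have "(1 - q) * ?S N \<le> ?B" by (simp add: algebra_simps)
  then show "?S N \<le> ?B / (1 - q)"
    using q by (simp add: pos_le_divide_eq mult.commute)
qed

text \<open>Cauchy product with the geometric series: partial sums are the coefficients of A(z) / (1
  - z).\<close>

lemma summable_partial_sums:
  fixes a :: "nat \<Rightarrow> real"
  assumes nn: "\<And>n. 0 \<le> a n" and z: "0 < z" "z < 1" and s: "summable (\<lambda>n. a n * z ^ n)"
  shows "summable (\<lambda>n. (\<Sum>k<n. a k) * z ^ n)"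
proof -
  have "summable (\<lambda>n. \<Sum>k\<le>n. (a k * z ^ k) * z ^ (n - k))"
    by (rule summable_Cauchy_product) (use nn z s in \<open>auto simp: abs_mult\<close>)
  moreover have "(\<Sum>k\<le>n. (a k * z ^ k) * z ^ (n - k)) = (\<Sum>k\<le>n. a k) * z ^ n" for n
    by (simp add: sum_distrib_right mult.assoc power_add[symmetric])
  ultimately have s2: "summable (\<lambda>n. (\<Sum>k\<le>n. a k) * z ^ n)" by simp
  show ?thesis
  proof (rule summable_comparison_test'[OF s2])
    fix n
    have "(\<Sum>k<n. a k) \<le> (\<Sum>k\<le>n. a k)" using nn by (intro sum_mono2) auto
    then show "norm ((\<Sum>k<n. a k) * z ^ n) \<le> (\<Sum>k\<le>n. a k) * z ^ n"
      using nn z by (simp add: abs_mult sum_nonneg mult_right_mono)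
  qed
qed

text \<open>If the sums stayed bounded below \<open>r\<close>, the series would converge at
  \<open>r\<close>, and so would the series of its partial sums because \<open>r < 1\<close>. Then
  \<open>D m * r ^ m < 1\<close> for some \<open>m\<close>, the inequality persists slightly beyond
  \<open>r\<close>, and \<open>sub\<close> turns it into convergence there.\<close>

lemma critical_radius:
  fixes c :: "nat \<Rightarrow> real" and b K :: real
  assumes nn: "\<And>n. 0 \<le> c n" and K: "K \<ge> 0"
    and sub: "\<And>n m. c (n + m) \<le> (K + (\<Sum>k<m. c k)) * c n"
    and b: "b < 1" "\<And>z. 0 < z \<Longrightarrow> z < 1 \<Longrightarrow> summable (\<lambda>n. c n * z ^ n) \<Longrightarrow> z \<le> b"
  obtains r where "0 < r" "r \<le> b" "\<And>z. 0 \<le> z \<Longrightarrow> z < r \<Longrightarrow> summable (\<lambda>n. c n * z ^ n)"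
    "\<And>M r'. r' < r \<Longrightarrow> \<exists>z. 0 < z \<and> r' < z \<and> z < r \<and> M < (\<Sum>n. c n * z ^ n)"
proof -
  define Z where "Z = {z. 0 < z \<and> z < 1 \<and> summable (\<lambda>n. c n * z ^ n)}"
  define D where "D m = K + (\<Sum>k<m. c k)" for m
  have D0: "D m \<ge> 0" for m unfolding D_def using K nn by (simp add: sum_nonneg)
  \<comment> \<open>Small enough for the ratio test with step 1, since \<open>sub\<close> gives
    \<open>c (n + 1) \<le> D 1 * c n\<close>; this makes \<open>Z\<close> nonempty.\<close>
  define z0 where "z0 = 1 / (2 * (D 1 + 1))"
  have z0: "0 < z0" "z0 < 1" "D 1 * z0 < 1" using D0[of 1] by (auto simp: z0_def field_simps)
  have "summable (\<lambda>n. c n * z0 ^ n)"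
  proof (rule summable_shift_contract[where q = "D 1 * z0" and m = 1])
    fix n show "c (n + 1) * z0 ^ (n + 1) \<le> D 1 * z0 * (c n * z0 ^ n)"
      using mult_right_mono[OF sub[of n 1, folded D_def], of "z0 ^ (n+1)"] z0 by (simp add: algebra_simps)
  qed (use z0 D0 nn in auto)
  then have z0Z: "z0 \<in> Z" using z0 by (simp add: Z_def)
  have bdd: "bdd_above Z" using b(2) by (auto simp: Z_def intro: bdd_aboveI[of _ b])
  define r where "r = Sup Z"
  have r0: "0 < r" using cSup_upper[OF z0Z bdd] z0 r_def by linarith
  have rb: "r \<le> b" unfolding r_def by (rule cSup_least) (use z0Z b(2) in \<open>auto simp: Z_def\<close>)
  have conv: "summable (\<lambda>n. c n * z ^ n)" if z: "0 \<le> z" "z < r" for z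
  proof -
    obtain z' where z': "z' \<in> Z" "z < z'" using less_cSupD[of Z z] z0Z z(2) r_def by blast
    show ?thesis
    proof (rule summable_comparison_test'[where g = "\<lambda>n. c n * z' ^ n"])
      show "summable (\<lambda>n. c n * z' ^ n)" using z' by (simp add: Z_def)
      fix n show "norm (c n * z ^ n) \<le> c n * z' ^ n"
        using nn z z' by (simp add: abs_mult mult_left_mono power_mono)
    qed
  qed
  have unb: "\<exists>z. 0 < z \<and> z < r \<and> M < (\<Sum>n. c n * z ^ n)" for M
  proof (rule ccontr)
    assume "\<not> ?thesis"
    then have M: "(\<Sum>n. c n * z ^ n) \<le> M" if "0 < z" "z < r" for z using that by force
    have "summable (\<lambda>n. c n * r ^ n)"
    proof (rule bounded_imp_summable)
      fix n show "0 \<le> c n * r ^ n" using nn r0 by simp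
      have "((\<lambda>z. \<Sum>k\<le>n. c k * z ^ k) \<longlongrightarrow> (\<Sum>k\<le>n. c k * r ^ k)) (at_left r)"
        by (intro tendsto_intros)
      moreover have "\<forall>\<^sub>F z in at_left r. (\<Sum>k\<le>n. c k * z ^ k) \<le> M"
        using eventually_at_left_real[OF r0]
      proof eventually_elim
        case (elim z)
        then have "(\<Sum>k\<le>n. c k * z ^ k) \<le> (\<Sum>k. c k * z ^ k)"
          using nn by (intro sum_le_suminf conv) auto
        then show ?case using M[of z] elim by simp
      qed
      ultimately show "(\<Sum>k\<le>n. c k * r ^ k) \<le> M"
        by (rule tendsto_upperbound) simp
    qed
    then have "summable (\<lambda>n. (\<Sum>k<n. c k) * r ^ n)"
      using summable_partial_sums[OF nn r0] rb b by simp
    moreover have "summable (\<lambda>n. K * r ^ n)"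
      using r0 rb b by (intro summable_mult summable_geometric) auto
    ultimately have "summable (\<lambda>n. D n * r ^ n)"
      unfolding D_def by (simp add: summable_add algebra_simps)
    then have "(\<lambda>n. D n * r ^ n) \<longlonglongrightarrow> 0" by (rule summable_LIMSEQ_zero)
    then have "\<forall>\<^sub>F n in sequentially. D n * r ^ n < 1"
      by (rule order_tendstoD) simp
    then obtain m where m: "D m * r ^ m < 1" by (auto simp: eventually_sequentially)
    have "((\<lambda>z. D m * z ^ m) \<longlongrightarrow> D m * r ^ m) (at_right r)" by (intro tendsto_intros)
    then have "\<forall>\<^sub>F z in at_right r. D m * z ^ m < 1" using m by (rule order_tendstoD)
    moreover have "r < 1" using rb b by simp
    then have "\<forall>\<^sub>F z in at_right r. z \<in> {r<..<1}" by (rule eventually_at_right_real)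
    ultimately have "\<forall>\<^sub>F z in at_right r. D m * z ^ m < 1 \<and> z \<in> {r<..<1}" by eventually_elim simp
    then obtain z where z: "D m * z ^ m < 1" "r < z" "z < 1"
      by (auto dest!: eventually_happens'[OF trivial_limit_at_right_real])
    have "summable (\<lambda>n. c n * z ^ n)"
    proof (rule summable_shift_contract[where q = "D m * z ^ m" and m = m])
      fix n show "c (n + m) * z ^ (n + m) \<le> D m * z ^ m * (c n * z ^ n)"
        using mult_right_mono[OF sub[of n m, folded D_def], of "z ^ (n+m)"] z r0
        by (simp add: power_add mult_ac)
    qed (use z D0 nn r0 in auto)
    then have "z \<in> Z" using z r0 by (simp add: Z_def)
    then show False using cSup_upper[OF _ bdd, of z] z r_def by simp
  qed
  show ?thesis
  proof (rule that[OF r0 rb conv])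
    fix M r' assume r': "r' < r"
    \<comment> \<open>The sum increases with \<open>z\<close>, so a witness for a large sum may be
      pushed up to exceed \<open>r'\<close>.\<close>
    define r1 where "r1 = max (r/2) ((r + r')/2)"
    have r1: "0 < r1" "r' < r1" "r1 < r" using r0 r' by (auto simp: r1_def max_def)
    obtain z where z: "0 < z" "z < r" "M < (\<Sum>n. c n * z ^ n)" using unb by blast
    have "(\<Sum>n. c n * z ^ n) \<le> (\<Sum>n. c n * max z r1 ^ n)"
      using z r1 nn by (intro suminf_le conv mult_left_mono power_mono) auto
    then show "\<exists>z. 0 < z \<and> r' < z \<and> z < r \<and> M < (\<Sum>n. c n * z ^ n)"
      using z r1 by (intro exI[of _ "max z r1"]) auto
  qed
qed

text \<open>Tychonoff: the cube is compact, so the sequence has a cluster point \<open>l\<close>,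
  and \<open>F\<close> is the trace of the neighbourhoods of \<open>l\<close> on the indices. A
  filter replaces a subsequence because the coordinates may be uncountably many.\<close>

lemma cluster_subfilter:
  fixes h :: "nat \<Rightarrow> 'b \<Rightarrow> real"
  assumes "\<And>k j. h k j \<in> {0..1}"
  obtains l F where "F \<noteq> bot" "F \<le> sequentially" "\<And>j. ((\<lambda>k. h k j) \<longlongrightarrow> l j) F"
proof -
  have "compactin (product_topology (\<lambda>_::'b. euclidean) UNIV) (PiE UNIV (\<lambda>_. {0..1::real}))"
    by (simp add: compactin_PiE)
  then have "compact (PiE UNIV (\<lambda>_::'b. {0..1::real}))"
    by (simp add: euclidean_product_topology)
  moreover have "filtermap h sequentially \<noteq> bot" by (simp add: filtermap_bot_iff)
  moreover have "eventually (\<lambda>x. x \<in> PiE UNIV (\<lambda>_::'b. {0..1::real})) (filtermap h sequentially)"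
    using assms by (simp add: eventually_filtermap PiE_iff)
  ultimately obtain l where l: "inf (nhds l) (filtermap h sequentially) \<noteq> bot"
    unfolding compact_filter by blast
  define F where "F = inf sequentially (filtercomap h (nhds l))"
  have "F \<noteq> bot"
  proof
    assume "F = bot"
    then have "eventually (\<lambda>_. False) F" by simp
    then obtain Q R R' where QR: "eventually Q sequentially" "eventually R' (nhds l)"
       "\<And>k. R' (h k) \<Longrightarrow> R k" "\<And>k. Q k \<Longrightarrow> R k \<Longrightarrow> False"
      unfolding F_def eventually_inf eventually_filtercomap by blast
    have "eventually (\<lambda>y. \<not> R' y) (filtermap h sequentially)"
      unfolding eventually_filtermap using QR(1) by (rule eventually_mono) (use QR in blast)
    then have "eventually (\<lambda>_. False) (inf (nhds l) (filtermap h sequentially))"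
      unfolding eventually_inf using QR(2) by blast
    then show False using l by (simp add: eventually_False)
  qed
  moreover have "F \<le> sequentially" by (simp add: F_def)
  moreover have "((\<lambda>k. h k j) \<longlongrightarrow> l j) F" for j
  proof -
    have fl: "filterlim h (nhds l) F"
      unfolding F_def by (rule filterlim_mono[OF filterlim_filtercomap]) auto
    have "continuous_map (product_topology (\<lambda>_::'b. euclidean) UNIV) (euclidean :: real topology) (\<lambda>x. x j)"
      by (rule continuous_map_product_projection) simp
    then have cont: "continuous_on UNIV (\<lambda>x::'b \<Rightarrow> real. x j)"
      by (simp add: euclidean_product_topology)
    show ?thesis
    proof (rule topological_tendstoI)
      fix S :: "real set" assume S: "open S" "l j \<in> S"
      have "open ((\<lambda>x::'b \<Rightarrow> real. x j) -` S)"
        using open_vimage[OF S(1) cont] by simp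
      then have "eventually (\<lambda>x. x j \<in> S) (nhds l)"
        using S(2) unfolding eventually_nhds by auto
      then show "eventually (\<lambda>k. h k j \<in> S) F"
        using fl by (rule eventually_compose_filterlim)
    qed
  qed
  ultimately show ?thesis using that by blast
qed

section \<open>The eigenfunction of the transfer operator and its continuity\<close>

context interval_system begin

text \<open>The eigenfunction is a limit point of the normalized resolvents at the radius of convergence
  (Milnor and Thurston). Each value of the transfer is a finite sum, so it commutes with pointwise limits.\<close>

lemma eigenfunction:
  assumes w: "monotone_family w" "\<And>i. i \<in> I \<Longrightarrow> w i 0 = 0"
    and r: "0 < r" "\<And>z. 0 \<le> z \<Longrightarrow> z < r \<Longrightarrow> summable (\<lambda>n. mass ((transfer ^^ n) w) * z ^ n)"
    "\<And>M r'. r' < r \<Longrightarrow> \<exists>z. 0 < z \<and> r' < z \<and> z < r \<and> M < (\<Sum>n. mass ((transfer ^^ n) w) * z ^ n)"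
  obtains u where "monotone_family u" "\<And>i. i \<in> I \<Longrightarrow> u i 0 = 0" "mass u = 1"
    "\<And>i x. i \<in> I \<Longrightarrow> x \<in> {0..L i} \<Longrightarrow> u i x = r * transfer u i x"
proof -
  define W where "W n = (transfer ^^ n) w" for n
  define c where "c n = mass (W n)" for n
  have mW: "monotone_family (W n)" for n unfolding W_def by (intro transfer_pow_mono w)
  have W_Suc: "transfer (W n) = W (Suc n)" for n by (simp add: W_def)
  have W0: "W n i 0 = 0" if "i \<in> I" for n i
    using that w(2) by (cases n) (auto simp: W_def transfer_0)
  have Wb: "0 \<le> W n i x" "W n i x \<le> c n" if "i \<in> I" "x \<in> {0..L i}" for n i x
  proof -
    show "0 \<le> W n i x" using monotone_familyD[OF mW[of n] that(1), of 0 x] W0[OF that(1)] that by simp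
    show "W n i x \<le> c n"
      using monotone_familyD[OF mW[of n] that(1), of x "L i"] osc_le_mass[OF mW[of n] that(1)] W0[OF that(1), of n] that
      by (simp add: c_def)
  qed
  have sc: "summable (\<lambda>n. c n * z ^ n)" if "0 \<le> z" "z < r" for z using r(2)[OF that] by (simp add: c_def W_def)
  have sW: "summable (\<lambda>n. W n i x * z ^ n)" if "i \<in> I" "x \<in> {0..L i}" "0 \<le> z" "z < r" for i x z
  proof (rule summable_comparison_test'[OF sc[OF that(3,4)]])
    fix n show "norm (W n i x * z ^ n) \<le> c n * z ^ n"
      using Wb[OF that(1,2), of n] that by (simp add: abs_mult mult_right_mono)
  qed
  \<comment> \<open>The resolvent: formally the inverse of 1 - z times the transfer, applied to
    \<open>w\<close>.\<close>
  define U where "U z i x = (\<Sum>n. W n i x * z ^ n)" for z i x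
  define S where "S z = (\<Sum>n. c n * z ^ n)" for z
  have U0: "U z i 0 = 0" if "i \<in> I" for z i using W0[OF that] by (simp add: U_def)
  have U_mono: "U z i x \<le> U z i y" if "i \<in> I" "0 \<le> x" "x \<le> y" "y \<le> L i" "0 \<le> z" "z < r" for z i x y
    unfolding U_def using that
    by (intro suminf_le sW mult_right_mono monotone_familyD[OF mW]) auto
  have U_le: "U z i x \<le> S z" if "i \<in> I" "x \<in> {0..L i}" "0 \<le> z" "z < r" for z i x
    unfolding U_def S_def using that by (intro suminf_le sW sc mult_right_mono Wb) auto
  have mass_U: "(\<Sum>i\<in>I. U z i (L i)) = S z" if "0 \<le> z" "z < r" for z
  proof -
    have "(\<Sum>i\<in>I. U z i (L i)) = (\<Sum>n. \<Sum>i\<in>I. W n i (L i) * z ^ n)"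
      unfolding U_def using that L_nonneg by (intro suminf_sum[symmetric] sW) auto
    also have "(\<lambda>n. \<Sum>i\<in>I. W n i (L i) * z ^ n) = (\<lambda>n. c n * z ^ n)"
      using W0 by (auto simp: c_def mass_def sum_distrib_right cong: sum.cong)
    finally show ?thesis by (simp add: S_def)
  qed
  \<comment> \<open>The resolvent equation. Which of the two branch values is larger does not depend
    on \<open>n\<close>, so by monotonicity the absolute values resolve with one sign throughout and
    pass through the series.\<close>
  have TU: "U z i x = w i x + z * transfer (U z) i x" if "i \<in> I" "x \<in> {0..L i}" "0 \<le> z" "z < r" for z i x
  proof -
    have br: "(\<lambda>n. \<bar>W n (tgt p) (\<phi> p (clip (lo p) (hi p) x)) - W n (tgt p) (\<phi> p (lo p))\<bar> * z ^ n) sums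
       \<bar>U z (tgt p) (\<phi> p (clip (lo p) (hi p) x)) - U z (tgt p) (\<phi> p (lo p))\<bar>" if p: "p \<in> P" for p
    proof -
      let ?x = "\<phi> p (clip (lo p) (hi p) x)" and ?y = "\<phi> p (lo p)"
      have in1: "?x \<in> {0..L (tgt p)}" "?y \<in> {0..L (tgt p)}"
        using \<phi>_into[OF p clip_mem[OF p]] \<phi>_into[OF p, of "lo p"] lo_hi[OF p] by auto
      have s: "(\<lambda>n. W n (tgt p) ?x * z ^ n) sums U z (tgt p) ?x" "(\<lambda>n. W n (tgt p) ?y * z ^ n) sums U z (tgt p) ?y"
        unfolding U_def using in1 \<open>0 \<le> z\<close> \<open>z < r\<close> by (auto intro!: summable_sums sW tgt p)
      consider "?y \<le> ?x" | "?x \<le> ?y" by linarith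
      then show ?thesis
      proof cases
        case 1
        then have "W n (tgt p) ?y \<le> W n (tgt p) ?x" for n
          using in1 by (intro monotone_familyD[OF mW tgt[OF p]]) auto
        then have "\<bar>W n (tgt p) ?x - W n (tgt p) ?y\<bar> * z ^ n = W n (tgt p) ?x * z ^ n - W n (tgt p) ?y * z ^ n" for n
          by (simp add: algebra_simps)
        moreover have "\<bar>U z (tgt p) ?x - U z (tgt p) ?y\<bar> = U z (tgt p) ?x - U z (tgt p) ?y"
          using U_mono[OF tgt[OF p], of ?y ?x z] 1 in1 \<open>0 \<le> z\<close> \<open>z < r\<close> by simp
        ultimately show ?thesis using sums_diff[OF s] by simp
      next
        case 2
        then have "W n (tgt p) ?x \<le> W n (tgt p) ?y" for n
          using in1 by (intro monotone_familyD[OF mW tgt[OF p]]) auto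
        then have "\<bar>W n (tgt p) ?x - W n (tgt p) ?y\<bar> * z ^ n = W n (tgt p) ?y * z ^ n - W n (tgt p) ?x * z ^ n" for n
          by (simp add: algebra_simps)
        moreover have "\<bar>U z (tgt p) ?x - U z (tgt p) ?y\<bar> = U z (tgt p) ?y - U z (tgt p) ?x"
          using U_mono[OF tgt[OF p], of ?x ?y z] 2 in1 \<open>0 \<le> z\<close> \<open>z < r\<close> by simp
        ultimately show ?thesis using sums_diff[OF s(2) s(1)] by simp
      qed
    qed
    have "(\<lambda>n. \<Sum>p | p \<in> P \<and> src p = i. \<bar>W n (tgt p) (\<phi> p (clip (lo p) (hi p) x)) - W n (tgt p) (\<phi> p (lo p))\<bar> * z ^ n)
       sums transfer (U z) i x"
      unfolding transfer_def by (intro sums_sum br) auto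
    then have "(\<lambda>n. transfer (W n) i x * z ^ n) sums transfer (U z) i x"
      by (simp add: transfer_def sum_distrib_right)
    then have "(\<lambda>n. z * (W (Suc n) i x * z ^ n)) sums (z * transfer (U z) i x)"
      by (intro sums_mult) (simp add: W_Suc)
    then have "(\<lambda>n. W (Suc n) i x * z ^ Suc n) sums (z * transfer (U z) i x)"
      by (simp add: algebra_simps)
    then have "(\<lambda>n. W n i x * z ^ n) sums (z * transfer (U z) i x + W 0 i x * z ^ 0)"
      using sums_Suc_iff[of "\<lambda>n. W n i x * z ^ n"] by simp
    then show ?thesis by (simp add: U_def sums_iff W_def)
  qed
  have "\<forall>k. \<exists>z. 0 < z \<and> r - 1 / real (Suc k) < z \<and> z < r \<and> real (Suc k) < S z"
    using r(3) by (auto simp: S_def c_def W_def)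
  then obtain \<zeta> where \<zeta>: "\<And>k. 0 < \<zeta> k" "\<And>k. r - 1 / real (Suc k) < \<zeta> k" "\<And>k. \<zeta> k < r" "\<And>k. real (Suc k) < S (\<zeta> k)"
    by metis
  have S0: "0 < S (\<zeta> k)" for k using \<zeta>(4)[of k] of_nat_0_le_iff[of "Suc k"] by linarith
  \<comment> \<open>Coordinates outside the segments are set to 0 to keep all values in
    \<open>{0..1}\<close>.\<close>
  define h where "h k j = (if fst j \<in> I \<and> snd j \<in> {0..L (fst j)} then U (\<zeta> k) (fst j) (snd j) / S (\<zeta> k) else 0)" for k and j :: "'i \<times> real"
  have U_ge: "0 \<le> U z i x" if "i \<in> I" "x \<in> {0..L i}" "0 \<le> z" "z < r" for z i x
    using U_mono[OF that(1), of 0 x z] U0[OF that(1)] that by simp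
  have h01: "h k j \<in> {0..1}" for k j
    unfolding h_def using U_ge U_le \<zeta> S0 by (auto simp: divide_le_eq less_imp_le)
  obtain l F where F: "F \<noteq> bot" "F \<le> sequentially" "\<And>j. ((\<lambda>k. h k j) \<longlongrightarrow> l j) F"
    using cluster_subfilter[of h] h01 by metis
  have \<zeta>_lim: "(\<zeta> \<longlongrightarrow> r) F"
  proof (rule tendsto_mono[OF F(2)], rule tendsto_sandwich)
    show "(\<lambda>k. r - 1 / real (Suc k)) \<longlonglongrightarrow> r"
      using tendsto_diff[OF tendsto_const[of r] LIMSEQ_Suc[OF lim_1_over_n]] by simp
    show "(\<lambda>k. r) \<longlonglongrightarrow> r" by simp
  qed (use \<zeta> in \<open>auto intro!: always_eventually less_imp_le\<close>)
  have iS_le: "1 / S (\<zeta> k) \<le> 1 / real (Suc k)" for k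
    using \<zeta>(4)[of k] S0[of k] by (intro divide_left_mono) (auto simp del: of_nat_Suc)
  have iS: "((\<lambda>k. 1 / S (\<zeta> k)) \<longlongrightarrow> 0) F"
  proof (rule tendsto_mono[OF F(2)], rule tendsto_sandwich)
    show "(\<lambda>k. 0) \<longlonglongrightarrow> (0::real)" by simp
    show "(\<lambda>k. 1 / real (Suc k)) \<longlonglongrightarrow> 0" by (rule LIMSEQ_Suc[OF lim_1_over_n])
    show "\<forall>\<^sub>F k in sequentially. 1 / S (\<zeta> k) \<le> 1 / real (Suc k)"
      using iS_le by (intro always_eventually allI)
    show "\<forall>\<^sub>F k in sequentially. 0 \<le> 1 / S (\<zeta> k)"
      using S0 by (intro always_eventually allI) (simp add: less_imp_le)
  qed
  define u where "u i x = l (i, x)" for i x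
  have lim: "((\<lambda>k. U (\<zeta> k) i x / S (\<zeta> k)) \<longlongrightarrow> u i x) F" if "i \<in> I" "x \<in> {0..L i}" for i x
    using F(3)[of "(i,x)"] that by (simp add: h_def u_def)
  have mu: "monotone_family u"
    unfolding monotone_family_def
  proof (intro ballI mono_onI)
    fix i x y assume *: "i \<in> I" "x \<in> {0..L i}" "y \<in> {0..L i}" "x \<le> y"
    show "u i x \<le> u i y"
      by (rule tendsto_le[OF F(1) lim[OF *(1,3)] lim[OF *(1,2)]])
         (intro always_eventually allI divide_right_mono U_mono, use * \<zeta> S0 in \<open>auto simp: less_imp_le\<close>)
  qed
  have u0: "u i 0 = 0" if "i \<in> I" for i
    using lim[OF that, of 0] U0[OF that] L_nonneg[OF that] F(1) by (simp add: tendsto_const_iff)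
  \<comment> \<open>Every normalized resolvent has mass exactly 1. Mass is a finite sum of point
    values, so it survives the pointwise limit and the limit is not zero.\<close>
  have m1: "mass u = 1"
  proof -
    have "((\<lambda>k. \<Sum>i\<in>I. U (\<zeta> k) i (L i) / S (\<zeta> k)) \<longlongrightarrow> (\<Sum>i\<in>I. u i (L i))) F"
      by (intro tendsto_sum lim) (auto simp: L_nonneg)
    moreover have "(\<Sum>i\<in>I. U (\<zeta> k) i (L i) / S (\<zeta> k)) = 1" for k
      using mass_U[of "\<zeta> k"] \<zeta> S0[of k] by (simp add: sum_divide_distrib[symmetric] less_imp_le)
    ultimately have "(\<Sum>i\<in>I. u i (L i)) = 1" using F(1) by (simp add: tendsto_const_iff)
    then show ?thesis using u0 by (simp add: mass_def)
  qed
  \<comment> \<open>In the resolvent equation divided by the mass, the inhomogeneous term is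
    \<open>w i x / S (\<zeta> k)\<close>, which tends to 0.\<close>
  have eq: "u i x = r * transfer u i x" if ix: "i \<in> I" "x \<in> {0..L i}" for i x
  proof -
    let ?T = "\<lambda>k. \<Sum>p | p \<in> P \<and> src p = i. \<bar>U (\<zeta> k) (tgt p) (\<phi> p (clip (lo p) (hi p) x)) / S (\<zeta> k) -
         U (\<zeta> k) (tgt p) (\<phi> p (lo p)) / S (\<zeta> k)\<bar>"
    have "(?T \<longlongrightarrow> transfer u i x) F"
      unfolding transfer_def
      by (intro tendsto_intros lim)
         (use tgt \<phi>_into clip_mem lo_hi in \<open>auto simp: less_imp_le\<close>)
    then have "((\<lambda>k. w i x * (1 / S (\<zeta> k)) + \<zeta> k * ?T k) \<longlongrightarrow> w i x * 0 + r * transfer u i x) F"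
      by (intro tendsto_intros iS \<zeta>_lim)
    moreover have "w i x * (1 / S (\<zeta> k)) + \<zeta> k * ?T k = U (\<zeta> k) i x / S (\<zeta> k)" for k
    proof -
      have "?T k = transfer (U (\<zeta> k)) i x / S (\<zeta> k)"
        unfolding transfer_def sum_divide_distrib
        using S0[of k] by (intro sum.cong refl) (simp add: diff_divide_distrib[symmetric])
      then show ?thesis using TU[OF ix, of "\<zeta> k"] \<zeta>[of k] by (simp add: add_divide_distrib)
    qed
    ultimately show ?thesis using tendsto_unique[OF F(1) _ lim[OF ix]] by simp
  qed
  show ?thesis by (rule that[OF mu u0 m1 eq])
qed

text \<open>Here \<open>d\<close> is a direction. A step shorter than the distance from
  \<open>x\<close> to every other branch end has no branch end strictly inside, so
  \<open>cover\<close> applies to it.\<close>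

lemma germ_in_piece:
  assumes i: "i \<in> I" and x: "x \<in> {0..L i}" and d: "\<bar>d\<bar> = 1" and v: "0 < v" "x + d * v \<in> {0..L i}"
  obtains p \<epsilon> where "p \<in> P" "src p = i" "0 < \<epsilon>" "\<epsilon> \<le> v" "x \<in> {lo p..hi p}" "x + d * \<epsilon> \<in> {lo p..hi p}"
proof -
  define C where "C = lo ` P \<union> hi ` P"
  have "finite C" using finite_P by (simp add: C_def)
  then obtain \<epsilon> where e: "0 < \<epsilon>" "\<epsilon> \<le> v" and far: "\<And>c. c \<in> C \<Longrightarrow> c \<noteq> x \<Longrightarrow> \<epsilon> \<le> \<bar>c - x\<bar>"
    using finite_avoid[of C v x] v(1) by blast
  have d': "d = 1 \<or> d = -1" using d by linarith
  have "\<exists>p\<in>P. src p = i \<and> lo p \<le> min x (x + d * \<epsilon>) \<and> max x (x + d * \<epsilon>) \<le> hi p"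
  proof (rule cover[OF i])
    fix p assume "p \<in> P"
    then have "lo p \<in> C" "hi p \<in> C" by (auto simp: C_def)
    then show "lo p \<notin> {min x (x + d * \<epsilon>)<..<max x (x + d * \<epsilon>)} \<and> hi p \<notin> {min x (x + d * \<epsilon>)<..<max x (x + d * \<epsilon>)}"
      using far[of "lo p"] far[of "hi p"] d' e by auto
  qed (use d' e x v in \<open>auto simp: min_def max_def\<close>)
  then show ?thesis using that e by auto
qed

text \<open>A one-sided jump at a point gives an \<open>s\<close> times larger one-sided jump at its image, while all
  jumps are bounded by the mass.\<close>

lemma eigenfunction_continuous:
  assumes mu: "monotone_family u" and s: "1 < s"
    and eq: "\<And>p x y. p \<in> P \<Longrightarrow> lo p \<le> x \<Longrightarrow> x \<le> y \<Longrightarrow> y \<le> hi p \<Longrightarrow>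
       \<bar>u (tgt p) (\<phi> p y) - u (tgt p) (\<phi> p x)\<bar> = s * (u (src p) y - u (src p) x)"
    and i: "i \<in> I"
  shows "continuous_on {0..L i} (u i)"
proof -
  \<comment> \<open>A jump of height at least \<open>\<kappa>\<close> at \<open>x\<close> on the
    side \<open>d\<close>: every point on that side differs in value by at least
    \<open>\<kappa>\<close>. Demanding that the side is nonempty keeps this from holding
    vacuously.\<close>
  define J where "J i x d \<kappa> \<longleftrightarrow> i \<in> I \<and> x \<in> {0..L i} \<and> \<bar>d\<bar> = 1 \<and> (\<exists>v>0. x + d * v \<in> {0..L i}) \<and>
     (\<forall>v>0. x + d * v \<in> {0..L i} \<longrightarrow> \<kappa> \<le> \<bar>u i (x + d * v) - u i x\<bar>)" for i x d \<kappa>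
  have grow: "\<exists>i' x' d'. J i' x' d' (s * \<kappa>)" if J: "J i x d \<kappa>" and \<kappa>: "0 < \<kappa>" for i x d \<kappa>
  proof -
    from J obtain v0 where a: "i \<in> I" "x \<in> {0..L i}" "\<bar>d\<bar> = 1" "0 < v0" "x + d * v0 \<in> {0..L i}"
      and j: "\<And>v. v>0 \<Longrightarrow> x + d * v \<in> {0..L i} \<Longrightarrow> \<kappa> \<le> \<bar>u i (x + d * v) - u i x\<bar>"
      unfolding J_def by blast
    obtain p \<epsilon> where p: "p \<in> P" "src p = i" "0 < \<epsilon>" "\<epsilon> \<le> v0" "x \<in> {lo p..hi p}" "x + d * \<epsilon> \<in> {lo p..hi p}"
      using germ_in_piece[OF a] by metis
    have d: "d = 1 \<or> d = -1" using a by linarith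
    have seg: "x + d * v \<in> {lo p..hi p}" if "0 < v" "v \<le> \<epsilon>" for v
      using d p that by auto
    have seg': "x + d * v \<in> {0..L i}" if "0 < v" "v \<le> \<epsilon>" for v
      using seg[OF that] lo[OF p(1)] hi[OF p(1)] p(2) by auto
    let ?x = "\<phi> p x" and ?i = "tgt p"
    have big: "s * \<kappa> \<le> \<bar>u ?i (\<phi> p (x + d * v)) - u ?i ?x\<bar>" if v: "0 < v" "v \<le> \<epsilon>" for v
    proof -
      have "\<bar>u ?i (\<phi> p (x + d * v)) - u ?i ?x\<bar> = s * \<bar>u i (x + d * v) - u i x\<bar>"
      proof (cases "d = 1")
        case True
        then show ?thesis
          using eq[OF p(1), of x "x + v"] seg[OF v] v p monotone_familyD[OF mu a(1), of x "x + v"] a(2) seg'[OF v] by auto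
      next
        case False
        then have "d = -1" using d by simp
        then show ?thesis
          using eq[OF p(1), of "x - v" x] seg[OF v] v p monotone_familyD[OF mu a(1), of "x - v" x] a(2) seg'[OF v] by auto
      qed
      then show ?thesis using j[OF v(1) seg'[OF v]] s by simp
    qed
    have sk: "0 < s * \<kappa>" using s \<kappa> by simp
    have ne: "\<phi> p (x + d * v) \<noteq> ?x" if "0 < v" "v \<le> \<epsilon>" for v using big[OF that] sk by auto
    \<comment> \<open>The side of the image point to which the branch moves; the jump makes the
      branch nonconstant arbitrarily near \<open>x\<close>, so this side is well defined.\<close>
    define d' where "d' = sgn (\<phi> p (x + d * \<epsilon>) - ?x)"
    have d': "d' = 1 \<or> d' = -1" using ne[of \<epsilon>] p unfolding d'_def by (auto simp: sgn_if)
    have pos: "0 < d' * (\<phi> p (x + d * v) - ?x)" if v: "0 < v" "v \<le> \<epsilon>" for v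
      using \<phi>_mono[OF p(1)]
    proof
      assume m: "mono_on {lo p..hi p} (\<phi> p)"
      show ?thesis
        using d
      proof
        assume "d = 1"
        then show ?thesis
          using mono_onD[OF m, of x "x + d * v"] mono_onD[OF m, of x "x + d * \<epsilon>"] seg[OF v] p v ne[OF v] ne[of \<epsilon>]
          by (auto simp: d'_def)
      next
        assume "d = -1"
        then show ?thesis
          using mono_onD[OF m, of "x + d * v" x] mono_onD[OF m, of "x + d * \<epsilon>" x] seg[OF v] p v ne[OF v] ne[of \<epsilon>]
          by (auto simp: d'_def sgn_if)
      qed
    next
      assume m: "antimono_on {lo p..hi p} (\<phi> p)"
      show ?thesis
        using d
      proof
        assume "d = 1"
        then show ?thesis
          using monotone_onD[OF m, of x "x + d * v"] monotone_onD[OF m, of x "x + d * \<epsilon>"] seg[OF v] p v ne[OF v] ne[of \<epsilon>]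
          by (auto simp: d'_def sgn_if)
      next
        assume "d = -1"
        then show ?thesis
          using monotone_onD[OF m, of "x + d * v" x] monotone_onD[OF m, of "x + d * \<epsilon>" x] seg[OF v] p v ne[OF v] ne[of \<epsilon>]
          by (auto simp: d'_def sgn_if)
      qed
    qed
    have into: "\<phi> p (x + d * v) \<in> {0..L ?i}" if "0 < v" "v \<le> \<epsilon>" for v using \<phi>_into[OF p(1) seg[OF that]] .
    have xin: "?x \<in> {0..L ?i}" using \<phi>_into[OF p(1,5)] .
    have "J ?i ?x d' (s * \<kappa>)"
      unfolding J_def
    proof (intro conjI allI impI)
      show "?i \<in> I" using tgt p by simp
      show "?x \<in> {0..L ?i}" by (rule xin)
      show "\<bar>d'\<bar> = 1" using d' by auto
      have "?x + d' * (d' * (\<phi> p (x + d * \<epsilon>) - ?x)) = \<phi> p (x + d * \<epsilon>)" using d' by auto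
      then show "\<exists>v>0. ?x + d' * v \<in> {0..L ?i}"
        using pos[of \<epsilon>] into[of \<epsilon>] p by (intro exI[of _ "d' * (\<phi> p (x + d * \<epsilon>) - ?x)"]) auto
      fix w assume w: "0 < w" "?x + d' * w \<in> {0..L ?i}"
      \<comment> \<open>By continuity the branch takes a value strictly between the image point and
        the point at distance \<open>w\<close>. The difference there is already
        \<open>s * \<kappa>\<close>, and monotonicity of \<open>u\<close> carries it out to distance
        \<open>w\<close>.\<close>
      have "continuous_on {0..\<epsilon>} (\<lambda>v. \<phi> p (x + d * v))"
      proof (rule continuous_on_compose2[OF \<phi>_cont[OF p(1)]])
        show "(\<lambda>v. x + d * v) ` {0..\<epsilon>} \<subseteq> {lo p..hi p}"
          using seg p by (force simp: le_less)
      qed (intro continuous_intros)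
      then have "\<exists>\<delta>>0. \<forall>v\<in>{0..\<epsilon>}. \<bar>v - 0\<bar> < \<delta> \<longrightarrow> \<bar>\<phi> p (x + d * v) - \<phi> p (x + d * 0)\<bar> < w"
        using continuous_on_iff[THEN iffD1, rule_format, of "{0..\<epsilon>}" "\<lambda>v. \<phi> p (x + d * v)" 0 w] w(1) p(3)
        by (simp only: dist_real_def) simp
      then obtain \<delta> where \<delta>: "\<delta> > 0" "\<And>v. v \<in> {0..\<epsilon>} \<Longrightarrow> \<bar>v\<bar> < \<delta> \<Longrightarrow> \<bar>\<phi> p (x + d * v) - ?x\<bar> < w"
        by auto
      define v where "v = min \<epsilon> (\<delta>/2)"
      have v: "0 < v" "v \<le> \<epsilon>" "v < \<delta>" using \<delta> p by (auto simp: v_def)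
      have near: "\<bar>\<phi> p (x + d * v) - ?x\<bar> < w" using \<delta>(2)[of v] v by auto
      show "s * \<kappa> \<le> \<bar>u ?i (?x + d' * w) - u ?i ?x\<bar>"
        using d'
      proof
        assume 1: "d' = 1"
        then have o: "?x \<le> \<phi> p (x + d * v)" "\<phi> p (x + d * v) \<le> ?x + w" using pos[OF v(1,2)] near by auto
        show ?thesis
          using big[OF v(1,2)] monotone_familyD[OF mu tgt[OF p(1)], of ?x "\<phi> p (x + d * v)"]
            monotone_familyD[OF mu tgt[OF p(1)], of "\<phi> p (x + d * v)" "?x + w"] o xin into[OF v(1,2)] w 1 by auto
      next
        assume 1: "d' = -1"
        then have o: "\<phi> p (x + d * v) \<le> ?x" "?x - w \<le> \<phi> p (x + d * v)" using pos[OF v(1,2)] near by auto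
        show ?thesis
          using big[OF v(1,2)] monotone_familyD[OF mu tgt[OF p(1)], of "\<phi> p (x + d * v)" ?x]
            monotone_familyD[OF mu tgt[OF p(1)], of "?x - w" "\<phi> p (x + d * v)"] o xin into[OF v(1,2)] w 1 by auto
      qed
    qed
    then show ?thesis by blast
  qed
  have iter: "\<exists>i' x' d'. J i' x' d' (s ^ n * \<kappa>)" if "J i x d \<kappa>" "0 < \<kappa>" for i x d \<kappa> n
  proof (induction n)
    case 0 then show ?case using that by auto
  next
    case (Suc n)
    then obtain i' x' d' where "J i' x' d' (s ^ n * \<kappa>)" by blast
    moreover have "0 < s ^ n * \<kappa>" using s that by simp
    ultimately obtain i'' x'' d'' where "J i'' x'' d'' (s * (s ^ n * \<kappa>))"
      using grow by blast
    moreover have "s * (s ^ n * \<kappa>) = s ^ Suc n * \<kappa>" by simp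
    ultimately show ?case by metis
  qed
  have no_jump: False if J: "J i x d \<kappa>" "0 < \<kappa>" for i x d \<kappa>
  proof -
    obtain n where n: "mass u / \<kappa> < s ^ n" using s real_arch_pow by blast
    obtain i' x' d' where J': "J i' x' d' (s ^ n * \<kappa>)" using iter[OF J] by blast
    then obtain v where v: "i' \<in> I" "x' \<in> {0..L i'}" "x' + d' * v \<in> {0..L i'}" "s ^ n * \<kappa> \<le> \<bar>u i' (x' + d' * v) - u i' x'\<bar>"
      unfolding J_def by blast
    have "u i' 0 \<le> u i' y \<and> u i' y \<le> u i' (L i')" if "y \<in> {0..L i'}" for y
      using monotone_familyD[OF mu v(1)] that by auto
    from this[OF v(2)] this[OF v(3)] have "s ^ n * \<kappa> \<le> mass u"
      using osc_le_mass[OF mu v(1)] v(4) by linarith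
    then show False using n J(2) by (simp add: divide_less_eq)
  qed
  \<comment> \<open>Absence of a jump yields one point with a small difference, and monotonicity
    extends the estimate to everything between it and \<open>x\<close>.\<close>
  have side: "\<exists>\<delta>>0. \<forall>v. 0 \<le> v \<and> v < \<delta> \<and> x + d * v \<in> {0..L i} \<longrightarrow> \<bar>u i (x + d * v) - u i x\<bar> < e"
    if x: "x \<in> {0..L i}" and d: "d = 1 \<or> d = -1" and e: "0 < e" for x d e
  proof (cases "\<exists>v>0. x + d * v \<in> {0..L i}")
    case False
    then have z: "v = 0" if "0 \<le> v" "x + d * v \<in> {0..L i}" for v
      using that le_less by blast
    have "\<bar>u i (x + d * v) - u i x\<bar> < e" if "0 \<le> v" "x + d * v \<in> {0..L i}" for v
      using z[OF that] e by simp
    then show ?thesis using zero_less_one by blast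
  next
    case True
    moreover have "\<bar>d\<bar> = 1" using d by auto
    moreover have "\<not> J i x d e" using no_jump e by blast
    ultimately have "\<not> (\<forall>v>0. x + d * v \<in> {0..L i} \<longrightarrow> e \<le> \<bar>u i (x + d * v) - u i x\<bar>)"
      using i x unfolding J_def by blast
    then obtain w where w: "w > 0" "x + d * w \<in> {0..L i}" "\<bar>u i (x + d * w) - u i x\<bar> < e"
      by (meson not_le)
    have "\<bar>u i (x + d * v) - u i x\<bar> < e" if v: "0 \<le> v" "v < w" "x + d * v \<in> {0..L i}" for v
      using d
    proof
      assume "d = 1" then show ?thesis
        using monotone_familyD[OF mu i, of x "x + v"] monotone_familyD[OF mu i, of "x + v" "x + w"] x v w by auto
    next
      assume "d = -1" then show ?thesis
        using monotone_familyD[OF mu i, of "x - v" x] monotone_familyD[OF mu i, of "x - w" "x - v"] x v w by auto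
    qed
    then show ?thesis using w by blast
  qed
  show ?thesis
    unfolding continuous_on_iff dist_real_def
  proof (intro ballI allI impI)
    fix x e :: real assume x: "x \<in> {0..L i}" and e: "0 < e"
    obtain \<delta>1 where 1: "\<delta>1 > 0" "\<And>v. 0 \<le> v \<Longrightarrow> v < \<delta>1 \<Longrightarrow> x + v \<in> {0..L i} \<Longrightarrow> \<bar>u i (x + v) - u i x\<bar> < e"
      using side[OF x _ e, of 1] by auto
    obtain \<delta>2 where 2: "\<delta>2 > 0" "\<And>v. 0 \<le> v \<Longrightarrow> v < \<delta>2 \<Longrightarrow> x - v \<in> {0..L i} \<Longrightarrow> \<bar>u i (x - v) - u i x\<bar> < e"
      using side[OF x _ e, of "-1"] by auto
    show "\<exists>d>0. \<forall>x'\<in>{0..L i}. \<bar>x' - x\<bar> < d \<longrightarrow> \<bar>u i x' - u i x\<bar> < e"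
    proof (intro exI[of _ "min \<delta>1 \<delta>2"] conjI ballI impI)
      fix y assume y: "y \<in> {0..L i}" "\<bar>y - x\<bar> < min \<delta>1 \<delta>2"
      show "\<bar>u i y - u i x\<bar> < e"
        using 1(2)[of "y - x"] 2(2)[of "x - y"] y by (cases "x \<le> y") auto
    qed (use 1 2 in auto)
  qed
qed

end


section \<open>Traces of connected sets on the edges of a graph\<close>

lemma finite_gap:
  fixes T :: "real set"
  assumes "finite T" "p < q" "{p<..<q} \<inter> T = {}" "a \<in> T" "a \<le> p" "b \<in> T" "q \<le> b"
  obtains s t where "s \<in> T" "t \<in> T" "s \<le> p" "q \<le> t" "{s<..<t} \<inter> T = {}"
proof -
  define s where "s = Max {x \<in> T. x \<le> p}"
  define t where "t = Min {x \<in> T. q \<le> x}"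
  have f: "finite {x \<in> T. x \<le> p}" "finite {x \<in> T. q \<le> x}" "{x \<in> T. x \<le> p} \<noteq> {}" "{x \<in> T. q \<le> x} \<noteq> {}"
    using assms by auto
  have s: "s \<in> {x \<in> T. x \<le> p}" unfolding s_def using f by (intro Max_in) auto
  have t: "t \<in> {x \<in> T. q \<le> x}" unfolding t_def using f by (intro Min_in) auto
  have "x \<notin> T" if "x \<in> {s<..<t}" for x
  proof
    assume x: "x \<in> T"
    consider "x \<le> p" | "q \<le> x" | "x \<in> {p<..<q}" by force
    then show False
    proof cases
      case 1
      then have "x \<le> s" unfolding s_def using x f by (intro Max_ge) auto
      then show False using that by simp
    next
      case 2
      then have "t \<le> x" unfolding t_def using x f by (intro Min_le) auto
      then show False using that by simp
    qed (use x assms in auto)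
  qed
  then show ?thesis using that s t by blast
qed

text \<open>The cuts are the infimum and supremum of \<open>S\<close>: a gap between them that meets
  \<open>S\<close> lies strictly inside the bounds and is filled by convexity.\<close>

lemma tame_interval:
  fixes S :: "real set"
  assumes "is_interval S" "S \<subseteq> {0<..<l}"
  obtains T where "finite T" "\<And>a b. a < b \<Longrightarrow> {a<..<b} \<inter> T = {} \<Longrightarrow> {a<..<b} \<subseteq> S \<or> {a<..<b} \<inter> S = {}"
proof (rule that)
  show "finite {Inf S, Sup S}" by simp
  fix a b assume ab: "a < b" "{a<..<b} \<inter> {Inf S, Sup S} = {}"
  show "{a<..<b} \<subseteq> S \<or> {a<..<b} \<inter> S = {}"
  proof (rule disjCI)
    assume "{a<..<b} \<inter> S \<noteq> {}"
    then obtain x where x: "x \<in> {a<..<b}" "x \<in> S" by blast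
    have bdd: "bdd_below S" "bdd_above S" using assms(2) by (auto intro!: bdd_belowI[of _ 0] bdd_aboveI[of _ l])
    have "Inf S \<le> x" "x \<le> Sup S" using x bdd by (auto intro: cInf_lower cSup_upper)
    then have ends: "Inf S \<le> a" "b \<le> Sup S" using ab x by force+
    show "{a<..<b} \<subseteq> S"
    proof
      fix y assume y: "y \<in> {a<..<b}"
      then have "Inf S < y" "y < Sup S" using ends by auto
      then obtain u v where "u \<in> S" "u < y" "v \<in> S" "y < v"
        using cInf_lessD[of S y] less_cSupD[of S y] x by blast
      then show "y \<in> S" using assms(1) unfolding is_interval_1 by (meson less_imp_le)
    qed
  qed
qed

text \<open>The hypothesis is what remains of connectedness for the trace of a connected set on an open
  edge, since the set may also leave the edge through both ends.\<close>

lemma tame_trace: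
  fixes S :: "real set"
  assumes S: "S \<subseteq> {0<..<l}"
    and conn: "\<And>r p r' q. 0 < r \<Longrightarrow> r' < l \<Longrightarrow> r < p \<Longrightarrow> p < r' \<Longrightarrow> r \<notin> S \<Longrightarrow> r' \<notin> S \<Longrightarrow> p \<in> S \<Longrightarrow> q \<in> S \<Longrightarrow> q \<in> {r<..<r'}"
  shows "is_interval S \<or> is_interval ({0<..<l} - S)"
proof (rule disjCI)
  assume ni: "\<not> is_interval ({0<..<l} - S)"
  then obtain r p r' where a: "r \<in> {0<..<l} - S" "r' \<in> {0<..<l} - S" "r \<le> p" "p \<le> r'" "p \<notin> {0<..<l} - S"
    unfolding is_interval_1 by blast
  then have p: "p \<in> S" "r < p" "p < r'" by (auto simp: le_less)
  show "is_interval S"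
    unfolding is_interval_1
  proof (intro ballI allI impI)
    fix x y z assume xyz: "x \<in> S" "y \<in> S" "x \<le> z \<and> z \<le> y"
    show "z \<in> S"
    proof (rule ccontr)
      assume z: "z \<notin> S"
      have sub: "q \<in> {r<..<r'}" if "q \<in> S" for q using conn[of r r' p q] a p that by auto
      have xz: "x < z" "z < y" using xyz z by (auto simp: le_less)
      have "y \<in> {r<..<z}"
        using conn[of r z x y] sub[OF xyz(1)] xyz xz z a S by auto
      then show False using xz by simp
    qed
  qed
qed

lemma tame_trace_cuts:
  fixes S :: "real set"
  assumes S: "S \<subseteq> {0<..<l}" and "is_interval S \<or> is_interval ({0<..<l} - S)"
  obtains T where "finite T" "\<And>a b. a < b \<Longrightarrow> {a<..<b} \<subseteq> {0<..<l} \<Longrightarrow> {a<..<b} \<inter> T = {} \<Longrightarrow> {a<..<b} \<subseteq> S \<or> {a<..<b} \<inter> S = {}"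
  using assms(2)
proof
  assume "is_interval S"
  from tame_interval[OF this S] obtain T where
    T: "finite T" "\<And>a b. a < b \<Longrightarrow> {a<..<b} \<inter> T = {} \<Longrightarrow> {a<..<b} \<subseteq> S \<or> {a<..<b} \<inter> S = {}" by blast
  show ?thesis by (rule that[OF T(1)]) (use T in blast)
next
  assume "is_interval ({0<..<l} - S)"
  from tame_interval[OF this, of l] obtain T where
    T: "finite T" "\<And>a b. a < b \<Longrightarrow> {a<..<b} \<inter> T = {} \<Longrightarrow> {a<..<b} \<subseteq> {0<..<l} - S \<or> {a<..<b} \<inter> ({0<..<l} - S) = {}" by blast
  show ?thesis by (rule that[OF T(1)]) (use T in blast)
qed

section \<open>Topology of a parametrized graph\<close>

locale graph =
  fixes X :: "'a topology" and V :: "'a set" and E :: "'a graph_edge set"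
  assumes param: "graph_parametrization X V E"
begin

lemma Hausdorff: "Hausdorff_space X" and finite_V: "finite V" and V_sub: "V \<subseteq> topspace X"
  and finite_E: "finite E" and E_ne: "E \<noteq> {}"
  using param by (auto simp: graph_parametrization_def)

lemma edge:
  assumes "e \<in> E"
  shows edge_pos: "0 < fst e" and edge_cont: "continuous_map (top_of_set {0..fst e}) X (snd e)"
    and edge_inj: "inj_on (snd e) {0<..<fst e}" and edge_0: "snd e 0 \<in> V" and edge_l: "snd e (fst e) \<in> V"
    and edge_disj: "snd e ` {0<..<fst e} \<inter> V = {}"
proof -
  obtain l \<gamma> where e: "e = (l, \<gamma>)" by (cases e)
  have "0 < l \<and> continuous_map (top_of_set {0..l}) X \<gamma> \<and> inj_on \<gamma> {0<..<l} \<and>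
       \<gamma> 0 \<in> V \<and> \<gamma> l \<in> V \<and> \<gamma> ` {0<..<l} \<inter> V = {}"
    using param assms unfolding graph_parametrization_def e by blast
  then show "0 < fst e" "continuous_map (top_of_set {0..fst e}) X (snd e)"
    "inj_on (snd e) {0<..<fst e}" "snd e 0 \<in> V" "snd e (fst e) \<in> V"
    "snd e ` {0<..<fst e} \<inter> V = {}"
    by (simp_all add: e)
qed

lemma open_edge_eq: "open_edge e = snd e ` {0<..<fst e}"
  by (simp add: open_edge_def split: prod.split)

lemma edges_disjnt: "e \<in> E \<Longrightarrow> e' \<in> E \<Longrightarrow> e \<noteq> e' \<Longrightarrow> open_edge e \<inter> open_edge e' = {}"
  using param unfolding graph_parametrization_def pairwise_def disjnt_def by blast

lemma topspace_eq: "topspace X = V \<union> (\<Union>e\<in>E. open_edge e)"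
  using param unfolding graph_parametrization_def by blast

lemma edge_in: "e \<in> E \<Longrightarrow> t \<in> {0..fst e} \<Longrightarrow> snd e t \<in> topspace X"
  using continuous_map_image_subset_topspace[OF edge_cont, of e] by auto

lemma edge_V_iff:
  assumes "e \<in> E" "t \<in> {0..fst e}" shows "snd e t \<in> V \<longleftrightarrow> t = 0 \<or> t = fst e"
proof -
  have "snd e t \<notin> V" if "t \<noteq> 0" "t \<noteq> fst e"
  proof -
    have "t \<in> {0<..<fst e}" using assms that by auto
    then show ?thesis using edge_disj[OF assms(1)] by blast
  qed
  then show ?thesis using edge_0[OF assms(1)] edge_l[OF assms(1)] by blast
qed

text \<open>Only \<open>t\<close> is assumed interior. The other parameter cannot be an end, since
  ends are sent to vertices and open edges avoid them.\<close>

lemma edge_param_unique: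
  assumes "e \<in> E" "e' \<in> E" "t \<in> {0<..<fst e}" "t' \<in> {0..fst e'}" "snd e t = snd e' t'"
  shows "e' = e \<and> t' = t"
proof -
  have "snd e t \<notin> V" using edge_disj[OF assms(1)] assms(3) by blast
  then have "snd e' t' \<notin> V" using assms(5) by simp
  then have t': "t' \<in> {0<..<fst e'}" using edge_V_iff[OF assms(2,4)] assms(4) by auto
  have "e' = e"
  proof (rule ccontr)
    assume "e' \<noteq> e"
    then have "open_edge e \<inter> open_edge e' = {}" using edges_disjnt assms by blast
    moreover have "snd e t \<in> open_edge e" "snd e t \<in> open_edge e'"
      unfolding open_edge_eq using assms(3) t' assms(5) by (blast, metis imageI)
    ultimately show False by blast
  qed
  then show ?thesis using edge_inj[OF assms(1)] assms t' by (auto dest: inj_onD)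
qed

lemma compactin_edge: "e \<in> E \<Longrightarrow> compact K \<Longrightarrow> K \<subseteq> {0..fst e} \<Longrightarrow> compactin X (snd e ` K)"
  by (rule image_compactin[OF _ edge_cont]) (auto simp: compactin_subtopology)

lemma closedin_edge: "e \<in> E \<Longrightarrow> compact K \<Longrightarrow> K \<subseteq> {0..fst e} \<Longrightarrow> closedin X (snd e ` K)"
  by (intro compactin_imp_closedin Hausdorff compactin_edge)

lemma closedin_V: "S \<subseteq> V \<Longrightarrow> closedin X S"
  by (meson Hausdorff V_sub closedin_Hausdorff_finite dual_order.trans finite_V finite_subset)

lemma connectedin_edge: "e \<in> E \<Longrightarrow> connected K \<Longrightarrow> K \<subseteq> {0..fst e} \<Longrightarrow> connectedin X (snd e ` K)"
  by (rule connectedin_continuous_map_image[OF edge_cont]) (auto simp: connectedin_subtopology)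

lemma topspace_edges: "topspace X = V \<union> (\<Union>e\<in>E. snd e ` {0..fst e})"
proof -
  have "snd e ` {0..fst e} \<subseteq> topspace X" if "e \<in> E" for e using edge_in that by blast
  moreover have "open_edge e \<subseteq> snd e ` {0..fst e}" for e by (auto simp: open_edge_eq)
  ultimately have "(\<Union>e\<in>E. open_edge e) \<subseteq> (\<Union>e\<in>E. snd e ` {0..fst e})" "(\<Union>e\<in>E. snd e ` {0..fst e}) \<subseteq> topspace X"
    by (meson UN_mono order_refl, meson UN_least)
  then show ?thesis using V_sub topspace_eq by (intro equalityI) auto
qed

lemma compact_space: "compact_space X"
proof -
  have "compactin X (V \<union> (\<Union>e\<in>E. snd e ` {0..fst e}))"
  proof (intro compactin_Un compactin_Union)
    show "compactin X V" using V_sub finite_V by (rule finite_imp_compactin)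
    show "finite ((\<lambda>e. snd e ` {0..fst e}) ` E)" using finite_E by simp
    fix S assume "S \<in> (\<lambda>e. snd e ` {0..fst e}) ` E"
    then show "compactin X S" using compactin_edge[OF _ compact_Icc order_refl] by blast
  qed
  then show ?thesis by (simp add: compact_space_def topspace_edges)
qed

text \<open>The complement is the union of the vertices, the other closed edges and the rest of this
  edge: finitely many compact sets, closed in a Hausdorff space.\<close>

lemma openin_edge:
  assumes e: "e \<in> E" and A: "open A" "A \<subseteq> {0<..<fst e}"
  shows "openin X (snd e ` A)"
proof -
  let ?C = "V \<union> (\<Union>e'\<in>E - {e}. snd e' ` {0..fst e'}) \<union> snd e ` ({0..fst e} - A)"
  have "closedin X (\<Union>e'\<in>E - {e}. snd e' ` {0..fst e'})"
    using finite_E closedin_edge[OF _ compact_Icc order_refl]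
    by (intro closedin_Union) blast+
  moreover have "closedin X (snd e ` ({0..fst e} - A))"
    using A by (intro closedin_edge e compact_diff) auto
  ultimately have "closedin X ?C"
    using closedin_V[OF order_refl] by (simp add: closedin_Un)
  moreover have "snd e ` A = topspace X - ?C"
  proof (intro equalityI subsetI)
    fix x assume "x \<in> snd e ` A"
    then obtain t where t: "t \<in> A" "x = snd e t" by auto
    then have t0: "t \<in> {0<..<fst e}" using A by auto
    have "x \<notin> V" using edge_disj[OF e] t0 t by blast
    moreover have "x \<notin> snd e' ` ({0..fst e'})" if "e' \<in> E - {e}" for e'
    proof
      assume "x \<in> snd e' ` {0..fst e'}"
      then obtain t' where "t' \<in> {0..fst e'}" "snd e t = snd e' t'" using t by auto
      from edge_param_unique[OF e _ t0 this] show False using that by blast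
    qed
    moreover have "x \<notin> snd e ` ({0..fst e} - A)"
    proof
      assume "x \<in> snd e ` ({0..fst e} - A)"
      then obtain t' where "t' \<in> {0..fst e}" "t' \<notin> A" "snd e t = snd e t'" using t by auto
      moreover from this have "t' = t" using edge_param_unique[OF e e t0] by blast
      ultimately show False using t by blast
    qed
    moreover have "x \<in> topspace X" using edge_in[OF e, of t] t t0 by auto
    ultimately show "x \<in> topspace X - ?C" by blast
  next
    fix x assume x: "x \<in> topspace X - ?C"
    have "x \<in> (\<Union>e\<in>E. snd e ` {0..fst e})" using x unfolding topspace_edges by auto
    then obtain e' where e': "e' \<in> E" "x \<in> snd e' ` {0..fst e'}" by (rule UN_E)
    then have "e' = e" using x by auto
    then obtain t where "x = snd e t" "t \<in> {0..fst e}" using e' by auto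
    then show "x \<in> snd e ` A" using x by auto
  qed
  ultimately show ?thesis by (simp add: openin_diff)
qed

lemma openin_open_edge: "e \<in> E \<Longrightarrow> openin X (open_edge e)"
  unfolding open_edge_eq by (rule openin_edge) auto

text \<open>If both ends of \<open>{r<..<r'}\<close> are outside the trace, the image of this
  interval is clopen relative to \<open>S\<close>: it is open, and adding the two ends adds no point
  of \<open>S\<close>. A connected \<open>S\<close> that meets it is therefore contained in it,
  which is the hypothesis of \<open>tame_trace\<close>.\<close>

lemma connectedin_trace:
  assumes e: "e \<in> E" and S: "connectedin X S"
  defines "S' \<equiv> {t \<in> {0<..<fst e}. snd e t \<in> S}"
  shows "is_interval S' \<or> is_interval ({0<..<fst e} - S')"
proof (rule tame_trace)
  show "S' \<subseteq> {0<..<fst e}" by (auto simp: S'_def)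
  fix r p r' q assume a: "0 < r" "r' < fst e" "r < p" "p < r'" "r \<notin> S'" "r' \<notin> S'" "p \<in> S'" "q \<in> S'"
  let ?U = "snd e ` {r<..<r'}" and ?C = "snd e ` {r..r'}"
  have "openin X ?U" using a by (intro openin_edge e) auto
  moreover have "closedin X ?C" using a by (intro closedin_edge e) auto
  moreover have "S \<inter> ?U = S \<inter> ?C"
  proof -
    have "{r..r'} = insert r (insert r' {r<..<r'})" using a by auto
    moreover have "snd e r \<notin> S" "snd e r' \<notin> S" using a by (auto simp: S'_def)
    ultimately show ?thesis by auto
  qed
  ultimately have "openin (subtopology X S) (S \<inter> ?U)" and "closedin (subtopology X S) (S \<inter> ?U)"
    using openin_subtopology_Int2[of X ?U S] closedin_subtopology_Int_closed[of X ?C S] by metis+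
  moreover have "connected_space (subtopology X S)" "topspace (subtopology X S) = S"
    using S by (auto simp: connectedin_def)
  ultimately have "S \<inter> ?U = {} \<or> S \<inter> ?U = S"
    unfolding connected_space_clopen_in by simp
  moreover have "snd e p \<in> S \<inter> ?U" using a by (auto simp: S'_def)
  ultimately have "snd e q \<in> ?U" using a by (auto simp: S'_def)
  then obtain t where t: "t \<in> {r<..<r'}" "snd e q = snd e t" by auto
  then have "q = t"
    using edge_param_unique[OF e e, of t q] a by (auto simp: S'_def)
  then show "q \<in> {r<..<r'}" using t by simp
qed

text \<open>Off the vertices the graph is a disjoint union of open sets, the open edges.\<close>

lemma connectedin_open_edge:
  assumes "connectedin X S" "S \<inter> V = {}" "S \<noteq> {}"
  obtains e where "e \<in> E" "S \<subseteq> open_edge e"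
proof -
  have sub: "S \<subseteq> topspace X" using assms connectedin_subset_topspace by blast
  obtain x where x: "x \<in> S" using assms by auto
  then have "x \<in> (\<Union>e\<in>E. open_edge e)" using sub assms(2) topspace_eq by auto
  then obtain e where e: "e \<in> E" "x \<in> open_edge e" by blast
  have op: "openin X (\<Union>e'\<in>E-{e}. open_edge e')" using openin_open_edge by blast
  then have "S \<inter> open_edge e = {} \<or> S \<inter> (\<Union>e'\<in>E-{e}. open_edge e') = {}"
  proof -
    have "S \<subseteq> open_edge e \<union> (\<Union>e'\<in>E-{e}. open_edge e')"
    proof
      fix y assume "y \<in> S"
      then have "y \<in> (\<Union>e\<in>E. open_edge e)" using sub assms(2) topspace_eq by auto
      then show "y \<in> open_edge e \<union> (\<Union>e'\<in>E-{e}. open_edge e')" by auto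
    qed
    moreover have "open_edge e \<inter> (\<Union>e'\<in>E-{e}. open_edge e') \<inter> S = {}"
      using edges_disjnt[OF e(1)] by fastforce
    ultimately show ?thesis
      using connectedinD[OF assms(1) openin_open_edge[OF e(1)], of "\<Union>e'\<in>E-{e}. open_edge e'"] op by blast
  qed
  moreover have "y \<in> (\<Union>e\<in>E. open_edge e)" if "y \<in> S" for y using that sub assms(2) topspace_eq by auto
  ultimately have "S \<subseteq> open_edge e" using x e by blast
  then show ?thesis using that e by blast
qed

text \<open>The edges of length zero serve as targets for branches that are constant at a vertex, which may
  be isolated.\<close>

definition all_edges :: "'a graph_edge set"
  where "all_edges = E \<union> (\<lambda>v. (0, \<lambda>_. v)) ` V"

lemma finite_all_edges: "finite all_edges" by (simp add: all_edges_def finite_E finite_V)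

lemma all_edges_nonneg: "e \<in> all_edges \<Longrightarrow> 0 \<le> fst e"
  using edge_pos[of e] by (auto simp: all_edges_def)

lemma all_edges_pos: "e \<in> all_edges \<Longrightarrow> 0 < fst e \<Longrightarrow> e \<in> E"
  by (auto simp: all_edges_def)

lemma all_edges_cont: "e \<in> all_edges \<Longrightarrow> continuous_map (top_of_set {0..fst e}) X (snd e)"
  using edge_cont V_sub by (auto simp: all_edges_def)

lemma all_edges_cover: "x \<in> topspace X \<Longrightarrow> \<exists>e\<in>all_edges. \<exists>t\<in>{0..fst e}. x = snd e t"
proof -
  assume "x \<in> topspace X"
  then consider "x \<in> V" | e where "e \<in> E" "x \<in> snd e ` {0..fst e}" unfolding topspace_edges by blast
  then show ?thesis
  proof cases
    case 1
    then show ?thesis by (intro bexI[of _ "(0, \<lambda>_. x)"]) (auto simp: all_edges_def)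
  next
    case 2
    then show ?thesis by (intro bexI[of _ e]) (auto simp: all_edges_def)
  qed
qed

end


section \<open>Monotone branches of a piecewise monotone graph map\<close>

lemma at_within_Ioo_right: "p < q \<Longrightarrow> at p within {p<..<q} = at_right (p::real)"
  by (rule at_within_nhd[of _ "{..<q}"]) auto

lemma at_within_Ioo_left: "p < q \<Longrightarrow> at q within {p<..<q} = at_left (q::real)"
  by (rule at_within_nhd[of _ "{p<..}"]) auto

text \<open>The end values are the infimum and supremum of the values, which are the one-sided
  limits of a monotone function.\<close>

lemma mono_extension:
  fixes g :: "real \<Rightarrow> real"
  assumes pq: "p < q" and c: "continuous_on {p<..<q} g" and m: "mono_on {p<..<q} g"
    and into: "g ` {p<..<q} \<subseteq> {0..l}"
  obtains h where "continuous_on {p..q} h" "mono_on {p..q} h" "h ` {p..q} \<subseteq> {0..l}" "\<And>x. x \<in> {p<..<q} \<Longrightarrow> h x = g x"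
proof -
  define a where "a = Inf (g ` {p<..<q})"
  define b where "b = Sup (g ` {p<..<q})"
  have ne: "g ` {p<..<q} \<noteq> {}" using pq by simp
  have bdd: "bdd_below (g ` {p<..<q})" "bdd_above (g ` {p<..<q})"
    using into by (auto intro!: bdd_belowI[of _ 0] bdd_aboveI[of _ l])
  have into': "0 \<le> g x" "g x \<le> l" if "p < x" "x < q" for x
    using into that by (auto simp: image_subset_iff)
  have ab: "a \<le> g x" "g x \<le> b" if "x \<in> {p<..<q}" for x
    unfolding a_def b_def using that bdd by (auto intro!: cInf_lower cSup_upper)
  have a0: "0 \<le> a" unfolding a_def using into ne by (intro cInf_greatest) auto
  have bl: "b \<le> l" unfolding b_def using into ne by (intro cSup_least) auto
  define h where "h x = (if x \<le> p then a else if q \<le> x then b else g x)" for x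
  have hg: "h x = g x" if "x \<in> {p<..<q}" for x using that by (simp add: h_def)
  have mono: "mono_on {p..q} h"
  proof (rule mono_onI)
    fix x y assume xy: "x \<in> {p..q}" "y \<in> {p..q}" "x \<le> y"
    have mid: "(p+q)/2 \<in> {p<..<q}" using pq by auto
    have "a \<le> b" using ab[OF mid] by simp
    then show "h x \<le> h y"
      using xy ab mono_onD[OF m, of x y] unfolding h_def by auto
  qed
  have cont: "continuous_on {p..q} h"
  proof (rule continuous_on_IccI)
    have "(g \<longlongrightarrow> Inf (g ` ({p<..} \<inter> {..<q}))) (at p within ({p<..} \<inter> {..<q}))"
      by (rule Lim_right_bound[where K = 0]) (use into' in \<open>auto intro!: mono_onD[OF m]\<close>)
    moreover have "{p<..} \<inter> {..<q} = {p<..<q}" by auto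
    moreover have "at p within {p<..<q} = at_right p" using pq by (rule at_within_Ioo_right)
    ultimately have "(g \<longlongrightarrow> a) (at_right p)" by (simp add: a_def)
    moreover have "\<forall>\<^sub>F x in at_right p. g x = h x"
      using eventually_at_right_real[OF pq] by eventually_elim (simp add: hg)
    ultimately have "(h \<longlongrightarrow> a) (at_right p)" by (rule Lim_transform_eventually)
    then show "(h \<longlongrightarrow> h p) (at_right p)" by (simp add: h_def)
    have "(g \<longlongrightarrow> Sup (g ` ({..<q} \<inter> {p<..}))) (at q within ({..<q} \<inter> {p<..}))"
      by (rule Lim_left_bound[where K = l]) (use into' in \<open>auto intro!: mono_onD[OF m]\<close>)
    moreover have "{..<q} \<inter> {p<..} = {p<..<q}" by auto
    moreover have "at q within {p<..<q} = at_left q" using pq by (rule at_within_Ioo_left)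
    ultimately have "(g \<longlongrightarrow> b) (at_left q)" by (simp add: b_def)
    moreover have "\<forall>\<^sub>F x in at_left q. g x = h x"
      using eventually_at_left_real[OF pq] by eventually_elim (simp add: hg)
    ultimately have "(h \<longlongrightarrow> b) (at_left q)" by (rule Lim_transform_eventually)
    then show "(h \<longlongrightarrow> h q) (at_left q)" using pq by (simp add: h_def)
    fix x assume x: "p < x" "x < q"
    then have "x \<in> {p<..<q}" by simp
    then have "g \<midarrow>x\<rightarrow> g x" using c continuous_on_eq_continuous_at[of "{p<..<q}" g] by (simp add: isCont_def)
    moreover have "\<forall>\<^sub>F y in at x. y \<in> {p<..<q}"
      by (rule eventually_at_in_open') (use x in auto)
    then have "\<forall>\<^sub>F y in at x. g y = h y" by eventually_elim (simp add: hg)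
    ultimately have "h \<midarrow>x\<rightarrow> g x" by (rule Lim_transform_eventually)
    then show "h \<midarrow>x\<rightarrow> h x" using x by (simp add: hg)
  qed (rule pq)
  have "h ` {p..q} \<subseteq> {0..l}"
  proof -
    have mid: "(p+q)/2 \<in> {p<..<q}" using pq by auto
    have "a \<le> b" using ab[OF mid] by simp
    moreover have "g x \<in> {0..l}" if "x \<in> {p<..<q}" for x using into that by blast
    ultimately show ?thesis using a0 bl unfolding h_def by auto
  qed
  then show ?thesis using that cont mono hg by blast
qed

lemma monotone_extension:
  fixes g :: "real \<Rightarrow> real"
  assumes pq: "p < q" and c: "continuous_on {p<..<q} g" and m: "mono_on {p<..<q} g \<or> antimono_on {p<..<q} g"
    and into: "g ` {p<..<q} \<subseteq> {0..l}"
  obtains h where "continuous_on {p..q} h" "mono_on {p..q} h \<or> antimono_on {p..q} h" "h ` {p..q} \<subseteq> {0..l}"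
    "\<And>x. x \<in> {p<..<q} \<Longrightarrow> h x = g x"
  using m
proof
  assume "mono_on {p<..<q} g"
  from mono_extension[OF pq c this into] show ?thesis using that by metis
next
  assume a: "antimono_on {p<..<q} g"
  have "continuous_on {p<..<q} (\<lambda>x. l - g x)" by (intro continuous_intros c)
  moreover have "mono_on {p<..<q} (\<lambda>x. l - g x)"
    using monotone_onD[OF a] by (intro mono_onI) simp
  moreover have "(\<lambda>x. l - g x) ` {p<..<q} \<subseteq> {0..l}" using into by auto
  ultimately obtain h where h: "continuous_on {p..q} h" "mono_on {p..q} h" "h ` {p..q} \<subseteq> {0..l}"
    "\<And>x. x \<in> {p<..<q} \<Longrightarrow> h x = l - g x"
    using mono_extension[OF pq] by metis
  show ?thesis
  proof (rule that[of "\<lambda>x. l - h x"])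
    show "continuous_on {p..q} (\<lambda>x. l - h x)" by (intro continuous_intros h)
    show "mono_on {p..q} (\<lambda>x. l - h x) \<or> antimono_on {p..q} (\<lambda>x. l - h x)"
      using mono_onD[OF h(2)] by (intro disjI2 monotone_onI) simp
  qed (use h in auto)
qed

lemma connected_fibres_imp_monotone:
  fixes g :: "real \<Rightarrow> real"
  assumes "is_interval S" "continuous_on S g" "\<And>y. is_interval {x \<in> S. g x = y}"
  shows "mono_on S g \<or> antimono_on S g"
proof -
  have "monotone_map (top_of_set S) euclideanreal g"
    unfolding monotone_map using assms(3)
    by (auto simp: connectedin_subtopology is_interval_connected_1)
  then show ?thesis using monotone_map_euclideanreal[OF assms(1,2)] by simp
qed

lemma Icc_Ioo: "{p..q} \<inter> {p<..<q} = {p<..<q::real}"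
  by auto

context graph begin

text \<open>The lift \<open>\<phi>\<close> is part of the data: at a vertex, which may lie on
  several edges or be both ends of a loop, the value of \<open>f\<close> determines neither the edge
  nor the coordinate.\<close>

definition branch :: "('a \<Rightarrow> 'a) \<Rightarrow> 'a graph_edge \<Rightarrow> real \<Rightarrow> real \<Rightarrow> 'a graph_edge \<Rightarrow> (real \<Rightarrow> real) \<Rightarrow> bool"
  where "branch f e s t e' \<phi> \<longleftrightarrow> e' \<in> all_edges \<and> continuous_on {s..t} \<phi> \<and>
    (mono_on {s..t} \<phi> \<or> antimono_on {s..t} \<phi>) \<and>
    (\<forall>u\<in>{s..t}. \<phi> u \<in> {0..fst e'} \<and> f (snd e u) = snd e' (\<phi> u))"

text \<open>An interval free of all cuts lies in a single gap of \<open>T\<close>, where the local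
  cut set decides.\<close>

lemma cuts_combine:
  assumes T: "finite T" "0 \<in> T" "l \<in> T" "T \<subseteq> {0..l}"
    and Q: "\<And>s t. s \<in> T \<Longrightarrow> t \<in> T \<Longrightarrow> s < t \<Longrightarrow> {s<..<t} \<inter> T = {} \<Longrightarrow>
      \<exists>T'. finite T' \<and> (\<forall>p q. s \<le> p \<longrightarrow> p < q \<longrightarrow> q \<le> t \<longrightarrow> {p<..<q} \<inter> T' = {} \<longrightarrow> Q p q)"
  obtains T' where "finite T'" "0 \<in> T'" "l \<in> T'" "T' \<subseteq> {0..l}"
    "\<And>p q. 0 \<le> p \<Longrightarrow> p < q \<Longrightarrow> q \<le> (l::real) \<Longrightarrow> {p<..<q} \<inter> T' = {} \<Longrightarrow> Q p q"
proof -
  define G where "G = {(s, t) \<in> T \<times> T. s < t \<and> {s<..<t} \<inter> T = {}}"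
  have "\<forall>g\<in>G. \<exists>T'. finite T' \<and> (\<forall>p q. fst g \<le> p \<longrightarrow> p < q \<longrightarrow> q \<le> snd g \<longrightarrow> {p<..<q} \<inter> T' = {} \<longrightarrow> Q p q)"
    using Q by (auto simp: G_def)
  then obtain C where C: "\<And>g. g \<in> G \<Longrightarrow> finite (C g) \<and> (\<forall>p q. fst g \<le> p \<longrightarrow> p < q \<longrightarrow> q \<le> snd g \<longrightarrow> {p<..<q} \<inter> C g = {} \<longrightarrow> Q p q)"
    by metis
  have G: "finite G" by (rule finite_subset[of _ "T \<times> T"]) (auto simp: G_def T(1))
  define T' where "T' = T \<union> ((\<Union>g\<in>G. C g) \<inter> {0..l})"
  show ?thesis
  proof (rule that[of T'])
    show "finite T'" using T(1) G C by (simp add: T'_def)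
    fix p q assume pq: "0 \<le> p" "p < q" "q \<le> l" "{p<..<q} \<inter> T' = {}"
    then have "{p<..<q} \<inter> T = {}" by (auto simp: T'_def)
    from finite_gap[OF T(1) pq(2) this T(2) pq(1) T(3) pq(3)]
    obtain s t where st: "s \<in> T" "t \<in> T" "s \<le> p" "q \<le> t" "{s<..<t} \<inter> T = {}" by metis
    then have g: "(s, t) \<in> G" using pq by (auto simp: G_def)
    have "{p<..<q} \<inter> C (s, t) = {}" using pq g by (fastforce simp: T'_def)
    then show "Q p q" using C[OF g] st pq by auto
  qed (use T in \<open>auto simp: T'_def\<close>)
qed

text \<open>The image of the open interval is connected and avoids the vertices, hence lies in one
  open edge. The parametrization of that edge is open on its interior, so \<open>f\<close> lifts
  continuously; connected fibres make the lift monotone. It extends to the ends, where the lifting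
  equation holds by density.\<close>

lemma branch_off_vertices:
  assumes e: "e \<in> E" and f: "continuous_map X X f" and pq: "0 \<le> p" "p < q" "q \<le> fst e"
    and off: "\<And>t. t \<in> {p<..<q} \<Longrightarrow> f (snd e t) \<notin> V"
    and fib: "\<And>y. is_interval {t \<in> {p<..<q}. f (snd e t) = y}"
  shows "\<exists>e' \<phi>. branch f e p q e' \<phi>"
proof -
  let ?h = "\<lambda>t. f (snd e t)"
  have hc: "continuous_map (top_of_set {p..q}) X ?h"
  proof -
    have "continuous_map (top_of_set {0..fst e}) X ?h"
      using continuous_map_compose[OF edge_cont[OF e] f] by (simp add: o_def)
    then show ?thesis
      by (rule continuous_map_from_subtopology_mono) (use pq in auto)
  qed
  have hc': "continuous_map (top_of_set {p<..<q}) X ?h"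
    by (rule continuous_map_from_subtopology_mono[OF hc]) auto
  have "connectedin X (?h ` {p<..<q})"
    by (rule connectedin_continuous_map_image[OF hc']) (auto simp: connectedin_subtopology)
  moreover have "?h ` {p<..<q} \<inter> V = {}" using off by blast
  moreover have "?h ` {p<..<q} \<noteq> {}" using pq by simp
  ultimately obtain e' where e': "e' \<in> E" "?h ` {p<..<q} \<subseteq> open_edge e'"
    using connectedin_open_edge by blast
  define g where "g t = inv_into {0<..<fst e'} (snd e') (?h t)" for t
  have g: "g t \<in> {0<..<fst e'}" "snd e' (g t) = ?h t" if "t \<in> {p<..<q}" for t
  proof -
    have "?h t \<in> snd e' ` {0<..<fst e'}" using e'(2) that by (auto simp: open_edge_eq)
    then show "g t \<in> {0<..<fst e'}" "snd e' (g t) = ?h t"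
      unfolding g_def by (rule inv_into_into, rule f_inv_into_f)
  qed
  have gc: "continuous_on {p<..<q} g"
  proof -
    have "\<exists>A. open A \<and> A \<inter> {p<..<q} = g -` B \<inter> {p<..<q}" if B: "open B" for B
    proof -
      have "openin X (snd e' ` (B \<inter> {0<..<fst e'}))" using B by (intro openin_edge e') auto
      then have "openin (top_of_set {p<..<q}) {t \<in> topspace (top_of_set {p<..<q}). ?h t \<in> snd e' ` (B \<inter> {0<..<fst e'})}"
        by (rule openin_continuous_map_preimage[OF hc'])
      moreover have "{t \<in> topspace (top_of_set {p<..<q}). ?h t \<in> snd e' ` (B \<inter> {0<..<fst e'})} = g -` B \<inter> {p<..<q}"
      proof (intro equalityI subsetI)
        fix t assume t: "t \<in> {t \<in> topspace (top_of_set {p<..<q}). ?h t \<in> snd e' ` (B \<inter> {0<..<fst e'})}"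
        then obtain b where b: "b \<in> B" "b \<in> {0<..<fst e'}" "?h t = snd e' b" and tt: "t \<in> {p<..<q}" by auto
        have "g t = b" using g[OF tt] b inj_onD[OF edge_inj[OF e'(1)], of "g t" b] by simp
        then show "t \<in> g -` B \<inter> {p<..<q}" using b tt by simp
      next
        fix t assume t: "t \<in> g -` B \<inter> {p<..<q}"
        then have "?h t = snd e' (g t)" "g t \<in> B \<inter> {0<..<fst e'}" using g[of t] by auto
        then show "t \<in> {t \<in> topspace (top_of_set {p<..<q}). ?h t \<in> snd e' ` (B \<inter> {0<..<fst e'})}" using t by auto
      qed
      ultimately show ?thesis unfolding openin_open by (metis inf_commute)
    qed
    then show ?thesis unfolding continuous_on_open_invariant by blast
  qed
  have "is_interval {t \<in> {p<..<q}. g t = y}" for y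
  proof -
    have "{t \<in> {p<..<q}. g t = y} = (if y \<in> {0<..<fst e'} then {t \<in> {p<..<q}. ?h t = snd e' y} else {})"
    proof (cases "y \<in> {0<..<fst e'}")
      case True
      have "g t = y \<longleftrightarrow> ?h t = snd e' y" if "t \<in> {p<..<q}" for t
        using inj_onD[OF edge_inj[OF e'(1)], of "g t" y] g[OF that] True by metis
      then show ?thesis using True by auto
    next
      case False
      then show ?thesis using g(1) by auto
    qed
    then show ?thesis using fib by simp
  qed
  then have "mono_on {p<..<q} g \<or> antimono_on {p<..<q} g"
    by (intro connected_fibres_imp_monotone gc is_interval_oo)
  moreover have "g ` {p<..<q} \<subseteq> {0..fst e'}"
  proof (rule image_subsetI)
    fix t assume "t \<in> {p<..<q}"
    then show "g t \<in> {0..fst e'}" using g(1)[of t] by simp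
  qed
  ultimately obtain \<phi> where \<phi>: "continuous_on {p..q} \<phi>" "mono_on {p..q} \<phi> \<or> antimono_on {p..q} \<phi>" "\<phi> ` {p..q} \<subseteq> {0..fst e'}"
    "\<And>x. x \<in> {p<..<q} \<Longrightarrow> \<phi> x = g x"
    by (rule monotone_extension[OF pq(2) gc]) (rule that)
  have "?h u = snd e' (\<phi> u)" if "u \<in> {p..q}" for u
  proof (rule forall_in_closure_of_eq[where X = "top_of_set {p..q}" and Y = X and S = "{p<..<q}" and f = ?h and g = "\<lambda>u. snd e' (\<phi> u)"])
    show "u \<in> top_of_set {p..q} closure_of {p<..<q}"
      using that pq Icc_Ioo[of p q] by (simp add: closure_of_subtopology)
    have "continuous_map (top_of_set {p..q}) (top_of_set {0..fst e'}) \<phi>"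
      using \<phi> by auto
    from continuous_map_compose[OF this edge_cont[OF e'(1)]]
    show "continuous_map (top_of_set {p..q}) X (\<lambda>u. snd e' (\<phi> u))" by (simp add: o_def)
  qed (use Hausdorff hc \<phi> g in auto)
  then have "branch f e p q e' \<phi>"
    unfolding branch_def all_edges_def using e' \<phi> by blast
  then show ?thesis by blast
qed

lemma branch_const:
  assumes e: "e \<in> E" and f: "continuous_map X X f" and pq: "0 \<le> p" "p < q" "q \<le> fst e"
    and v: "v \<in> V" "\<And>t. t \<in> {p<..<q} \<Longrightarrow> f (snd e t) = v"
  shows "\<exists>e' \<phi>. branch f e p q e' \<phi>"
proof -
  have hc: "continuous_map (top_of_set {p..q}) X (\<lambda>t. f (snd e t))"
  proof -
    have "continuous_map (top_of_set {0..fst e}) X (\<lambda>t. f (snd e t))"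
      using continuous_map_compose[OF edge_cont[OF e] f] by (simp add: o_def)
    then show ?thesis
      by (rule continuous_map_from_subtopology_mono) (use pq in auto)
  qed
  have "f (snd e u) = v" if "u \<in> {p..q}" for u
  proof (rule forall_in_closure_of_eq[where X = "top_of_set {p..q}" and Y = X and S = "{p<..<q}" and f = "\<lambda>t. f (snd e t)" and g = "\<lambda>_. v"])
    show "u \<in> top_of_set {p..q} closure_of {p<..<q}"
      using that pq Icc_Ioo[of p q] by (simp add: closure_of_subtopology)
    show "continuous_map (top_of_set {p..q}) X (\<lambda>u. v)" using v V_sub by auto
  qed (use Hausdorff hc v in auto)
  then have "branch f e p q (0, \<lambda>_. v) (\<lambda>_. 0)"
    using v by (auto simp: branch_def all_edges_def mono_on_def)
  then show ?thesis by blast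
qed

lemma is_interval_restrict:
  "is_interval {t \<in> {a<..<b::real}. P t} \<Longrightarrow> a \<le> p \<Longrightarrow> q \<le> b \<Longrightarrow> is_interval {t \<in> {p<..<q}. P t}"
  unfolding is_interval_1
  by (smt (verit) greaterThanLessThan_iff mem_Collect_eq)

lemma disconnected_fibre:
  assumes "\<not> is_interval {u \<in> {a<..<b::real}. g u = y}"
  obtains c d m where "c \<in> {a<..<b}" "g c = y" "d \<in> {a<..<b}" "g d = y" "c \<le> m" "m \<le> d" "g m \<noteq> y"
proof -
  obtain c d m where "c \<in> {u \<in> {a<..<b}. g u = y}" "d \<in> {u \<in> {a<..<b}. g u = y}"
    "c \<le> m" "m \<le> d" "m \<notin> {u \<in> {a<..<b}. g u = y}"
    using assms unfolding is_interval_1 by blast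
  then show ?thesis using that[of c d m] by auto
qed

text \<open>If the complement of a set is an interval containing \<open>m\<close>, the set is an
  initial segment to the left of \<open>m\<close> and a final segment to the right.\<close>

lemma co_interval_restrict:
  assumes co: "is_interval ({a<..<b::real} - {u \<in> {a<..<b}. P u})" and m: "m \<in> {a<..<b} - {u \<in> {a<..<b}. P u}"
  shows "is_interval {u \<in> {a<..<m}. P u} \<and> is_interval {u \<in> {m<..<b}. P u}"
proof -
  have co': "\<not> P w" if "a < x" "y < b" "\<not> P x" "\<not> P y" "x \<le> w" "w \<le> y" for x y w
  proof -
    have "x \<in> {a<..<b} - {u \<in> {a<..<b}. P u}" "y \<in> {a<..<b} - {u \<in> {a<..<b}. P u}" using that by auto
    then have "w \<in> {a<..<b} - {u \<in> {a<..<b}. P u}"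
      using co that unfolding is_interval_1 by meson
    then show ?thesis by blast
  qed
  show ?thesis
    unfolding is_interval_1
  proof (intro conjI ballI allI impI)
    fix x z w assume *: "x \<in> {u \<in> {a<..<m}. P u}" "z \<in> {u \<in> {a<..<m}. P u}" "x \<le> w \<and> w \<le> z"
    then show "w \<in> {u \<in> {a<..<m}. P u}" using co'[of w m z] m by auto
  next
    fix x z w assume *: "x \<in> {u \<in> {m<..<b}. P u}" "z \<in> {u \<in> {m<..<b}. P u}" "x \<le> w \<and> w \<le> z"
    then show "w \<in> {u \<in> {m<..<b}. P u}" using co'[of m w x] m by auto
  qed
qed

text \<open>Cutting at the ends of the fibres of the finitely many vertices leaves intervals on
  which \<open>f\<close> is constant at a vertex or avoids all vertices.\<close>

lemma branches_connected_fibres: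
  assumes e: "e \<in> E" and f: "continuous_map X X f" and ab: "0 \<le> a" "a < b" "b \<le> fst e"
    and fib: "\<And>y. is_interval {t \<in> {a<..<b}. f (snd e t) = y}"
  shows "\<exists>T. finite T \<and> (\<forall>p q. a \<le> p \<longrightarrow> p < q \<longrightarrow> q \<le> b \<longrightarrow> {p<..<q} \<inter> T = {} \<longrightarrow> (\<exists>e' \<phi>. branch f e p q e' \<phi>))"
proof -
  define tame where "tame v T \<longleftrightarrow> finite T \<and> (\<forall>p q. p < q \<longrightarrow> {p<..<q} \<inter> T = {} \<longrightarrow>
      {p<..<q} \<subseteq> {t \<in> {a<..<b}. f (snd e t) = v} \<or> {p<..<q} \<inter> {t \<in> {a<..<b}. f (snd e t) = v} = {})" for v T
  have "\<exists>T. tame v T" for v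
  proof -
    have "{t \<in> {a<..<b}. f (snd e t) = v} \<subseteq> {0<..<fst e}" using ab by auto
    then obtain T where "finite T" "\<And>p q. p < q \<Longrightarrow> {p<..<q} \<inter> T = {} \<Longrightarrow>
      {p<..<q} \<subseteq> {t \<in> {a<..<b}. f (snd e t) = v} \<or> {p<..<q} \<inter> {t \<in> {a<..<b}. f (snd e t) = v} = {}"
      using tame_interval[OF fib] by blast
    then have "tame v T" by (simp add: tame_def)
    then show ?thesis ..
  qed
  then obtain T where "\<And>v. tame v (T v)" by metis
  then have T: "\<And>v. finite (T v)"
    "\<And>v p q. p < q \<Longrightarrow> {p<..<q} \<inter> T v = {} \<Longrightarrow>
      {p<..<q} \<subseteq> {t \<in> {a<..<b}. f (snd e t) = v} \<or> {p<..<q} \<inter> {t \<in> {a<..<b}. f (snd e t) = v} = {}"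
    unfolding tame_def by blast+
  show ?thesis
  proof (intro exI[of _ "\<Union>v\<in>V. T v"] conjI allI impI)
    show "finite (\<Union>v\<in>V. T v)" using finite_V T by blast
    fix p q assume pq: "a \<le> p" "p < q" "q \<le> b" "{p<..<q} \<inter> (\<Union>v\<in>V. T v) = {}"
    have pq': "0 \<le> p" "q \<le> fst e" using pq ab by auto
    show "\<exists>e' \<phi>. branch f e p q e' \<phi>"
    proof (cases "\<exists>v\<in>V. {p<..<q} \<subseteq> {t \<in> {a<..<b}. f (snd e t) = v}")
      case True
      then obtain v where "v \<in> V" "\<And>t. t \<in> {p<..<q} \<Longrightarrow> f (snd e t) = v" by blast
      then show ?thesis using branch_const[OF e f pq'(1) pq(2) pq'(2)] by blast
    next
      case False
      have "f (snd e t) \<notin> V" if t: "t \<in> {p<..<q}" for t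
      proof
        assume v: "f (snd e t) \<in> V"
        then have "{p<..<q} \<inter> T (f (snd e t)) = {}" using pq by blast
        from T(2)[OF pq(2) this] have "{p<..<q} \<inter> {u \<in> {a<..<b}. f (snd e u) = f (snd e t)} = {}"
          using False v by blast
        moreover have "t \<in> {a<..<b}" using t pq by auto
        ultimately show False using t by blast
      qed
      then show ?thesis
        using branch_off_vertices[OF e f pq'(1) pq(2) pq'(2)] is_interval_restrict[OF fib pq(1,3)] by blast
    qed
  qed
qed

text \<open>Each edge is cut first at the ends of the traces of the monotone pieces, then at one
  further point per gap to make all fibres connected, and finally at the fibres of the
  vertices.\<close>

lemma branches_exist:
  assumes f: "continuous_map X X f" and pm: "piecewise_monotone X f" and e: "e \<in> E"
  obtains T where "finite T" "0 \<in> T" "fst e \<in> T" "T \<subseteq> {0..fst e}"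
    "\<And>p q. 0 \<le> p \<Longrightarrow> p < q \<Longrightarrow> q \<le> fst e \<Longrightarrow> {p<..<q} \<inter> T = {} \<Longrightarrow> \<exists>e' \<phi>. branch f e p q e' \<phi>"
proof -
  obtain \<J> where J: "finite \<J>" "\<Union>\<J> = topspace X"
    "\<And>J. J \<in> \<J> \<Longrightarrow> connectedin X J" "\<And>J. J \<in> \<J> \<Longrightarrow> monotone_on_piece X X f J"
    using pm unfolding piecewise_monotone_def by blast
  have fibJ: "connectedin X {x \<in> J. f x = y}" if "J \<in> \<J>" for J y
  proof -
    have "J \<subseteq> topspace X" using that J(2) by blast
    then have "topspace (subtopology X J) = J" by (simp add: inf.absorb2)
    then show ?thesis
      using J(4)[OF that] unfolding monotone_on_piece_def monotone_map connectedin_subtopology by simp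
  qed
  let ?l = "fst e"
  let ?tr = "\<lambda>S. {t \<in> {0<..<?l}. snd e t \<in> S}"
  have l: "0 < ?l" using edge_pos[OF e] .
  define tame where "tame J T \<longleftrightarrow> finite T \<and>
    (\<forall>a b. a < b \<longrightarrow> {a<..<b} \<subseteq> {0<..<?l} \<longrightarrow> {a<..<b} \<inter> T = {} \<longrightarrow> {a<..<b} \<subseteq> ?tr J \<or> {a<..<b} \<inter> ?tr J = {})"
    for J T
  have "\<forall>J\<in>\<J>. \<exists>T. tame J T"
  proof
    fix J assume Jm: "J \<in> \<J>"
    have "?tr J \<subseteq> {0<..<?l}" by auto
    then obtain T where "finite T" "\<And>a b. a < b \<Longrightarrow> {a<..<b} \<subseteq> {0<..<?l} \<Longrightarrow> {a<..<b} \<inter> T = {} \<Longrightarrow>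
      {a<..<b} \<subseteq> ?tr J \<or> {a<..<b} \<inter> ?tr J = {}"
      using tame_trace_cuts[OF _ connectedin_trace[OF e J(3)[OF Jm]]] by blast
    then have "tame J T" by (simp add: tame_def)
    then show "\<exists>T. tame J T" ..
  qed
  then obtain TJ where "\<And>J. J \<in> \<J> \<Longrightarrow> tame J (TJ J)" by (meson bchoice)
  then have TJ: "\<And>J. J \<in> \<J> \<Longrightarrow> finite (TJ J)"
    "\<And>J a b. J \<in> \<J> \<Longrightarrow> a < b \<Longrightarrow> {a<..<b} \<subseteq> {0<..<?l} \<Longrightarrow> {a<..<b} \<inter> TJ J = {} \<Longrightarrow> {a<..<b} \<subseteq> ?tr J \<or> {a<..<b} \<inter> ?tr J = {}"
    unfolding tame_def by (simp, meson)
  define T0 where "T0 = {0, ?l} \<union> ((\<Union>J\<in>\<J>. TJ J) \<inter> {0..?l})"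
  show ?thesis
  proof (rule cuts_combine[of T0 ?l "\<lambda>p q. \<exists>e' \<phi>. branch f e p q e' \<phi>"])
    show "finite T0" using J(1) TJ by (simp add: T0_def)
    show "0 \<in> T0" "?l \<in> T0" "T0 \<subseteq> {0..?l}" using l by (auto simp: T0_def)
    fix s t assume st: "s \<in> T0" "t \<in> T0" "s < t" "{s<..<t} \<inter> T0 = {}"
    have s0: "0 \<le> s" and tl: "t \<le> ?l" using st l by (auto simp: T0_def)
    have sub: "{s<..<t} \<subseteq> {0<..<?l}" using s0 tl by auto
    \<comment> \<open>Each piece contains or misses the whole gap, so the piece through the image of
      the midpoint contains all of it.\<close>
    have mid: "(s+t)/2 \<in> {s<..<t}" using st by auto
    then have "(s+t)/2 \<in> {0..?l}" using s0 tl by simp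
    then have "snd e ((s+t)/2) \<in> topspace X" by (rule edge_in[OF e])
    then obtain J where Jm: "J \<in> \<J>" "snd e ((s+t)/2) \<in> J" using J(2) by blast
    have "{s<..<t} \<inter> TJ J = {}"
    proof -
      have "{s<..<t} \<inter> TJ J \<subseteq> {s<..<t} \<inter> T0" using sub Jm(1) by (fastforce simp: T0_def)
      then show ?thesis using st by blast
    qed
    from TJ(2)[OF Jm(1) st(3) sub this] have inJ: "{s<..<t} \<subseteq> ?tr J" using mid Jm sub by blast
    have fibs: "is_interval {u \<in> {s<..<t}. f (snd e u) = y} \<or> is_interval ({s<..<t} - {u \<in> {s<..<t}. f (snd e u) = y})" for y
    proof -
      let ?S = "?tr {x \<in> J. f x = y}"
      have "is_interval ?S \<or> is_interval ({0<..<?l} - ?S)" by (rule connectedin_trace[OF e fibJ[OF Jm(1)]])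
      moreover have "{u \<in> {s<..<t}. f (snd e u) = y} = ?S \<inter> {s<..<t}" using inJ by auto
      moreover have "{s<..<t} - {u \<in> {s<..<t}. f (snd e u) = y} = ({0<..<?l} - ?S) \<inter> {s<..<t}" using inJ sub by auto
      ultimately show ?thesis using is_interval_Int[OF _ is_interval_oo] by auto
    qed
    text \<open>At most one fibre is disconnected, since it contains both ends of the gap; it becomes
      connected after cutting at a point outside of it.\<close>
    have "\<exists>m\<in>{s<..<t}. \<forall>y. is_interval {u \<in> {s<..<m}. f (snd e u) = y} \<and> is_interval {u \<in> {m<..<t}. f (snd e u) = y}"
    proof (cases "\<forall>y. is_interval {u \<in> {s<..<t}. f (snd e u) = y}")
      case True
      then show ?thesis
        using is_interval_restrict[OF True[rule_format], of s "(s+t)/2"]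
          is_interval_restrict[OF True[rule_format], of "(s+t)/2" t] mid
        by (intro bexI[of _ "(s+t)/2"]) auto
    next
      case False
      then obtain y where y: "\<not> is_interval {u \<in> {s<..<t}. f (snd e u) = y}" by blast
      then have co: "is_interval ({s<..<t} - {u \<in> {s<..<t}. f (snd e u) = y})" using fibs by blast
      from disconnected_fibre[OF y] obtain c d m where cdm: "c \<in> {s<..<t}" "f (snd e c) = y" "d \<in> {s<..<t}" "f (snd e d) = y" "c \<le> m" "m \<le> d" "f (snd e m) \<noteq> y"
        by metis
      have m: "m \<in> {s<..<t}" "c < m" "m < d" using cdm by (auto simp: le_less)
      \<comment> \<open>The complement of this fibre is an interval through \<open>m\<close> that
        misses \<open>c\<close>, so it has no point to the left of \<open>c\<close>. To the right of
        \<open>d\<close> the argument is symmetric.\<close>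
      have left: "f (snd e u) = y" if "s < u" "u \<le> c" for u
      proof (rule ccontr)
        assume "f (snd e u) \<noteq> y"
        then have "u \<in> {s<..<t} - {u \<in> {s<..<t}. f (snd e u) = y}" "m \<in> {s<..<t} - {u \<in> {s<..<t}. f (snd e u) = y}"
          using that cdm m by auto
        then have "c \<in> {s<..<t} - {u \<in> {s<..<t}. f (snd e u) = y}"
          using co that m unfolding is_interval_1 by (meson less_imp_le)
        then show False using cdm by blast
      qed
      have right: "f (snd e u) = y" if "d \<le> u" "u < t" for u
      proof (rule ccontr)
        assume "f (snd e u) \<noteq> y"
        then have "u \<in> {s<..<t} - {u \<in> {s<..<t}. f (snd e u) = y}" "m \<in> {s<..<t} - {u \<in> {s<..<t}. f (snd e u) = y}"
          using that cdm m by auto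
        then have "d \<in> {s<..<t} - {u \<in> {s<..<t}. f (snd e u) = y}"
          using co that m unfolding is_interval_1 by (meson less_imp_le)
        then show False using cdm by blast
      qed
      have "is_interval {u \<in> {s<..<m}. f (snd e u) = y'} \<and> is_interval {u \<in> {m<..<t}. f (snd e u) = y'}" for y'
      proof (cases "y' = y")
        case False
        \<comment> \<open>The fibre of \<open>y'\<close> lies strictly between \<open>c\<close> and
          \<open>d\<close>. Were it disconnected, its complement would be an interval containing
          \<open>c\<close> and \<open>d\<close>, hence everything between them.\<close>
        have "is_interval {u \<in> {s<..<t}. f (snd e u) = y'}"
        proof (rule ccontr)
          assume n: "\<not> is_interval {u \<in> {s<..<t}. f (snd e u) = y'}"
          then have co': "is_interval ({s<..<t} - {u \<in> {s<..<t}. f (snd e u) = y'})" using fibs by blast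
          from disconnected_fibre[OF n] obtain c' where n': "c' \<in> {s<..<t}" "f (snd e c') = y'"
            by metis
          have "c < c'" using left[of c'] n' False by force
          moreover have "c' < d" using right[of c'] n' False by force
          moreover have "c \<in> {s<..<t} - {u \<in> {s<..<t}. f (snd e u) = y'}" "d \<in> {s<..<t} - {u \<in> {s<..<t}. f (snd e u) = y'}"
            using cdm False by auto
          ultimately have "c' \<in> {s<..<t} - {u \<in> {s<..<t}. f (snd e u) = y'}"
            using co' unfolding is_interval_1 by (meson less_imp_le)
          then show False using n' by blast
        qed
        from is_interval_restrict[OF this, of s m] is_interval_restrict[OF this, of m t]
        show ?thesis using m(1) by simp
      next
        case True
        have "m \<in> {s<..<t} - {u \<in> {s<..<t}. f (snd e u) = y}" using m cdm by blast
        from co_interval_restrict[OF co this] show ?thesis using True by simp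
      qed
      then show ?thesis using m(1) by blast
    qed
    then obtain m where m: "m \<in> {s<..<t}" "\<And>y. is_interval {u \<in> {s<..<m}. f (snd e u) = y}" "\<And>y. is_interval {u \<in> {m<..<t}. f (snd e u) = y}"
      by blast
    obtain T1 where T1: "finite T1" "\<And>p q. s \<le> p \<Longrightarrow> p < q \<Longrightarrow> q \<le> m \<Longrightarrow> {p<..<q} \<inter> T1 = {} \<Longrightarrow> \<exists>e' \<phi>. branch f e p q e' \<phi>"
      using branches_connected_fibres[OF e f s0 _ _ m(2)] m(1) tl by (metis greaterThanLessThan_iff less_imp_le order_trans)
    obtain T2 where T2: "finite T2" "\<And>p q. m \<le> p \<Longrightarrow> p < q \<Longrightarrow> q \<le> t \<Longrightarrow> {p<..<q} \<inter> T2 = {} \<Longrightarrow> \<exists>e' \<phi>. branch f e p q e' \<phi>"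
      using branches_connected_fibres[OF e f _ _ tl m(3)] m(1) s0 by (metis greaterThanLessThan_iff less_imp_le order_trans)
    show "\<exists>T'. finite T' \<and> (\<forall>p q. s \<le> p \<longrightarrow> p < q \<longrightarrow> q \<le> t \<longrightarrow> {p<..<q} \<inter> T' = {} \<longrightarrow> (\<exists>e' \<phi>. branch f e p q e' \<phi>))"
    proof (intro exI[of _ "insert m (T1 \<union> T2)"] conjI allI impI)
      show "finite (insert m (T1 \<union> T2))" using T1 T2 by simp
      fix p q assume pq: "s \<le> p" "p < q" "q \<le> t" "{p<..<q} \<inter> insert m (T1 \<union> T2) = {}"
      then have "q \<le> m \<or> m \<le> p" by force
      then show "\<exists>e' \<phi>. branch f e p q e' \<phi>" using pq T1(2)[of p q] T2(2)[of p q] by blast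
    qed
  qed (use that in blast)
qed

end


section \<open>Open covers and entropy of factors\<close>

lemma iterated_join_0: "iterated_join X f \<U> 0 = {topspace X}"
  by (auto simp: iterated_join_def)

text \<open>Splits off time 0 rather than the last time, so that inductions on \<open>n\<close> pull
  back along a single application of \<open>f\<close>.\<close>

lemma iterated_join_SucI:
  assumes "U \<in> \<U>" "B \<in> iterated_join X f \<U> n" "f \<in> topspace X \<rightarrow> topspace X"
  shows "{x \<in> topspace X. x \<in> U \<and> f x \<in> B} \<in> iterated_join X f \<U> (Suc n)"
proof -
  obtain W where W: "\<And>i. i < n \<Longrightarrow> W i \<in> \<U>" "B = {x \<in> topspace X. \<forall>i<n. (f ^^ i) x \<in> W i}"
    using assms(2) unfolding iterated_join_def by auto
  have "{x \<in> topspace X. x \<in> U \<and> f x \<in> B} = {x \<in> topspace X. \<forall>i<Suc n. (f ^^ i) x \<in> (case i of 0 \<Rightarrow> U | Suc j \<Rightarrow> W j)}"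
    using assms(3) by (auto simp: W(2) All_less_Suc2 funpow_Suc_right simp del: funpow.simps(2))
  moreover have "\<forall>i<Suc n. (case i of 0 \<Rightarrow> U | Suc j \<Rightarrow> W j) \<in> \<U>"
    using assms(1) W(1) by (auto simp: All_less_Suc2)
  ultimately show ?thesis unfolding iterated_join_def by blast
qed

lemma iterated_join_SucE:
  assumes "A \<in> iterated_join X f \<U> (Suc n)" "f \<in> topspace X \<rightarrow> topspace X"
  obtains U B where "U \<in> \<U>" "B \<in> iterated_join X f \<U> n" "A = {x \<in> topspace X. x \<in> U \<and> f x \<in> B}"
proof -
  obtain W where W: "\<forall>i<Suc n. W i \<in> \<U>" "A = {x \<in> topspace X. \<forall>i<Suc n. (f ^^ i) x \<in> W i}"
    using assms(1) unfolding iterated_join_def by auto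
  let ?B = "{x \<in> topspace X. \<forall>i<n. (f ^^ i) x \<in> W (Suc i)}"
  have "A = {x \<in> topspace X. x \<in> W 0 \<and> f x \<in> ?B}"
    using assms(2) by (auto simp: W(2) All_less_Suc2 funpow_Suc_right simp del: funpow.simps(2))
  moreover have "?B \<in> iterated_join X f \<U> n"
    unfolding iterated_join_def using W(1) by (intro CollectI exI[of _ "\<lambda>i. W (Suc i)"]) auto
  moreover have "W 0 \<in> \<U>" using W(1) by auto
  ultimately show ?thesis using that by blast
qed

lemma open_cover_iterated_join:
  assumes f: "continuous_map X X f" and U: "open_cover X \<U>"
  shows "open_cover X (iterated_join X f \<U> n)"
proof (induction n)
  case 0
  then show ?case by (simp add: iterated_join_0 open_cover_def)
next
  case (Suc n)
  have f': "f \<in> topspace X \<rightarrow> topspace X" using f continuous_map_funspace by blast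
  have "openin X A" if A: "A \<in> iterated_join X f \<U> (Suc n)" for A
  proof -
    obtain U' B where *: "U' \<in> \<U>" "B \<in> iterated_join X f \<U> n" "A = {x \<in> topspace X. x \<in> U' \<and> f x \<in> B}"
      by (rule iterated_join_SucE[OF A f'])
    then have "openin X U'" "openin X B" using U Suc by (auto simp: open_cover_def)
    moreover from this have "A = U' \<inter> {x \<in> topspace X. f x \<in> B}" using * openin_subset by fastforce
    ultimately show ?thesis using openin_continuous_map_preimage[OF f] by (simp add: openin_Int)
  qed
  moreover have "x \<in> \<Union>(iterated_join X f \<U> (Suc n))" if x: "x \<in> topspace X" for x
  proof -
    have "x \<in> \<Union>\<U>" "f x \<in> \<Union>(iterated_join X f \<U> n)" using x f' U Suc by (auto simp: open_cover_def)
    then obtain U' B where "U' \<in> \<U>" "x \<in> U'" "B \<in> iterated_join X f \<U> n" "f x \<in> B" by blast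
    then have "x \<in> {x \<in> topspace X. x \<in> U' \<and> f x \<in> B}" "{x \<in> topspace X. x \<in> U' \<and> f x \<in> B} \<in> iterated_join X f \<U> (Suc n)"
      using x iterated_join_SucI f' by fast+
    then show ?thesis by blast
  qed
  ultimately show ?case unfolding open_cover_def by (meson openin_subset Sup_least subset_antisym subsetI)
qed

lemma subcover_number_le:
  "finite \<V> \<Longrightarrow> \<V> \<subseteq> \<W> \<Longrightarrow> \<Union>\<V> = topspace X \<Longrightarrow> subcover_number X \<W> \<le> card \<V>"
  unfolding subcover_number_def by (intro cInf_lower) auto

lemma subcover_number_attained:
  assumes "compact_space X" "open_cover X \<W>"
  obtains \<V> where "finite \<V>" "\<V> \<subseteq> \<W>" "\<Union>\<V> = topspace X" "card \<V> = subcover_number X \<W>"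
proof -
  let ?S = "{\<V>. finite \<V> \<and> \<V> \<subseteq> \<W> \<and> \<Union>\<V> = topspace X}"
  have "\<exists>\<V>. finite \<V> \<and> \<V> \<subseteq> \<W> \<and> \<Union>\<V> = topspace X"
    using compact_space[THEN iffD1, rule_format, OF assms(1), of \<W>] assms(2) unfolding open_cover_def by simp
  then have "?S \<noteq> {}" by fastforce
  then have "card ` ?S \<noteq> {}" by simp
  then have "subcover_number X \<W> \<in> card ` ?S" unfolding subcover_number_def by (rule Inf_nat_def1)
  then obtain \<V> where "\<V> \<in> ?S" "subcover_number X \<W> = card \<V>" by (rule imageE)
  then show ?thesis using that[of \<V>] by simp
qed

text \<open>Includes \<open>m = 0\<close>, where \<open>ln 0 = 0\<close> by convention lies below
  the logarithm of every positive integer.\<close>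

lemma ln_real_mono: "m \<le> n \<Longrightarrow> ln (real m) \<le> ln (real n)"
  by (cases "m = 0"; cases "n = 0") auto

text \<open>Every member of the join of the pulled back cover is the preimage of a member of the
  join on \<open>Y\<close>, and surjectivity of \<open>\<psi>\<close> turns a subcover of
  \<open>X\<close> into one of \<open>Y\<close> with at most as many members.\<close>

lemma semiconjugacy_subcover_number:
  assumes X: "compact_space X" and f: "continuous_map X X f" and \<psi>: "continuous_map X Y \<psi>"
    and surj: "\<psi> ` topspace X = topspace Y" and g: "g \<in> topspace Y \<rightarrow> topspace Y"
    and comm: "\<And>x. x \<in> topspace X \<Longrightarrow> \<psi> (f x) = g (\<psi> x)"
    and U: "open_cover Y \<U>"
  defines "\<U>' \<equiv> (\<lambda>U. {x \<in> topspace X. \<psi> x \<in> U}) ` \<U>"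
  shows "open_cover X \<U>'" "subcover_number Y (iterated_join Y g \<U> n) \<le> subcover_number X (iterated_join X f \<U>' n)"
proof -
  show oc: "open_cover X \<U>'"
    unfolding open_cover_def
  proof
    show "\<forall>U\<in>\<U>'. openin X U"
      using U openin_continuous_map_preimage[OF \<psi>] by (auto simp: \<U>'_def open_cover_def)
    have "\<psi> x \<in> \<Union>\<U>" if "x \<in> topspace X" for x using surj U that by (auto simp: open_cover_def)
    then show "\<Union>\<U>' = topspace X" by (auto simp: \<U>'_def)
  qed
  have fX: "f x \<in> topspace X" if "x \<in> topspace X" for x using continuous_map_image_subset_topspace[OF f] that by blast
  have it: "(f ^^ i) x \<in> topspace X \<and> \<psi> ((f ^^ i) x) = (g ^^ i) (\<psi> x)" if "x \<in> topspace X" for x i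
    by (induction i) (use that comm fX in auto)
  obtain \<V> where V: "finite \<V>" "\<V> \<subseteq> iterated_join X f \<U>' n" "\<Union>\<V> = topspace X" "card \<V> = subcover_number X (iterated_join X f \<U>' n)"
    by (rule subcover_number_attained[OF X open_cover_iterated_join[OF f oc]])
  have "\<exists>B\<in>iterated_join Y g \<U> n. A = {x \<in> topspace X. \<psi> x \<in> B}" if "A \<in> iterated_join X f \<U>' n" for A
  proof -
    obtain W where W: "\<forall>i<n. W i \<in> \<U>'" "A = {x \<in> topspace X. \<forall>i<n. (f ^^ i) x \<in> W i}"
      using \<open>A \<in> iterated_join X f \<U>' n\<close> unfolding iterated_join_def by auto
    have "\<forall>i. \<exists>W'. i < n \<longrightarrow> W' \<in> \<U> \<and> W i = {x \<in> topspace X. \<psi> x \<in> W'}"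
      using W(1) unfolding \<U>'_def by blast
    then obtain W' where W': "\<And>i. i < n \<Longrightarrow> W' i \<in> \<U> \<and> W i = {x \<in> topspace X. \<psi> x \<in> W' i}" by metis
    let ?B = "{y \<in> topspace Y. \<forall>i<n. (g ^^ i) y \<in> W' i}"
    have "?B \<in> iterated_join Y g \<U> n" unfolding iterated_join_def using W' by blast
    moreover have "A = {x \<in> topspace X. \<psi> x \<in> ?B}"
    proof (intro set_eqI iffI)
      fix x assume "x \<in> A"
      then show "x \<in> {x \<in> topspace X. \<psi> x \<in> ?B}" using it[of x] W' surj unfolding W(2) by auto
    next
      fix x assume "x \<in> {x \<in> topspace X. \<psi> x \<in> ?B}"
      then show "x \<in> A" using it[of x] W' unfolding W(2) by auto
    qed
    ultimately show ?thesis by blast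
  qed
  then have "\<forall>A\<in>\<V>. \<exists>B. B \<in> iterated_join Y g \<U> n \<and> A = {x \<in> topspace X. \<psi> x \<in> B}" using V(2) by blast
  then obtain \<Phi> where \<Phi>: "\<And>A. A \<in> \<V> \<Longrightarrow> \<Phi> A \<in> iterated_join Y g \<U> n \<and> A = {x \<in> topspace X. \<psi> x \<in> \<Phi> A}"
    by (meson bchoice)
  have "\<Union>(\<Phi> ` \<V>) = topspace Y"
  proof
    show "\<Union>(\<Phi> ` \<V>) \<subseteq> topspace Y" using \<Phi> unfolding iterated_join_def by blast
    show "topspace Y \<subseteq> \<Union>(\<Phi> ` \<V>)"
    proof
      fix y assume "y \<in> topspace Y"
      then obtain x where x: "x \<in> topspace X" "y = \<psi> x" using surj by blast
      then obtain A where "A \<in> \<V>" "x \<in> A" using V(3) by blast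
      then show "y \<in> \<Union>(\<Phi> ` \<V>)" using \<Phi>[of A] x by auto
    qed
  qed
  then have "subcover_number Y (iterated_join Y g \<U> n) \<le> card (\<Phi> ` \<V>)"
    using V(1) \<Phi> by (intro subcover_number_le) auto
  also have "\<dots> \<le> card \<V>" using V(1) by (rule card_image_le)
  finally show "subcover_number Y (iterated_join Y g \<U> n) \<le> subcover_number X (iterated_join X f \<U>' n)"
    using V(4) by simp
qed

lemma topological_entropy_factor:
  assumes X: "compact_space X" and f: "continuous_map X X f" and \<psi>: "continuous_map X Y \<psi>"
    and surj: "\<psi> ` topspace X = topspace Y" and g: "g \<in> topspace Y \<rightarrow> topspace Y"
    and comm: "\<And>x. x \<in> topspace X \<Longrightarrow> \<psi> (f x) = g (\<psi> x)"
  shows "topological_entropy Y g \<le> topological_entropy X f"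
  unfolding topological_entropy_def
proof (rule SUP_mono)
  fix \<U> assume "\<U> \<in> {\<U>. open_cover Y \<U>}"
  then have U: "open_cover Y \<U>" by simp
  note s = semiconjugacy_subcover_number[OF assms U]
  have "cover_entropy Y g \<U> \<le> cover_entropy X f ((\<lambda>U. {x \<in> topspace X. \<psi> x \<in> U}) ` \<U>)"
    unfolding cover_entropy_def
    by (intro Limsup_mono always_eventually allI) (simp add: divide_right_mono ln_real_mono s(2))
  then show "\<exists>m\<in>{\<U>. open_cover X \<U>}. cover_entropy Y g \<U> \<le> cover_entropy X f m"
    using s(1) by blast
qed


section \<open>Maps of constant slope\<close>

text \<open>The slope is recorded in the affine pieces themselves, so that derivatives are only met
  in \<open>affine_slope_imp_constant_slope\<close>.\<close>

definition affine_cuts :: "'a graph_edge set \<Rightarrow> ('a \<Rightarrow> 'a) \<Rightarrow> real \<Rightarrow> 'a graph_edge \<Rightarrow> real set \<Rightarrow> bool"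
  where "affine_cuts E g \<sigma> e T \<longleftrightarrow> finite T \<and> {0, fst e} \<subseteq> T \<and> T \<subseteq> {0..fst e} \<and>
    (\<forall>s\<in>T. \<forall>t\<in>T. s < t \<and> {s<..<t} \<inter> T = {} \<longrightarrow>
      (\<exists>e'\<in>E. \<exists>a b. \<bar>a\<bar> = \<sigma> \<and> (\<forall>u\<in>{s..t}. a * u + b \<in> {0..fst e'} \<and> g (snd e u) = snd e' (a * u + b))))"

definition affine_slope :: "'a graph_edge set \<Rightarrow> ('a \<Rightarrow> 'a) \<Rightarrow> real \<Rightarrow> bool"
  where "affine_slope E g \<sigma> \<longleftrightarrow> (\<forall>e\<in>E. \<exists>T. affine_cuts E g \<sigma> e T)"

lemma affine_cutsD:
  assumes "affine_cuts E g \<sigma> e T"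
  shows "finite T" "0 \<in> T" "fst e \<in> T" "T \<subseteq> {0..fst e}"
  using assms by (auto simp: affine_cuts_def)

lemma affine_cuts_piece:
  assumes "affine_cuts E g \<sigma> e T" "s \<in> T" "t \<in> T" "s < t" "{s<..<t} \<inter> T = {}"
  obtains e' a b where "e' \<in> E" "\<bar>a\<bar> = \<sigma>"
    "\<And>u. u \<in> {s..t} \<Longrightarrow> a * u + b \<in> {0..fst e'} \<and> g (snd e u) = snd e' (a * u + b)"
proof -
  have "\<exists>e'\<in>E. \<exists>a b. \<bar>a\<bar> = \<sigma> \<and> (\<forall>u\<in>{s..t}. a * u + b \<in> {0..fst e'} \<and> g (snd e u) = snd e' (a * u + b))"
    using assms unfolding affine_cuts_def by simp
  then obtain e' a b where "e' \<in> E" "\<bar>a\<bar> = \<sigma>"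
    "\<forall>u\<in>{s..t}. a * u + b \<in> {0..fst e'} \<and> g (snd e u) = snd e' (a * u + b)" by blast
  then show ?thesis by (intro that) auto
qed

lemma affine_slope_imp_piecewise_affine:
  assumes "affine_slope E g \<sigma>" shows "piecewise_affine E g"
  unfolding piecewise_affine_def
proof (rule ballI, clarify)
  fix l \<gamma> assume "(l, \<gamma>) \<in> E"
  then obtain T where T: "affine_cuts E g \<sigma> (l, \<gamma>) T" using assms unfolding affine_slope_def by blast
  show "\<exists>T. finite T \<and> {0, l} \<subseteq> T \<and> T \<subseteq> {0..l} \<and>
      (\<forall>s\<in>T. \<forall>t\<in>T. s < t \<and> {s<..<t} \<inter> T = {} \<longrightarrow>
        (\<exists>(l', \<gamma>')\<in>E. \<exists>a b. \<forall>u\<in>{s..t}. a * u + b \<in> {0..l'} \<and> g (\<gamma> u) = \<gamma>' (a * u + b)))"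
  proof (intro exI[of _ T] conjI ballI impI)
    fix s t assume "s \<in> T" "t \<in> T" "s < t \<and> {s<..<t} \<inter> T = {}"
    then obtain e' a b where e': "e' \<in> E" "\<And>u. u \<in> {s..t} \<Longrightarrow> a * u + b \<in> {0..fst e'} \<and> g (\<gamma> u) = snd e' (a * u + b)"
      using affine_cuts_piece[OF T, of s t] by (metis snd_conv)
    have "\<forall>u\<in>{s..t}. a * u + b \<in> {0..fst e'} \<and> g (\<gamma> u) = snd e' (a * u + b)" using e'(2) by blast
    then show "\<exists>(l', \<gamma>')\<in>E. \<exists>a b. \<forall>u\<in>{s..t}. a * u + b \<in> {0..l'} \<and> g (\<gamma> u) = \<gamma>' (a * u + b)"
      using e'(1) unfolding case_prod_beta by blast
  qed (use affine_cutsD[OF T] in auto)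
qed

text \<open>The pair \<open>(t, d)\<close> is a starting point with a direction, and
  \<open>h\<close> carries a short path from it affinely onto one from \<open>(t', d')\<close>,
  stretched by \<open>c\<close>. Such germs compose without refining any subdivision, which makes
  iterates of a constant slope map easy to treat.\<close>

definition affine_germ ::
    "'a graph_edge set \<Rightarrow> ('a \<Rightarrow> 'a) \<Rightarrow> real \<Rightarrow> 'a graph_edge \<Rightarrow> real \<Rightarrow> real \<Rightarrow> real \<Rightarrow> 'a graph_edge \<Rightarrow> real \<Rightarrow> real \<Rightarrow> bool"
  where "affine_germ E h c e t d \<epsilon> e' t' d' \<longleftrightarrow> e' \<in> E \<and> \<bar>d'\<bar> = 1 \<and>
    (\<forall>w\<in>{0..\<epsilon>}. t' + d' * (c * w) \<in> {0..fst e'} \<and> h (snd e (t + d * w)) = snd e' (t' + d' * (c * w)))"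

definition affine_germs :: "'a graph_edge set \<Rightarrow> ('a \<Rightarrow> 'a) \<Rightarrow> real \<Rightarrow> bool"
  where "affine_germs E h c \<longleftrightarrow> (\<forall>e\<in>E. \<forall>t\<in>{0..fst e}. \<forall>d v. \<bar>d\<bar> = 1 \<and> 0 < v \<and> t + d * v \<in> {0..fst e} \<longrightarrow>
    (\<exists>\<epsilon> e' t' d'. 0 < \<epsilon> \<and> \<epsilon> \<le> v \<and> affine_germ E h c e t d \<epsilon> e' t' d'))"

lemma affine_germsI:
  assumes "\<And>e t d v. e \<in> E \<Longrightarrow> t \<in> {0..fst e} \<Longrightarrow> \<bar>d\<bar> = 1 \<Longrightarrow> 0 < v \<Longrightarrow> t + d * v \<in> {0..fst e} \<Longrightarrow>
    \<exists>\<epsilon> e' t' d'. 0 < \<epsilon> \<and> \<epsilon> \<le> v \<and> affine_germ E h c e t d \<epsilon> e' t' d'"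
  shows "affine_germs E h c"
  unfolding affine_germs_def by (intro ballI allI impI assms) auto

lemma affine_germsD:
  assumes "affine_germs E h c" "e \<in> E" "t \<in> {0..fst e}" "\<bar>d\<bar> = 1" "0 < v" "t + d * v \<in> {0..fst e}"
  obtains \<epsilon> e' t' d' where "0 < \<epsilon>" "\<epsilon> \<le> v" "affine_germ E h c e t d \<epsilon> e' t' d'"
  using assms unfolding affine_germs_def by blast

lemma affine_germD:
  assumes "affine_germ E h c e t d \<epsilon> e' t' d'"
  shows "e' \<in> E" "\<bar>d'\<bar> = 1"
    and "0 \<le> w \<Longrightarrow> w \<le> \<epsilon> \<Longrightarrow> t' + d' * (c * w) \<in> {0..fst e'}"
    and "0 \<le> w \<Longrightarrow> w \<le> \<epsilon> \<Longrightarrow> h (snd e (t + d * w)) = snd e' (t' + d' * (c * w))"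
  using assms unfolding affine_germ_def by (blast, blast, simp, simp)

lemma unit_cases: "\<bar>d\<bar> = 1 \<Longrightarrow> d = 1 \<or> d = (-1::real)"
  by linarith

lemma affine_germs_id: "affine_germs E id 1"
proof (rule affine_germsI)
  fix e t d v assume a: "e \<in> E" "t \<in> {0..fst e}" "\<bar>d\<bar> = 1" "0 < v" "t + d * v \<in> {0..fst e}"
  have "t + d * w \<in> {0..fst e}" if "w \<in> {0..v}" for w
    using a that unit_cases[of d] by auto
  then have "affine_germ E id 1 e t d v e t d" using a by (simp add: affine_germ_def)
  then show "\<exists>\<epsilon> e' t' d'. 0 < \<epsilon> \<and> \<epsilon> \<le> v \<and> affine_germ E id 1 e t d \<epsilon> e' t' d'" using a by blast
qed

lemma affine_germs_compose:
  assumes 1: "affine_germs E h1 c1" and 2: "affine_germs E h2 c2" and c: "0 < c1"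
  shows "affine_germs E (h2 \<circ> h1) (c2 * c1)"
proof (rule affine_germsI)
  fix e t d v assume a: "e \<in> E" "t \<in> {0..fst e}" "\<bar>d\<bar> = 1" "0 < v" "t + d * v \<in> {0..fst e}"
  obtain \<epsilon> e' t' d' where \<epsilon>: "0 < \<epsilon>" "\<epsilon> \<le> v" and g: "affine_germ E h1 c1 e t d \<epsilon> e' t' d'"
    using affine_germsD[OF 1 a] .
  note g = affine_germD[OF g]
  have "t' \<in> {0..fst e'}" "t' + d' * (c1 * \<epsilon>) \<in> {0..fst e'}" "0 < c1 * \<epsilon>"
    using g(3)[of 0] g(3)[of \<epsilon>] \<epsilon> c by auto
  then obtain \<epsilon>2 e'' t'' d'' where \<epsilon>2: "0 < \<epsilon>2" "\<epsilon>2 \<le> c1 * \<epsilon>" and g2: "affine_germ E h2 c2 e' t' d' \<epsilon>2 e'' t'' d''"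
    using affine_germsD[OF 2 g(1) _ g(2)] by metis
  note g2 = affine_germD[OF g2]
  have le: "\<epsilon>2 / c1 \<le> \<epsilon>" using \<epsilon>2(2) c by (simp add: pos_divide_le_eq mult.commute)
  have "affine_germ E (h2 \<circ> h1) (c2 * c1) e t d (\<epsilon>2 / c1) e'' t'' d''"
    unfolding affine_germ_def
  proof (intro conjI ballI)
    fix w assume "w \<in> {0..\<epsilon>2 / c1}"
    then have "0 \<le> w" "w \<le> \<epsilon>2 / c1" by auto
    then have w: "0 \<le> w" "w \<le> \<epsilon>" "0 \<le> c1 * w" "c1 * w \<le> \<epsilon>2"
      using le c by (simp, linarith, simp, simp add: pos_le_divide_eq mult.commute)
    show "t'' + d'' * (c2 * c1 * w) \<in> {0..fst e''}" using g2(3)[OF w(3,4)] by (simp only: mult.assoc)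
    show "(h2 \<circ> h1) (snd e (t + d * w)) = snd e'' (t'' + d'' * (c2 * c1 * w))"
      using g(4)[OF w(1,2)] g2(4)[OF w(3,4)] by (simp add: mult.assoc)
  qed (use g2 in auto)
  moreover have "0 < \<epsilon>2 / c1" "\<epsilon>2 / c1 \<le> v" using \<epsilon> \<epsilon>2 c le by auto
  ultimately show "\<exists>\<epsilon> e' t' d'. 0 < \<epsilon> \<and> \<epsilon> \<le> v \<and> affine_germ E (h2 \<circ> h1) (c2 * c1) e t d \<epsilon> e' t' d'" by blast
qed

lemma affine_germs_pow:
  assumes "affine_germs E g \<sigma>" "0 < \<sigma>" shows "affine_germs E (g ^^ m) (\<sigma> ^ m)"
proof (induction m)
  case 0
  then show ?case using affine_germs_id by (simp add: id_def)
next
  case (Suc m)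
  have "affine_germs E (g \<circ> (g ^^ m)) (\<sigma> * \<sigma> ^ m)"
    by (rule affine_germs_compose[OF Suc assms(1)]) (use assms in simp)
  then show ?case by (simp add: o_def)
qed

context graph begin

lemma affine_piece_at:
  assumes g: "affine_slope E g \<sigma>" and e: "e \<in> E" and t: "t \<in> {0..fst e}"
    and d: "\<bar>d\<bar> = 1" and v: "0 < v" "t + d * v \<in> {0..fst e}"
  obtains \<epsilon> e' a b where "0 < \<epsilon>" "\<epsilon> \<le> v" "e' \<in> E" "\<bar>a\<bar> = \<sigma>"
    "\<And>w. 0 \<le> w \<Longrightarrow> w \<le> \<epsilon> \<Longrightarrow> a * (t + d * w) + b \<in> {0..fst e'} \<and> g (snd e (t + d * w)) = snd e' (a * (t + d * w) + b)"
proof -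
  obtain T where T: "affine_cuts E g \<sigma> e T" using g e unfolding affine_slope_def by blast
  note T' = affine_cutsD[OF T]
  obtain \<epsilon> where \<epsilon>: "0 < \<epsilon>" "\<epsilon> \<le> v" "\<And>c. c \<in> T \<Longrightarrow> c \<noteq> t \<Longrightarrow> \<epsilon> \<le> \<bar>c - t\<bar>"
    using finite_avoid[OF T'(1) v(1)] by metis
  define p q where "p = min t (t + d * \<epsilon>)" and "q = max t (t + d * \<epsilon>)"
  have pq: "p < q" "0 \<le> p" "q \<le> fst e" using unit_cases[OF d] \<epsilon> t v by (auto simp: p_def q_def)
  have "c \<notin> {p<..<q}" if "c \<in> T" for c
    using \<epsilon>(3)[OF that] unit_cases[OF d] \<epsilon>(1) by (cases "c = t") (auto simp: p_def q_def)
  then have "{p<..<q} \<inter> T = {}" by blast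
  then obtain s t' where st: "s \<in> T" "t' \<in> T" "s \<le> p" "q \<le> t'" "{s<..<t'} \<inter> T = {}"
    using finite_gap[OF T'(1) pq(1), of 0 "fst e"] T'(2,3) pq by metis
  have "s < t'" using st pq by simp
  from affine_cuts_piece[OF T st(1,2) this st(5)] obtain e' a b where e': "e' \<in> E" "\<bar>a\<bar> = \<sigma>"
    "\<And>u. u \<in> {s..t'} \<Longrightarrow> a * u + b \<in> {0..fst e'} \<and> g (snd e u) = snd e' (a * u + b)" by metis
  have "t + d * w \<in> {s..t'}" if "0 \<le> w" "w \<le> \<epsilon>" for w
    using that st unit_cases[OF d] by (auto simp: p_def q_def)
  then show ?thesis using e'(3) by (intro that[OF \<epsilon>(1,2) e'(1,2), of b]) simp
qed

lemma affine_slope_imp_germs: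
  assumes g: "affine_slope E g \<sigma>" and "0 < \<sigma>" shows "affine_germs E g \<sigma>"
proof (rule affine_germsI)
  fix e t d v assume a: "e \<in> E" "t \<in> {0..fst e}" "\<bar>d\<bar> = 1" "0 < v" "t + d * v \<in> {0..fst e}"
  obtain \<epsilon> e' A b where p: "0 < \<epsilon>" "\<epsilon> \<le> v" "e' \<in> E" "\<bar>A\<bar> = \<sigma>"
    "\<And>w. 0 \<le> w \<Longrightarrow> w \<le> \<epsilon> \<Longrightarrow> A * (t + d * w) + b \<in> {0..fst e'} \<and> g (snd e (t + d * w)) = snd e' (A * (t + d * w) + b)"
    by (rule affine_piece_at[OF g a]) (rule that)
  have eq: "A * (t + d * w) + b = (A * t + b) + (sgn A * d) * (\<sigma> * w)" for w
    using p(4) assms(2) by (auto simp: algebra_simps abs_if sgn_if split: if_splits)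
  moreover have "\<bar>sgn A * d\<bar> = 1" using a p(4) assms(2) by (auto simp: abs_mult sgn_if)
  ultimately have "affine_germ E g \<sigma> e t d \<epsilon> e' (A * t + b) (sgn A * d)"
    using p(3,5) unfolding affine_germ_def eq by simp
  then show "\<exists>\<epsilon> e' t' d'. 0 < \<epsilon> \<and> \<epsilon> \<le> v \<and> affine_germ E g \<sigma> e t d \<epsilon> e' t' d'" using p(1,2) by blast
qed

text \<open>The definition of derivative allows any target edge and any lift. Immediately to the
  right of \<open>t\<close> the image is interior to an edge, where coordinates are unique, so the
  lift agrees with the affine piece there and the right-hand difference quotient determines
  \<open>d\<close>. This covers cut points as well.\<close>

lemma affine_slope_imp_constant_slope:
  assumes g: "affine_slope E g \<sigma>" and \<sigma>: "0 < \<sigma>"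
  shows "constant_slope X g \<sigma>"
  unfolding constant_slope_def
proof (intro exI conjI ballI allI impI)
  show "graph_parametrization X V E" by (rule param)
  show "piecewise_affine E g" by (rule affine_slope_imp_piecewise_affine[OF g])
  fix e t d assume e: "e \<in> E" and td: "0 < t \<and> t < fst e \<and> graph_map_has_deriv E g e t d"
  obtain \<epsilon> e' a b where p: "0 < \<epsilon>" "\<epsilon> \<le> fst e - t" "e' \<in> E" "\<bar>a\<bar> = \<sigma>"
    "\<And>w. 0 \<le> w \<Longrightarrow> w \<le> \<epsilon> \<Longrightarrow> a * (t + 1 * w) + b \<in> {0..fst e'} \<and> g (snd e (t + 1 * w)) = snd e' (a * (t + 1 * w) + b)"
    using affine_piece_at[OF g e, of t 1 "fst e - t"] td by (metis abs_one add_diff_cancel_left' atLeastAtMost_iff diff_gt_0_iff_gt less_eq_real_def mult_1 add.commute diff_add_cancel edge_pos[OF e])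
  obtain e'' \<phi> where \<phi>: "e'' \<in> E" "\<forall>\<^sub>F u in nhds t. \<phi> u \<in> {0..fst e''} \<and> g (snd e u) = snd e'' (\<phi> u)"
    "(\<phi> has_real_derivative d) (at t)"
    using td unfolding graph_map_has_deriv_def case_prod_beta by blast
  have a0: "a \<noteq> 0" using p(4) \<sigma> by auto
  \<comment> \<open>As the slope is nonzero, points strictly inside the germ have coordinates
    strictly between two coordinates of the closed edge.\<close>
  have inside: "a * u + b \<in> {0<..<fst e'}" if u: "u \<in> {t<..<t + \<epsilon>}" for u
  proof -
    have "a * t + b \<in> {0..fst e'}" "a * (t + \<epsilon>) + b \<in> {0..fst e'}" using p(5)[of 0] p(5)[of \<epsilon>] p(1) by auto
    moreover have "a * t < a * u \<and> a * u < a * (t + \<epsilon>) \<or> a * (t + \<epsilon>) < a * u \<and> a * u < a * t"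
      using a0 u by (cases "0 < a") (auto simp del: distrib_left)
    ultimately show ?thesis by auto
  qed
  have "\<forall>\<^sub>F u in at_right t. \<phi> u \<in> {0..fst e''} \<and> g (snd e u) = snd e'' (\<phi> u)"
    using \<phi>(2) filter_leD[OF at_le] by (auto simp: eventually_at_filter elim: eventually_mono)
  moreover have "\<forall>\<^sub>F u in at_right t. u \<in> {t<..<t + \<epsilon>}" using p(1) by (intro eventually_at_right_real) simp
  ultimately have eq: "\<forall>\<^sub>F u in at_right t. \<phi> u = a * u + b"
  proof eventually_elim
    case (elim u)
    then have "snd e' (a * u + b) = snd e'' (\<phi> u)" using p(5)[of "u - t"] by auto
    from edge_param_unique[OF p(3) \<phi>(1) inside[OF elim(2)] _ this] elim show ?case by simp
  qed
  have "isCont \<phi> t" using \<phi>(3) DERIV_isCont by blast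
  then have "(\<phi> \<longlongrightarrow> \<phi> t) (at_right t)" unfolding isCont_def by (rule tendsto_within_subset) simp
  moreover have "(\<phi> \<longlongrightarrow> a * t + b) (at_right t)"
    by (rule Lim_transform_eventually[of "\<lambda>u. a * u + b"]) (use eq in \<open>auto intro!: tendsto_intros elim: eventually_mono\<close>)
  ultimately have \<phi>t: "\<phi> t = a * t + b" by (intro tendsto_unique[of "at_right t"]) auto
  have "((\<lambda>u. (\<phi> u - \<phi> t) / (u - t)) \<longlongrightarrow> d) (at_right t)"
    using has_field_derivative_at_within[OF \<phi>(3), of "{t<..}"] unfolding has_field_derivative_iff .
  moreover have "((\<lambda>u. (\<phi> u - \<phi> t) / (u - t)) \<longlongrightarrow> a) (at_right t)"
  proof (rule Lim_transform_eventually[of "\<lambda>_. a"])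
    show "\<forall>\<^sub>F u in at_right t. a = (\<phi> u - \<phi> t) / (u - t)"
      using eq eventually_at_right_less[of t]
      by eventually_elim (simp add: \<phi>t field_simps)
  qed simp
  ultimately have "d = a" by (intro tendsto_unique[of "at_right t"]) auto
  then show "\<bar>d\<bar> = \<sigma>" using p(4) by simp
qed

text \<open>An affine piece may run once around a loop and identify its two ends. Half a piece
  covers at most half of the target edge and is therefore injective; the singletons of
  \<open>V\<close> also cover isolated vertices.\<close>

lemma affine_slope_imp_piecewise_monotone:
  assumes g: "affine_slope E g \<sigma>" and \<sigma>: "0 < \<sigma>" and cont: "continuous_map X X g"
  shows "piecewise_monotone X g"
proof -
  have "\<forall>e\<in>E. \<exists>T. affine_cuts E g \<sigma> e T" using g unfolding affine_slope_def .
  then obtain T where T: "\<And>e. e \<in> E \<Longrightarrow> affine_cuts E g \<sigma> e (T e)" by (meson bchoice)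
  note TD = affine_cutsD[OF T]
  define G where "G = (SIGMA e:E. {(s, t). s \<in> T e \<and> t \<in> T e \<and> s < t \<and> {s<..<t} \<inter> T e = {}})"
  have finG: "finite G"
  proof -
    have "G \<subseteq> (SIGMA e:E. T e \<times> T e)" by (auto simp: G_def)
    moreover have "finite (SIGMA e:E. T e \<times> T e)"
      using finite_E TD(1) by (intro finite_SigmaI finite_cartesian_product) auto
    ultimately show ?thesis by (rule finite_subset)
  qed
  define piece where "piece k z = snd (fst z) ` (if k then {fst (snd z)..(fst (snd z) + snd (snd z)) / 2}
     else {(fst (snd z) + snd (snd z)) / 2..snd (snd z)})" for k :: bool and z :: "'a graph_edge \<times> real \<times> real"
  let ?J = "(piece True ` G \<union> piece False ` G) \<union> (\<lambda>v. {v}) ` V"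
  have sing: "monotone_on_piece X X g J \<and> connectedin X J"
    if J: "J = snd e ` {p..q}" and e: "e \<in> E" and pq: "s \<le> p" "p \<le> q" "q \<le> t" "q - p = (t - s) / 2"
      and st: "s \<in> T e" "t \<in> T e" "s < t" "{s<..<t} \<inter> T e = {}" for J e p q s t
  proof -
    obtain e' a b where e': "e' \<in> E" "\<bar>a\<bar> = \<sigma>"
      "\<And>u. u \<in> {s..t} \<Longrightarrow> a * u + b \<in> {0..fst e'} \<and> g (snd e u) = snd e' (a * u + b)"
      using affine_cuts_piece[OF T[OF e] st] by metis
    have st': "0 \<le> s" "t \<le> fst e" using TD(4)[OF e] st by auto
    have con: "connectedin X J" unfolding J using st' pq by (intro connectedin_edge e) auto
    have inj: "u = u'" if u: "u \<in> {p..q}" "u' \<in> {p..q}" "g (snd e u) = g (snd e u')" for u u'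
    proof -
      have us: "u \<in> {s..t}" "u' \<in> {s..t}" using u pq by auto
      have eq: "snd e' (a * u + b) = snd e' (a * u' + b)" using e'(3)[OF us(1)] e'(3)[OF us(2)] u by simp
      have "\<bar>a * s - a * t\<bar> \<le> fst e'" using e'(3)[of s] e'(3)[of t] st by auto
      then have "\<sigma> * (t - s) \<le> fst e'" using e'(2) st by (simp add: right_diff_distrib[symmetric] abs_mult)
      moreover have "\<bar>(a * u + b) - (a * u' + b)\<bar> \<le> \<sigma> * ((t - s) / 2)"
      proof -
        have "\<bar>u - u'\<bar> \<le> q - p" using u(1,2) by (simp add: abs_le_iff)
        then have "\<bar>u - u'\<bar> \<le> (t - s) / 2" using pq(4) by simp
        then have "\<bar>a\<bar> * \<bar>u - u'\<bar> \<le> \<sigma> * ((t - s) / 2)" using e'(2) \<sigma> by (intro mult_mono) auto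
        then show ?thesis by (simp add: abs_mult[symmetric] right_diff_distrib)
      qed
      moreover have "0 < \<sigma> * (t - s)" using \<sigma> st by simp
      ultimately have lt: "\<bar>(a * u + b) - (a * u' + b)\<bar> < fst e'" by simp
      \<comment> \<open>Equal images force equal coordinates or the two opposite ends of the edge,
        and the latter are too far apart by \<open>lt\<close>.\<close>
      have "a * u + b = a * u' + b"
      proof (cases "a * u + b \<in> {0<..<fst e'}")
        case True
        have "a * u' + b = a * u + b" using edge_param_unique[OF e'(1) e'(1) True _ eq] e'(3)[OF us(2)] by blast
        then show ?thesis by (rule sym)
      next
        case False
        then have 1: "a * u + b = 0 \<or> a * u + b = fst e'" using e'(3)[OF us(1)] by auto
        have "a * u' + b \<notin> {0<..<fst e'}"
          using edge_param_unique[OF e'(1) e'(1) _ _ eq[symmetric]] e'(3)[OF us(1)] False by auto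
        then have "a * u' + b = 0 \<or> a * u' + b = fst e'" using e'(3)[OF us(2)] by auto
        with 1 show ?thesis using lt edge_pos[OF e'(1)] by (elim disjE) simp_all
      qed
      then have "a * u = a * u'" by simp
      moreover have "a \<noteq> 0" using e'(2) \<sigma> by auto
      ultimately show "u = u'" by (metis mult_left_cancel)
    qed
    have JX: "J \<subseteq> topspace X" using con connectedin_subset_topspace by blast
    then have top: "topspace (subtopology X J) = J" by (simp add: inf.absorb2)
    have "connectedin X {x \<in> J. g x = y}" for y
    proof (cases "{x \<in> J. g x = y} = {}")
      case False
      then obtain x where x: "x \<in> J" "g x = y" by blast
      have "{x \<in> J. g x = y} = {x}"
      proof -
        have "x' = x" if x': "x' \<in> J" "g x' = y" for x'
        proof -
          obtain u u' where "u \<in> {p..q}" "x = snd e u" "u' \<in> {p..q}" "x' = snd e u'" using x(1) x'(1) unfolding J by blast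
          then show ?thesis using inj[of u u'] x(2) x'(2) by simp
        qed
        then show ?thesis using x by blast
      qed
      then show ?thesis using x JX by auto
    qed (simp only: connectedin_empty)
    then have "monotone_on_piece X X g J"
      using JX continuous_map_image_subset_topspace[OF cont]
      unfolding monotone_on_piece_def monotone_map top connectedin_subtopology by blast
    then show ?thesis using con by blast
  qed
  show ?thesis
    unfolding piecewise_monotone_def
  proof (intro exI[of _ ?J] conjI ballI)
    show "finite ?J" using finG finite_V by simp
    have piece_ok: "connectedin X J \<and> monotone_on_piece X X g J" if J: "J \<in> ?J" for J
    proof -
      consider z where "z \<in> G" "J = piece True z" | z where "z \<in> G" "J = piece False z" | v where "v \<in> V" "J = {v}"
        using J by blast
      then show ?thesis
      proof cases
        case (1 z)
        obtain e s t where z: "z = (e, s, t)" by (cases z)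
        have *: "e \<in> E" "s \<in> T e" "t \<in> T e" "s < t" "{s<..<t} \<inter> T e = {}" using 1(1) by (auto simp: G_def z)
        show ?thesis using sing[of J e s "(s+t)/2" s t] * 1(2) by (auto simp: piece_def z field_simps)
      next
        case (2 z)
        obtain e s t where z: "z = (e, s, t)" by (cases z)
        have *: "e \<in> E" "s \<in> T e" "t \<in> T e" "s < t" "{s<..<t} \<inter> T e = {}" using 2(1) by (auto simp: G_def z)
        show ?thesis using sing[of J e "(s+t)/2" t s t] * 2(2) by (auto simp: piece_def z field_simps)
      next
        case (3 v)
        then have v: "v \<in> topspace X" using V_sub by blast
        have "monotone_on_piece X X g J"
          unfolding monotone_on_piece_def monotone_map
        proof (intro conjI allI)
          have t: "topspace (subtopology X J) = {v}" using 3 v by auto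
          show "g ` topspace (subtopology X J) \<subseteq> topspace X"
            unfolding t using continuous_map_image_subset_topspace[OF cont] v by auto
          fix y
          have "{x \<in> topspace (subtopology X J). g x = y} = {} \<or> {x \<in> topspace (subtopology X J). g x = y} = {v}" unfolding t by auto
          then show "connectedin (subtopology X J) {x \<in> topspace (subtopology X J). g x = y}"
          proof (elim disjE ssubst)
          qed (use v 3(2) in \<open>simp_all add: connectedin_subtopology\<close>)
        qed
        then show ?thesis using 3 v by auto
      qed
    qed
    then show "\<And>J. J \<in> ?J \<Longrightarrow> connectedin X J" "\<And>J. J \<in> ?J \<Longrightarrow> monotone_on_piece X X g J" by blast+
    show "\<Union>?J = topspace X"
    proof
      show "\<Union>?J \<subseteq> topspace X" using piece_ok connectedin_subset_topspace by blast
      show "topspace X \<subseteq> \<Union>?J"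
      proof
        fix x assume "x \<in> topspace X"
        then consider "x \<in> V" | e where "e \<in> E" "x \<in> open_edge e" unfolding topspace_eq by blast
        then show "x \<in> \<Union>?J"
        proof cases
          case 2
          then obtain u where u: "u \<in> {0<..<fst e}" "x = snd e u" unfolding open_edge_eq by blast
          have Te: "finite (T e)" "0 \<in> T e" "fst e \<in> T e" using TD[OF 2(1)] by auto
          obtain \<epsilon> where \<epsilon>: "0 < \<epsilon>" "\<epsilon> \<le> fst e - u" "\<And>c. c \<in> T e \<Longrightarrow> c \<noteq> u \<Longrightarrow> \<epsilon> \<le> \<bar>c - u\<bar>"
            using finite_avoid[OF Te(1), of "fst e - u" u] u by auto
          have "c \<notin> {u<..<u + \<epsilon>}" if "c \<in> T e" for c using \<epsilon>(3)[OF that] by (cases "c = u") auto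
          then have "{u<..<u + \<epsilon>} \<inter> T e = {}" by blast
          then obtain s t where st: "s \<in> T e" "t \<in> T e" "s \<le> u" "u + \<epsilon> \<le> t" "{s<..<t} \<inter> T e = {}"
            using finite_gap[OF Te(1), of u "u + \<epsilon>" 0 "fst e"] Te u \<epsilon> by auto
          then have "(e, s, t) \<in> G" using 2(1) \<epsilon> by (auto simp: G_def)
          moreover have "x \<in> piece True (e, s, t) \<or> x \<in> piece False (e, s, t)"
            using st \<epsilon> u(2) by (cases "u \<le> (s+t)/2") (auto simp: piece_def)
          ultimately show ?thesis by blast
        qed blast
      qed
    qed
  qed
qed

end

section \<open>Total edge length of open sets and the lower entropy bound\<close>

context graph begin

definition slice :: "'a graph_edge \<Rightarrow> 'a set \<Rightarrow> real set"
  where "slice e A = {t \<in> {0..fst e}. snd e t \<in> A}"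

definition len :: "'a set \<Rightarrow> real"
  where "len A = (\<Sum>e\<in>E. measure lebesgue (slice e A))"

lemma slice_borel:
  assumes "e \<in> E" "openin X A" shows "slice e A \<in> sets borel"
proof -
  have "openin (top_of_set {0..fst e}) {t \<in> topspace (top_of_set {0..fst e}). snd e t \<in> A}"
    by (rule openin_continuous_map_preimage[OF edge_cont[OF assms(1)] assms(2)])
  then obtain W where "open W" "slice e A = {0..fst e} \<inter> W" by (auto simp: openin_open slice_def)
  then show ?thesis by (simp add: borel_open)
qed

lemma slice_lmeasurable:
  assumes "e \<in> E" "openin X A" shows "slice e A \<in> lmeasurable"
  using slice_borel[OF assms]
  by (intro bounded_set_imp_lmeasurable) (auto simp: slice_def intro: bounded_subset[OF bounded_closed_interval])

lemma len_mono:
  assumes "openin X A" "openin X B" "A \<subseteq> B" shows "len A \<le> len B"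
  unfolding len_def using assms
  by (intro sum_mono measure_mono_fmeasurable slice_lmeasurable fmeasurableD) (auto simp: slice_def)

lemma len_Union_le:
  assumes "finite \<V>" "\<And>A. A \<in> \<V> \<Longrightarrow> openin X A" shows "len (\<Union>\<V>) \<le> (\<Sum>A\<in>\<V>. len A)"
proof -
  have "len (\<Union>\<V>) \<le> (\<Sum>e\<in>E. \<Sum>A\<in>\<V>. measure lebesgue (slice e A))"
    unfolding len_def
  proof (rule sum_mono)
    fix e assume e: "e \<in> E"
    have "slice e (\<Union>\<V>) = (\<Union>A\<in>\<V>. slice e A)" by (auto simp: slice_def)
    then show "measure lebesgue (slice e (\<Union>\<V>)) \<le> (\<Sum>A\<in>\<V>. measure lebesgue (slice e A))"
      using measure_UNION_le[OF assms(1), of "slice e" lebesgue] slice_lmeasurable[OF e] assms(2)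
      by (simp add: fmeasurableD)
  qed
  then show ?thesis unfolding len_def by (subst (asm) sum.swap)
qed

lemma len_ge_0: "0 \<le> len A" unfolding len_def by (intro sum_nonneg) simp

lemma slice_le_len: "e \<in> E \<Longrightarrow> measure lebesgue (slice e A) \<le> len A"
  unfolding len_def using finite_E by (intro member_le_sum) auto

lemma len_topspace_pos: "0 < len (topspace X)"
proof -
  obtain e where e: "e \<in> E" using E_ne by blast
  have "slice e (topspace X) = {0..fst e}" using edge_in[OF e] by (auto simp: slice_def)
  then show ?thesis using slice_le_len[OF e, of "topspace X"] edge_pos[OF e] by simp
qed

definition params :: "'a graph_edge \<Rightarrow> 'a \<Rightarrow> real set"
  where "params e x = {t \<in> {0..fst e}. snd e t = x}"

text \<open>A vertex can be at most the two ends of an edge, and any other point has at most one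
  coordinate. With two directions each this produces the factor 4 in
  \<open>local_len_bound\<close>.\<close>

lemma card_params:
  assumes e: "e \<in> E" shows "finite (params e x) \<and> card (params e x) \<le> 2"
proof (cases "x \<in> V")
  case True
  have "params e x \<subseteq> {0, fst e}" using edge_V_iff[OF e] True by (auto simp: params_def)
  moreover have "card {0, fst e} \<le> 2" by (simp add: card_insert_if)
  ultimately show ?thesis by (meson card_mono finite.emptyI finite.insertI finite_subset le_trans)
next
  case False
  have "t = t'" if "t \<in> params e x" "t' \<in> params e x" for t t'
  proof -
    have "t \<in> {0<..<fst e}" using that False edge_0[OF e] edge_l[OF e] by (auto simp: params_def le_less)
    then show ?thesis using edge_param_unique[OF e e, of t t'] that by (auto simp: params_def)
  qed
  then have "params e x = {} \<or> (\<exists>t. params e x = {t})" by blast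
  then show ?thesis by auto
qed

text \<open>Every germ of \<open>h\<close> stretches by the factor \<open>c\<close>, and at most four germs start at a given
  point in each edge.\<close>

lemma local_len_bound:
  assumes h: "affine_germs E h c" and c: "0 < c" and cont: "continuous_map X X h" and x: "x \<in> topspace X"
  shows "\<exists>U. openin X U \<and> x \<in> U \<and>
    (\<forall>B. openin X B \<longrightarrow> len {y \<in> topspace X. y \<in> U \<and> h y \<in> B} \<le> (4 * card E / c) * len B)"
proof -
  define Z where "Z = (SIGMA e:E. params e x \<times> {1, -1::real})"
  \<comment> \<open>The premise excludes directions that leave the edge at once; for these any
    positive radius will do.\<close>
  define ok where "ok z \<epsilon> \<longleftrightarrow> (case z of (e, t, d) \<Rightarrow> 0 < \<epsilon> \<and>
    ((\<exists>v>0. t + d * v \<in> {0..fst e}) \<longrightarrow> (\<exists>e' t' d'. affine_germ E h c e t d \<epsilon> e' t' d')))" for z and \<epsilon> :: real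
  have finZ: "finite Z" unfolding Z_def using finite_E card_params by (intro finite_SigmaI) auto
  have "\<forall>z\<in>Z. \<exists>\<epsilon>. ok z \<epsilon>"
  proof
    fix z assume z: "z \<in> Z"
    obtain e t d where zz: "z = (e, t, d)" by (cases z)
    have a: "e \<in> E" "t \<in> {0..fst e}" "\<bar>d\<bar> = 1" using z by (auto simp: Z_def zz params_def)
    show "\<exists>\<epsilon>. ok z \<epsilon>"
    proof (cases "\<exists>v>0. t + d * v \<in> {0..fst e}")
      case True
      then obtain v where v: "0 < v" "t + d * v \<in> {0..fst e}" by blast
      obtain \<epsilon> e' t' d' where "0 < \<epsilon>" "affine_germ E h c e t d \<epsilon> e' t' d'"
        by (rule affine_germsD[OF h a v]) (rule that)
      then have "ok z \<epsilon>" unfolding ok_def zz prod.case by blast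
      then show ?thesis ..
    next
      case False
      then show ?thesis unfolding ok_def zz by (intro exI[of _ 1]) auto
    qed
  qed
  then obtain \<epsilon>z where \<epsilon>z: "\<And>z. z \<in> Z \<Longrightarrow> ok z (\<epsilon>z z)" by (meson bchoice)
  define \<epsilon> where "\<epsilon> = Min (insert 1 (\<epsilon>z ` Z))"
  have \<epsilon>0: "0 < \<epsilon>" unfolding \<epsilon>_def using finZ \<epsilon>z by (auto simp: ok_def split: prod.splits)
  have \<epsilon>le: "\<epsilon> \<le> \<epsilon>z z" if "z \<in> Z" for z unfolding \<epsilon>_def using finZ that by (intro Min_le) auto
  \<comment> \<open>Removing the compact sets of points whose coordinates are at distance at least
    \<open>\<epsilon>\<close> from all coordinates of \<open>x\<close> leaves an open
    \<open>U\<close>, each of whose points lies on a germ at \<open>x\<close>.\<close>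
  define K where "K e = {\<tau> \<in> {0..fst e}. \<forall>t\<in>params e x. \<epsilon> \<le> \<bar>\<tau> - t\<bar>}" for e
  define U where "U = topspace X - (\<Union>e\<in>E. snd e ` K e)"
  have Kc: "closedin X (snd e ` K e)" if "e \<in> E" for e
  proof (rule closedin_edge[OF that])
    have "K e = {0..fst e} \<inter> (\<Inter>t\<in>params e x. {\<tau>. \<epsilon> \<le> \<bar>\<tau> - t\<bar>})" by (auto simp: K_def)
    moreover have "closed (\<Inter>t\<in>params e x. {\<tau>. \<epsilon> \<le> \<bar>\<tau> - t\<bar>})"
      by (intro closed_INT ballI closed_Collect_le continuous_intros)
    ultimately show "compact (K e)" by (simp add: compact_Int_closed)
  qed (auto simp: K_def)
  have "closedin X (\<Union>e\<in>E. snd e ` K e)" using finite_E Kc by (intro closedin_Union) auto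
  then have Uo: "openin X U" unfolding U_def by (rule openin_diff[OF openin_topspace])
  have xU: "x \<in> U" unfolding U_def
  proof (intro DiffI x notI)
    assume "x \<in> (\<Union>e\<in>E. snd e ` K e)"
    then obtain e t where "e \<in> E" "t \<in> K e" "x = snd e t" by blast
    then have "t \<in> params e x" "t \<in> K e" by (auto simp: K_def params_def)
    then show False using \<epsilon>0 unfolding K_def by force
  qed
  have near: "\<exists>t\<in>params e x. \<bar>\<tau> - t\<bar> < \<epsilon>" if "e \<in> E" "\<tau> \<in> slice e U" for e \<tau>
  proof -
    have "\<tau> \<in> {0..fst e}" "snd e \<tau> \<notin> snd e ` K e" using that by (auto simp: slice_def U_def)
    then have "\<tau> \<notin> K e" by blast
    then show ?thesis using \<open>\<tau> \<in> {0..fst e}\<close> unfolding K_def by force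
  qed
  have bound: "len {y \<in> topspace X. y \<in> U \<and> h y \<in> B} \<le> (4 * card E / c) * len B" if B: "openin X B" for B
  proof -
    let ?A = "{y \<in> topspace X. y \<in> U \<and> h y \<in> B}"
    have "?A = U \<inter> {y \<in> topspace X. h y \<in> B}" by auto
    then have Ao: "openin X ?A" using Uo openin_continuous_map_preimage[OF cont B] by (simp add: openin_Int)
    have edge: "measure lebesgue (slice e ?A) \<le> 4 / c * len B" if e: "e \<in> E" for e
    proof -
      define cov where "cov p S \<longleftrightarrow> S \<in> lmeasurable \<and> measure lebesgue S \<le> len B / c \<and>
         (\<forall>w. 0 \<le> w \<and> w < \<epsilon> \<and> fst p + snd p * w \<in> slice e ?A \<longrightarrow> fst p + snd p * w \<in> S)" for p :: "real \<times> real" and S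
      have "\<forall>p\<in>params e x \<times> {1, -1}. \<exists>S. cov p S"
      proof
        fix p :: "real \<times> real" assume p: "p \<in> params e x \<times> {1, -1}"
        obtain t d where td: "p = (t, d)" by (cases p)
        have t: "t \<in> {0..fst e}" "snd e t = x" and d: "\<bar>d\<bar> = 1" using p by (auto simp: td params_def)
        have z: "(e, t, d) \<in> Z" using p e by (auto simp: Z_def td)
        show "\<exists>S. cov p S"
        proof (cases "\<exists>v>0. t + d * v \<in> {0..fst e}")
          case False
          have "w = 0" if "0 \<le> w" "t + d * w \<in> slice e ?A" for w
            using that False by (metis (no_types, lifting) mem_Collect_eq order_le_less slice_def)
          moreover have "{t} \<in> lmeasurable" by (rule bounded_set_imp_lmeasurable) auto
          ultimately have "cov p {t}" using c len_ge_0 by (auto simp: cov_def td)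
          then show ?thesis ..
        next
          case True
          then obtain e' t' d' where g: "affine_germ E h c e t d (\<epsilon>z (e, t, d)) e' t' d'"
            using \<epsilon>z[OF z] by (auto simp: ok_def)
          note g = affine_germD[OF g]
          \<comment> \<open>The slope of the inverse of the germ: z = t' + d' c w gives t + d w = q
            z + (t - q t'), because d' squared is 1. The factor 1 / c in the measure comes from
            here.\<close>
          define q where "q = d * d' / c"
          have q: "\<bar>q\<bar> = 1 / c" "q \<noteq> 0" using d g(2) c by (auto simp: q_def abs_mult)
          define S where "S = (\<lambda>z. q *\<^sub>R z + (t - q * t')) ` slice e' B"
          have mS: "measure lebesgue S = measure lebesgue (slice e' B) / c"
            using measure_lebesgue_affine[of q "t - q * t'" "slice e' B"] q(1) by (simp add: S_def)
          have "S = (\<lambda>u. (u - (t - q * t')) / q) -` slice e' B"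
          proof (intro set_eqI iffI)
            fix u assume "u \<in> S"
            then obtain z where "z \<in> slice e' B" "u = q * z + (t - q * t')" by (auto simp: S_def)
            then show "u \<in> (\<lambda>u. (u - (t - q * t')) / q) -` slice e' B" using q(2) by simp
          next
            fix u assume "u \<in> (\<lambda>u. (u - (t - q * t')) / q) -` slice e' B"
            then show "u \<in> S" unfolding S_def using q(2)
              by (intro image_eqI[of _ _ "(u - (t - q * t')) / q"]) auto
          qed
          moreover have "(\<lambda>u. (u - (t - q * t')) / q) \<in> borel_measurable borel" by measurable
          ultimately have "S \<in> sets borel"
            using slice_borel[OF g(1) B] measurable_sets[of "\<lambda>u. (u - (t - q * t')) / q" borel borel "slice e' B"] by simp
          moreover have "bounded S"
          proof -
            have "bounded (slice e' B)" by (rule bounded_subset[OF bounded_closed_interval, of _ 0 "fst e'"]) (auto simp: slice_def)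
            then have "bounded ((\<lambda>z. (t - q * t') + z) ` ((\<lambda>z. q *\<^sub>R z) ` slice e' B))"
              by (intro bounded_translation bounded_scaling)
            moreover have "(\<lambda>z. (t - q * t') + z) ` ((\<lambda>z. q *\<^sub>R z) ` slice e' B) = S"
              by (auto simp: S_def image_image add.commute)
            ultimately show ?thesis by simp
          qed
          ultimately have lS: "S \<in> lmeasurable" by (intro bounded_set_imp_lmeasurable) auto
          have "t + d * w \<in> S" if w: "0 \<le> w" "w < \<epsilon>" "t + d * w \<in> slice e ?A" for w
          proof -
            have w': "w \<le> \<epsilon>z (e, t, d)" using w \<epsilon>le[OF z] by simp
            have "h (snd e (t + d * w)) \<in> B" using w(3) by (simp add: slice_def)
            then have "t' + d' * (c * w) \<in> slice e' B" using g(3,4)[OF w(1) w'] by (simp add: slice_def)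
            moreover have "t + d * w = q *\<^sub>R (t' + d' * (c * w)) + (t - q * t')"
            proof -
              have "d' * d' = 1" using unit_cases[OF g(2)] by auto
              then have "q * (d' * (c * w)) = d * w" using c by (simp add: q_def mult.assoc mult.left_commute)
              then show ?thesis unfolding real_scaleR_def distrib_left by linarith
            qed
            ultimately show ?thesis unfolding S_def by (rule rev_image_eqI)
          qed
          moreover have "measure lebesgue S \<le> len B / c"
            unfolding mS using slice_le_len[OF g(1), of B] c by (simp add: divide_right_mono)
          ultimately have "cov p S" using lS by (simp add: cov_def td)
          then show ?thesis ..
        qed
      qed
      then obtain S where S: "\<And>p. p \<in> params e x \<times> {1, -1} \<Longrightarrow> cov p (S p)" by (meson bchoice)
      have finP: "finite (params e x \<times> {1, -1::real})" using card_params[OF e] by simp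
      have "slice e ?A \<subseteq> (\<Union>p\<in>params e x \<times> {1, -1}. S p)"
      proof
        fix \<tau> assume \<tau>: "\<tau> \<in> slice e ?A"
        then have "\<tau> \<in> slice e U" by (auto simp: slice_def)
        from near[OF e this] obtain t where t: "t \<in> params e x" "\<bar>\<tau> - t\<bar> < \<epsilon>" by blast
        define d where "d = (if t \<le> \<tau> then 1 else -1::real)"
        have "\<tau> = t + d * \<bar>\<tau> - t\<bar>" by (auto simp: d_def)
        moreover have p: "(t, d) \<in> params e x \<times> {1, -1}" using t by (auto simp: d_def)
        ultimately have "\<tau> \<in> S (t, d)"
          using S[OF p, unfolded cov_def fst_conv snd_conv, THEN conjunct2, THEN conjunct2, rule_format, of "\<bar>\<tau> - t\<bar>"] \<tau> t(2)
          by simp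
        then show "\<tau> \<in> (\<Union>p\<in>params e x \<times> {1, -1}. S p)" using p by blast
      qed
      moreover have "(\<Union>p\<in>params e x \<times> {1, -1}. S p) \<in> lmeasurable"
        using finP S by (intro fmeasurable.finite_UN[OF finP]) (auto simp: cov_def)
      ultimately have "measure lebesgue (slice e ?A) \<le> measure lebesgue (\<Union>p\<in>params e x \<times> {1, -1}. S p)"
        using slice_lmeasurable[OF e Ao] by (intro measure_mono_fmeasurable) auto
      also have "\<dots> \<le> (\<Sum>p\<in>params e x \<times> {1, -1}. measure lebesgue (S p))"
        using finP S by (intro measure_UNION_le) (auto simp: cov_def fmeasurableD)
      also have "\<dots> \<le> (\<Sum>p\<in>params e x \<times> {1, -1::real}. len B / c)"
        using S by (intro sum_mono) (auto simp: cov_def)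
      also have "\<dots> = real (card (params e x) * 2) * (len B / c)"
        by (simp add: card_cartesian_product)
      also have "\<dots> \<le> 4 * (len B / c)"
        using card_params[OF e, of x] len_ge_0[of B] c by (intro mult_right_mono) auto
      finally show ?thesis by simp
    qed
    have "len ?A \<le> (\<Sum>e\<in>E. 4 / c * len B)" unfolding len_def[of ?A] by (intro sum_mono edge)
    then show ?thesis by (simp add: mult_ac)
  qed
  show ?thesis using Uo xU bound by blast
qed

lemma len_iterated_join:
  assumes cont: "continuous_map X X h" and U: "open_cover X \<U>" and k: "0 \<le> k"
    and bound: "\<And>U B. U \<in> \<U> \<Longrightarrow> openin X B \<Longrightarrow> len {y \<in> topspace X. y \<in> U \<and> h y \<in> B} \<le> k * len B"
    and A: "A \<in> iterated_join X h \<U> n"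
  shows "len A \<le> k ^ n * len (topspace X)"
  using A
proof (induction n arbitrary: A)
  case 0
  then show ?case by (simp add: iterated_join_0)
next
  case (Suc n)
  have h': "h \<in> topspace X \<rightarrow> topspace X" using cont continuous_map_funspace by blast
  obtain U' B where *: "U' \<in> \<U>" "B \<in> iterated_join X h \<U> n" "A = {x \<in> topspace X. x \<in> U' \<and> h x \<in> B}"
    by (rule iterated_join_SucE[OF Suc.prems h'])
  have "openin X B" using open_cover_iterated_join[OF cont U, of n] *(2) by (auto simp: open_cover_def)
  then have "len A \<le> k * len B" using bound[OF *(1)] *(3) by simp
  also have "\<dots> \<le> k * (k ^ n * len (topspace X))" using Suc.IH[OF *(2)] k by (rule mult_left_mono)
  finally show ?case by simp
qed

text \<open>For the iterate \<open>g ^^ m\<close> the multiplicity in \<open>local_len_bound\<close> does not grow with \<open>m\<close>, so its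
  effect on the entropy vanishes as \<open>m\<close> tends to infinity.\<close>

lemma topological_entropy_ge_power:
  assumes g: "affine_germs E g \<sigma>" and \<sigma>: "0 < \<sigma>" and cont: "continuous_map X X g" and m: "0 < m"
  shows "ereal (ln \<sigma> - ln (4 * real (card E)) / real m) \<le> topological_entropy X g"
proof -
  define K where "K = 4 * real (card E)"
  have K: "0 < K" using finite_E E_ne by (simp add: K_def card_gt_0_iff)
  define h where "h = g ^^ m"
  define k where "k = K / \<sigma> ^ m"
  have k: "0 < k" using K \<sigma> by (simp add: k_def)
  have hg: "affine_germs E h (\<sigma> ^ m)" unfolding h_def by (rule affine_germs_pow[OF g \<sigma>])
  have hc: "continuous_map X X h"
    unfolding h_def
  proof (induction m)
    case 0
    then show ?case by (simp add: id_def[symmetric])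
  next
    case (Suc m)
    then show ?case using continuous_map_compose[OF Suc cont] by (simp add: o_def)
  qed
  have "\<forall>x\<in>topspace X. \<exists>U. openin X U \<and> x \<in> U \<and> (\<forall>B. openin X B \<longrightarrow> len {y \<in> topspace X. y \<in> U \<and> h y \<in> B} \<le> k * len B)"
    using local_len_bound[OF hg _ hc] \<sigma> unfolding k_def K_def by simp
  from bchoice[OF this] obtain U where "\<forall>x\<in>topspace X. openin X (U x) \<and> x \<in> U x \<and>
      (\<forall>B. openin X B \<longrightarrow> len {y \<in> topspace X. y \<in> U x \<and> h y \<in> B} \<le> k * len B)" by (rule exE)
  then have U: "\<And>x. x \<in> topspace X \<Longrightarrow> openin X (U x) \<and> x \<in> U x"
    "\<And>x B. x \<in> topspace X \<Longrightarrow> openin X B \<Longrightarrow> len {y \<in> topspace X. y \<in> U x \<and> h y \<in> B} \<le> k * len B"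
    by simp_all
  define \<U> where "\<U> = U ` topspace X"
  have oc: "open_cover X \<U>"
    unfolding open_cover_def \<U>_def using U openin_subset by fastforce
  have bound: "len {y \<in> topspace X. y \<in> W \<and> h y \<in> B} \<le> k * len B" if "W \<in> \<U>" "openin X B" for W B
    using that U by (auto simp: \<U>_def)
  define N where "N n = subcover_number X (iterated_join X g \<U> n)" for n
  \<comment> \<open>Keeping only the times divisible by \<open>m\<close> puts each member of the
    join for \<open>g\<close> into a member of the \<open>n\<close>-fold join for \<open>h\<close>,
    of length at most \<open>k ^ n\<close> times the total. The lengths of a subcover must add up to
    at least the total.\<close>
  have N: "1 \<le> real (N (m * n)) * k ^ n" for n
  proof -
    obtain \<V> where V: "finite \<V>" "\<V> \<subseteq> iterated_join X g \<U> (m * n)" "\<Union>\<V> = topspace X" "card \<V> = N (m * n)"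
      unfolding N_def by (rule subcover_number_attained[OF compact_space open_cover_iterated_join[OF cont oc]])
    have Vo: "openin X A" if "A \<in> \<V>" for A
      using open_cover_iterated_join[OF cont oc, of "m * n"] V(2) that by (auto simp: open_cover_def)
    have lA: "len A \<le> k ^ n * len (topspace X)" if AV: "A \<in> \<V>" for A
    proof -
      obtain W where W: "\<forall>i<m * n. W i \<in> \<U>" "A = {x \<in> topspace X. \<forall>i<m * n. (g ^^ i) x \<in> W i}"
        using subsetD[OF V(2) AV] unfolding iterated_join_def by auto
      let ?B = "{x \<in> topspace X. \<forall>j<n. (h ^^ j) x \<in> W (m * j)}"
      have lt: "m * j < m * n" if "j < n" for j using that m by simp
      have B: "?B \<in> iterated_join X h \<U> n" unfolding iterated_join_def using W(1) lt by (intro CollectI exI[of _ "\<lambda>j. W (m * j)"]) simp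
      have "openin X ?B" using open_cover_iterated_join[OF hc oc, of n] B unfolding open_cover_def by blast
      moreover have "A \<subseteq> ?B" unfolding W(2) h_def using lt by (auto simp: funpow_mult)
      ultimately have "len A \<le> len ?B" using Vo[OF that] by (intro len_mono)
      also have "\<dots> \<le> k ^ n * len (topspace X)"
        using k by (intro len_iterated_join[OF hc oc _ bound B]) auto
      finally show ?thesis .
    qed
    have "len (topspace X) \<le> (\<Sum>A\<in>\<V>. len A)" using len_Union_le[OF V(1) Vo] V(3) by simp
    also have "\<dots> \<le> (\<Sum>A\<in>\<V>. k ^ n * len (topspace X))" by (intro sum_mono lA)
    also have "\<dots> = (real (N (m * n)) * k ^ n) * len (topspace X)" using V(4) by simp
    finally show ?thesis using len_topspace_pos by simp
  qed
  let ?a = "\<lambda>n. ereal (ln (real (N n)) / real n)"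
  \<comment> \<open>With \<open>Suc n\<close> the index is positive; at index 0 the quotient would
    be a division by zero.\<close>
  have low: "ereal (ln \<sigma> - ln K / real m) \<le> ?a (m * Suc n)" for n
  proof -
    have "0 < real (N (m * Suc n))" using N[of "Suc n"] by (cases "N (m * Suc n) = 0") auto
    then have "0 \<le> ln (real (N (m * Suc n))) + real (Suc n) * ln k"
      using N[of "Suc n"] k ln_ge_zero[OF N[of "Suc n"]] by (simp add: ln_mult ln_realpow algebra_simps)
    moreover have "ln k = ln K - real m * ln \<sigma>" using K \<sigma> by (simp add: k_def ln_div ln_realpow)
    ultimately have "real (Suc n) * (real m * ln \<sigma> - ln K) \<le> ln (real (N (m * Suc n)))" by (simp add: algebra_simps)
    moreover have "real (m * Suc n) * (ln \<sigma> - ln K / real m) = real (Suc n) * (real m * (ln \<sigma> - ln K / real m))"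
      by (simp only: of_nat_mult mult_ac)
    moreover have "real m * (ln \<sigma> - ln K / real m) = real m * ln \<sigma> - ln K" using m by (simp add: right_diff_distrib)
    ultimately have "real (m * Suc n) * (ln \<sigma> - ln K / real m) \<le> ln (real (N (m * Suc n)))" by metis
    then show ?thesis using m by (simp add: pos_le_divide_eq mult.commute del: of_nat_mult of_nat_Suc mult_Suc_right)
  qed
  have sm: "strict_mono (\<lambda>n. m * Suc n)" using m by (simp add: strict_mono_Suc_iff)
  have "ereal (ln \<sigma> - ln K / real m) \<le> limsup (?a \<circ> (\<lambda>n. m * Suc n))"
    using low by (intro le_Limsup) (auto intro!: always_eventually)
  also have "\<dots> \<le> limsup ?a" by (rule limsup_subseq_mono[OF sm])
  also have "\<dots> = cover_entropy X g \<U>" by (simp add: cover_entropy_def N_def)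
  also have "\<dots> \<le> topological_entropy X g"
    unfolding topological_entropy_def using oc by (intro SUP_upper) simp
  finally show ?thesis by (simp add: K_def)
qed

lemma topological_entropy_ge:
  assumes g: "affine_slope E g \<sigma>" and \<sigma>: "0 < \<sigma>" and cont: "continuous_map X X g"
  shows "ereal (ln \<sigma>) \<le> topological_entropy X g"
proof (rule LIMSEQ_le_const2)
  have "(\<lambda>n. ln \<sigma> - ln (4 * real (card E)) * (1 / real (Suc n))) \<longlonglongrightarrow> ln \<sigma> - ln (4 * real (card E)) * 0"
    by (intro tendsto_intros LIMSEQ_Suc[OF lim_1_over_n])
  then show "(\<lambda>n. ereal (ln \<sigma> - ln (4 * real (card E)) / real (Suc n))) \<longlonglongrightarrow> ereal (ln \<sigma>)" by simp
  show "\<exists>N. \<forall>n\<ge>N. ereal (ln \<sigma> - ln (4 * real (card E)) / real (Suc n)) \<le> topological_entropy X g"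
    using topological_entropy_ge_power[OF affine_slope_imp_germs[OF g \<sigma>] \<sigma> cont] by (simp del: of_nat_Suc)
qed

end


section \<open>Collapsing the null intervals of a monotone family\<close>

text \<open>The family may vanish on whole edges, which are then contracted to vertices. By
  \<open>u_nontrivial\<close> at least one edge survives, as the definition of a graph
  requires.\<close>

locale collapse = graph X V E for X :: "'a topology" and V E +
  fixes u :: "'a graph_edge \<Rightarrow> real \<Rightarrow> real"
  assumes u_cont: "e \<in> E \<Longrightarrow> continuous_on {0..fst e} (u e)"
    and u_mono: "e \<in> E \<Longrightarrow> mono_on {0..fst e} (u e)"
    and u_0: "e \<in> E \<Longrightarrow> u e 0 = 0"
    and u_nontrivial: "\<exists>e\<in>E. 0 < u e (fst e)"
begin

lemma uD: "e \<in> E \<Longrightarrow> 0 \<le> s \<Longrightarrow> s \<le> t \<Longrightarrow> t \<le> fst e \<Longrightarrow> u e s \<le> u e t"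
  using mono_onD[OF u_mono, of e s t] by simp

lemma u_bounds: "e \<in> E \<Longrightarrow> t \<in> {0..fst e} \<Longrightarrow> 0 \<le> u e t \<and> u e t \<le> u e (fst e)"
  using uD[of e 0 t] uD[of e t "fst e"] u_0 by auto

lemma u_IVT:
  assumes "e \<in> E" "0 \<le> s" "s \<le> t" "t \<le> fst e" "y \<in> {u e s..u e t}"
  obtains x where "x \<in> {s..t}" "u e x = y"
  using IVT'[of "u e" s y t] assms continuous_on_subset[OF u_cont[OF assms(1)], of "{s..t}"] by auto

section \<open>The collapsing relation and the quotient topology\<close>

text \<open>Relates points at the same level of one edge. It fails to be transitive where collapsed
  segments of several edges meet at a vertex, and an isolated vertex is not related to itself; hence
  the use of \<open>R\<^sup>*\<close>.\<close>

definition R :: "('a \<times> 'a) set"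
  where "R = {(x, y). \<exists>e\<in>E. \<exists>t\<in>{0..fst e}. \<exists>t'\<in>{0..fst e}. x = snd e t \<and> y = snd e t' \<and> u e t = u e t'}"

lemma RI: "e \<in> E \<Longrightarrow> t \<in> {0..fst e} \<Longrightarrow> t' \<in> {0..fst e} \<Longrightarrow> u e t = u e t' \<Longrightarrow> (snd e t, snd e t') \<in> R"
  unfolding R_def by blast

lemma RE:
  assumes "(x, y) \<in> R"
  obtains e t t' where "e \<in> E" "t \<in> {0..fst e}" "t' \<in> {0..fst e}" "x = snd e t" "y = snd e t'" "u e t = u e t'"
proof -
  have "\<exists>e\<in>E. \<exists>t\<in>{0..fst e}. \<exists>t'\<in>{0..fst e}. x = snd e t \<and> y = snd e t' \<and> u e t = u e t'"
    using assms by (simp add: R_def)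
  then show ?thesis using that by (elim bexE conjE)
qed

lemma R_sym: "(x, y) \<in> R \<Longrightarrow> (y, x) \<in> R"
  by (elim RE) (simp add: RI)

lemma rtrancl_sym: "(x, y) \<in> R\<^sup>* \<Longrightarrow> (y, x) \<in> R\<^sup>*"
  using R_sym by (metis sym_def sym_rtrancl)

lemma R_topspace: "(x, y) \<in> R \<Longrightarrow> x \<in> topspace X \<and> y \<in> topspace X"
  by (elim RE) (simp add: edge_in)

lemma rtrancl_topspace: "(x, y) \<in> R\<^sup>* \<Longrightarrow> x \<in> topspace X \<longleftrightarrow> y \<in> topspace X"
  by (induction rule: rtrancl_induct) (use R_topspace in blast)+

lemma R_from_edge:
  assumes "e \<in> E" "t \<in> {0<..<fst e}" "(snd e t, z) \<in> R"
  obtains t' where "t' \<in> {0..fst e}" "z = snd e t'" "u e t' = u e t"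
proof -
  obtain e1 t1 t' where *: "e1 \<in> E" "t1 \<in> {0..fst e1}" "t' \<in> {0..fst e1}" "snd e t = snd e1 t1" "z = snd e1 t'" "u e1 t1 = u e1 t'"
    using assms(3) by (rule RE)
  then have "e1 = e \<and> t1 = t" using edge_param_unique[OF assms(1) *(1) assms(2) *(2)] by simp
  then show ?thesis using that * by simp
qed

text \<open>A point that is not a vertex has a single coordinate, so two steps through it take place
  in the same edge at the same level.\<close>

lemma R_trans_off_V:
  assumes xy: "(x, y) \<in> R" and yz: "(y, z) \<in> R" and y: "y \<notin> V" shows "(x, z) \<in> R"
proof -
  obtain e t t' where *: "e \<in> E" "t \<in> {0..fst e}" "t' \<in> {0..fst e}" "x = snd e t" "y = snd e t'" "u e t = u e t'"
    using xy by (rule RE)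
  have "t' \<in> {0<..<fst e}" using edge_V_iff[OF *(1,3)] y *(3,5) by auto
  from R_from_edge[OF *(1) this] yz *(5)
  obtain t'' where "t'' \<in> {0..fst e}" "z = snd e t''" "u e t'' = u e t'" by metis
  then show ?thesis using * RI by metis
qed

text \<open>Chains contract at all points that are not vertices. As there are finitely many
  vertices, closures of arbitrarily long chains reduce to finite unions.\<close>

lemma rtrancl_through_V:
  assumes "(x, z) \<in> R\<^sup>*"
  shows "x = z \<or> (x, z) \<in> R \<or> (\<exists>v\<in>V. (x, v) \<in> R\<^sup>* \<and> (v, z) \<in> R\<^sup>*)"
  using assms
proof (induction rule: rtrancl_induct)
  case (step y z)
  show ?case
  proof (cases "y \<in> V")
    case True
    then show ?thesis using step.hyps by blast
  next
    case False
    then show ?thesis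
      using step.IH step.hyps R_trans_off_V by (meson rtrancl.rtrancl_into_rtrancl)
  qed
qed simp

text \<open>On each edge the image consists of the points whose level is attained on the trace of
  \<open>S\<close>: the preimage under \<open>u e\<close> of a compact set.\<close>

lemma closedin_R_image:
  assumes S: "closedin X S" shows "closedin X (R `` S)"
proof -
  define A :: "'a graph_edge \<Rightarrow> real set" where "A e = {t \<in> {0..fst e}. snd e t \<in> S}" for e
  define K where "K e = {0..fst e} \<inter> u e -` (u e ` A e)" for e
  have "closedin X (snd e ` K e)" if e: "e \<in> E" for e
  proof (rule closedin_edge[OF e])
    have "closedin (top_of_set {0..fst e}) {t \<in> topspace (top_of_set {0..fst e}). snd e t \<in> S}"
      by (rule closedin_continuous_map_preimage[OF edge_cont[OF e] S])
    then have "closedin (top_of_set {0..fst e}) (A e)" by (simp add: A_def)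
    then have "compact (A e)" using closedin_compact by blast
    then have "compact (u e ` A e)"
      by (rule compact_continuous_image[rotated]) (rule continuous_on_subset[OF u_cont[OF e]], auto simp: A_def)
    then have "closed (K e)"
      unfolding K_def by (intro continuous_closed_preimage u_cont e compact_imp_closed) auto
    then show "compact (K e)" unfolding K_def using compact_Icc by (metis K_def bounded_Int bounded_closed_interval compact_eq_bounded_closed)
  qed (auto simp: K_def)
  then have "closedin X (\<Union>e\<in>E. snd e ` K e)" using finite_E by (intro closedin_Union) auto
  moreover have "R `` S = (\<Union>e\<in>E. snd e ` K e)"
  proof (intro equalityI subsetI)
    fix y assume "y \<in> R `` S"
    then obtain x where x: "x \<in> S" "(x, y) \<in> R" by blast
    obtain e t t' where *: "e \<in> E" "t \<in> {0..fst e}" "t' \<in> {0..fst e}" "x = snd e t" "y = snd e t'" "u e t = u e t'"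
      using x(2) by (rule RE)
    then have "t \<in> A e" using x by (simp add: A_def)
    then have "u e t' \<in> u e ` A e" using *(6) by (metis imageI)
    then have "t' \<in> K e" using *(3) by (simp add: K_def)
    then show "y \<in> (\<Union>e\<in>E. snd e ` K e)" using * by blast
  next
    fix y assume "y \<in> (\<Union>e\<in>E. snd e ` K e)"
    then obtain e t' where *: "e \<in> E" "t' \<in> K e" "y = snd e t'" by blast
    then obtain t where "t \<in> A e" "u e t' = u e t" "t' \<in> {0..fst e}" by (auto simp: K_def)
    then have "(snd e t, y) \<in> R" "snd e t \<in> S" using RI[OF *(1), of t t'] * by (auto simp: A_def)
    then show "y \<in> R `` S" by blast
  qed
  ultimately show ?thesis by simp
qed

text \<open>By \<open>R_trans_off_V\<close> everything in the class is a vertex of the class or one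
  step away from such a vertex.\<close>

lemma closedin_vertex_class:
  assumes v: "v \<in> V" shows "closedin X (R\<^sup>* `` {v})"
proof -
  let ?W = "V \<inter> R\<^sup>* `` {v}"
  have "z \<in> (\<Union>w\<in>?W. {w} \<union> R `` {w})" if "(v, z) \<in> R\<^sup>*" for z
    using that
  proof (induction rule: rtrancl_induct)
    case base
    then show ?case using v by blast
  next
    case (step y z)
    show ?case
    proof (cases "y \<in> V")
      case True
      then show ?thesis using step.hyps by blast
    next
      case False
      then obtain w where "w \<in> ?W" "(w, y) \<in> R" using step.IH by blast
      then show ?thesis using R_trans_off_V[OF _ step.hyps(2) False] by blast
    qed
  qed
  moreover have "(\<Union>w\<in>?W. {w} \<union> R `` {w}) \<subseteq> R\<^sup>* `` {v}"
    by (auto intro: rtrancl_into_rtrancl)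
  ultimately have eq: "R\<^sup>* `` {v} = (\<Union>w\<in>?W. {w} \<union> R `` {w})" by blast
  have "closedin X ({w} \<union> R `` {w})" if "w \<in> ?W" for w
    using that by (intro closedin_Un closedin_R_image closedin_V) auto
  then have "closedin X (\<Union>w\<in>?W. {w} \<union> R `` {w})" using finite_V by (intro closedin_Union) auto
  then show ?thesis using eq by argo
qed

text \<open>Makes \<open>rho\<close> a closed map. A continuous closed image of a compact Hausdorff
  space is Hausdorff, by normality.\<close>

lemma closedin_saturation:
  assumes S: "closedin X S" shows "closedin X (R\<^sup>* `` S)"
proof -
  let ?W = "V \<inter> R\<^sup>* `` S"
  have "R\<^sup>* `` S = S \<union> R `` S \<union> (\<Union>v\<in>?W. R\<^sup>* `` {v})"
  proof (intro equalityI subsetI)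
    fix z assume "z \<in> R\<^sup>* `` S"
    then obtain x where x: "x \<in> S" "(x, z) \<in> R\<^sup>*" by blast
    from rtrancl_through_V[OF x(2)] show "z \<in> S \<union> R `` S \<union> (\<Union>v\<in>?W. R\<^sup>* `` {v})"
    proof (elim disjE bexE conjE)
      fix v assume "v \<in> V" "(x, v) \<in> R\<^sup>*" "(v, z) \<in> R\<^sup>*"
      then have "v \<in> ?W" "z \<in> R\<^sup>* `` {v}" using x by auto
      then show ?thesis by blast
    qed (use x in auto)
  next
    fix z assume "z \<in> S \<union> R `` S \<union> (\<Union>v\<in>?W. R\<^sup>* `` {v})"
    then show "z \<in> R\<^sup>* `` S" by (auto intro: rtrancl_trans)
  qed
  moreover have "closedin X (\<Union>v\<in>?W. R\<^sup>* `` {v})"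
    using finite_V closedin_vertex_class by (intro closedin_Union) auto
  ultimately show ?thesis using closedin_Un[OF closedin_Un[OF S closedin_R_image[OF S]]] by metis
qed

text \<open>Classes are represented by chosen points, so that the quotient lives on the same type.\<close>

definition rho :: "'a \<Rightarrow> 'a" where "rho x = (SOME y. (x, y) \<in> R\<^sup>*)"

lemma rho_rel: "(x, rho x) \<in> R\<^sup>*"
  unfolding rho_def by (rule someI[of _ x]) simp

lemma rho_eq_iff: "rho x = rho y \<longleftrightarrow> (x, y) \<in> R\<^sup>*"
proof
  assume "rho x = rho y"
  then show "(x, y) \<in> R\<^sup>*" using rho_rel[of x] rho_rel[of y] rtrancl_sym rtrancl_trans by metis
next
  assume "(x, y) \<in> R\<^sup>*"
  then have "(x, z) \<in> R\<^sup>* \<longleftrightarrow> (y, z) \<in> R\<^sup>*" for z using rtrancl_sym rtrancl_trans by metis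
  then show "rho x = rho y" by (simp add: rho_def)
qed

lemma rho_idem: "rho (rho x) = rho x"
  using rho_rel[of x] rtrancl_sym by (simp add: rho_eq_iff)

lemma rho_in: "x \<in> topspace X \<Longrightarrow> rho x \<in> topspace X"
  using rtrancl_topspace[OF rho_rel] by blast

definition Q :: "'a topology"
  where "Q = topology (\<lambda>U. U \<subseteq> rho ` topspace X \<and> openin X {x \<in> topspace X. rho x \<in> U})"

lemma openin_Q: "openin Q U \<longleftrightarrow> U \<subseteq> rho ` topspace X \<and> openin X {x \<in> topspace X. rho x \<in> U}"
proof -
  have "istopology (\<lambda>U. U \<subseteq> rho ` topspace X \<and> openin X {x \<in> topspace X. rho x \<in> U})"
    unfolding istopology_def
  proof (intro conjI allI impI)
    fix S T assume a: "S \<subseteq> rho ` topspace X \<and> openin X {x \<in> topspace X. rho x \<in> S}"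
      "T \<subseteq> rho ` topspace X \<and> openin X {x \<in> topspace X. rho x \<in> T}"
    have "{x \<in> topspace X. rho x \<in> S \<inter> T} = {x \<in> topspace X. rho x \<in> S} \<inter> {x \<in> topspace X. rho x \<in> T}" by auto
    then show "S \<inter> T \<subseteq> rho ` topspace X" "openin X {x \<in> topspace X. rho x \<in> S \<inter> T}"
      using a by (blast, simp add: openin_Int)
  next
    fix \<K> assume a: "\<forall>K\<in>\<K>. K \<subseteq> rho ` topspace X \<and> openin X {x \<in> topspace X. rho x \<in> K}"
    then show "\<Union>\<K> \<subseteq> rho ` topspace X" by blast
    have "{x \<in> topspace X. rho x \<in> \<Union>\<K>} = (\<Union>K\<in>\<K>. {x \<in> topspace X. rho x \<in> K})" by auto
    then show "openin X {x \<in> topspace X. rho x \<in> \<Union>\<K>}" using a by auto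
  qed
  then show ?thesis by (simp add: Q_def topology_inverse')
qed

lemma topspace_Q: "topspace Q = rho ` topspace X"
proof
  show "topspace Q \<subseteq> rho ` topspace X" using openin_Q openin_topspace by blast
  have "{x \<in> topspace X. rho x \<in> rho ` topspace X} = topspace X" by blast
  then have "openin Q (rho ` topspace X)" by (simp add: openin_Q)
  then show "rho ` topspace X \<subseteq> topspace Q" by (rule openin_subset)
qed

lemma quotient_rho: "quotient_map X Q rho"
  unfolding quotient_map_def by (simp add: topspace_Q openin_Q)

lemma rho_cont: "continuous_map X Q rho"
  using quotient_rho by (rule quotient_imp_continuous_map)

lemma closed_rho: "closed_map X Q rho"
  unfolding closed_map_def
proof (intro allI impI)
  fix S assume S: "closedin X S"
  then have sub: "S \<subseteq> topspace X" by (rule closedin_subset)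
  have "{x \<in> topspace X. rho x \<in> topspace Q - rho ` S} = topspace X - R\<^sup>* `` S"
  proof (intro equalityI subsetI)
    fix x assume x: "x \<in> {x \<in> topspace X. rho x \<in> topspace Q - rho ` S}"
    have "x \<notin> R\<^sup>* `` S"
    proof
      assume "x \<in> R\<^sup>* `` S"
      then obtain s where "s \<in> S" "(s, x) \<in> R\<^sup>*" by blast
      then have "rho x = rho s" using rho_eq_iff by metis
      then show False using x \<open>s \<in> S\<close> by blast
    qed
    then show "x \<in> topspace X - R\<^sup>* `` S" using x by blast
  next
    fix x assume x: "x \<in> topspace X - R\<^sup>* `` S"
    have "rho x \<notin> rho ` S"
    proof
      assume "rho x \<in> rho ` S"
      then obtain s where "s \<in> S" "rho s = rho x" by force
      then show False using x rho_eq_iff by blast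
    qed
    then show "x \<in> {x \<in> topspace X. rho x \<in> topspace Q - rho ` S}" using x by (auto simp: topspace_Q)
  qed
  then have "openin Q (topspace Q - rho ` S)"
    using closedin_saturation[OF S] by (auto simp: openin_Q topspace_Q openin_diff)
  then show "closedin Q (rho ` S)" using sub by (auto simp: closedin_def topspace_Q)
qed

lemma Hausdorff_Q: "Hausdorff_space Q"
  using normal_Hausdorff_space_closed_continuous_map_image[OF _ Hausdorff closed_rho rho_cont]
    compact_Hausdorff_or_regular_imp_normal_space[OF compact_space] Hausdorff topspace_Q by blast

text \<open>A single step is bridged by the image of the segment between the two coordinates, on
  which \<open>u e\<close> is constant; consecutive bridges share a point.\<close>

lemma connected_class:
  assumes "(x, y) \<in> R\<^sup>*" "y \<in> topspace X"
  shows "\<exists>C. connectedin X C \<and> x \<in> C \<and> y \<in> C \<and> C \<subseteq> {z. (z, y) \<in> R\<^sup>*}"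
  using assms(1)
proof (induction rule: converse_rtrancl_induct)
  case base
  then show ?case using assms(2) by (intro exI[of _ "{y}"]) auto
next
  case (step x x')
  obtain C where C: "connectedin X C" "x' \<in> C" "y \<in> C" "C \<subseteq> {z. (z, y) \<in> R\<^sup>*}" using step.IH by blast
  obtain e t t' where *: "e \<in> E" "t \<in> {0..fst e}" "t' \<in> {0..fst e}" "x = snd e t" "x' = snd e t'" "u e t = u e t'"
    using step.hyps(1) by (rule RE)
  let ?D = "snd e ` {min t t'..max t t'}"
  have "connectedin X ?D" using * by (intro connectedin_edge) auto
  moreover have "x' \<in> ?D" "x \<in> ?D" using * by auto
  ultimately have "connectedin X (?D \<union> C)" using C by (intro connectedin_Un) auto
  moreover have "?D \<subseteq> {z. (z, y) \<in> R\<^sup>*}"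
  proof
    fix z assume "z \<in> ?D"
    then obtain r where r: "r \<in> {min t t'..max t t'}" "z = snd e r" by blast
    then have r0: "r \<in> {0..fst e}" using * by auto
    have "u e r = u e t'"
      using uD[OF *(1), of "min t t'" r] uD[OF *(1), of r "max t t'"] r * by (auto simp: min_def max_def split: if_splits)
    then have "(z, x') \<in> R" using r * r0 RI by metis
    then show "z \<in> {z. (z, y) \<in> R\<^sup>*}" using step.hyps(2) by (simp add: converse_rtrancl_into_rtrancl)
  qed
  ultimately show ?case using C \<open>x \<in> ?D\<close> by (intro exI[of _ "?D \<union> C"]) auto
qed

lemma monotone_rho: "monotone_map X Q rho"
  unfolding monotone_map_def
proof (intro conjI ballI)
  show "rho ` topspace X \<subseteq> topspace Q" by (simp add: topspace_Q)
  fix y assume "y \<in> topspace Q"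
  then obtain y0 where "y0 \<in> topspace X" "y = rho y0" by (auto simp: topspace_Q)
  then have y: "y \<in> topspace X" "rho y = y" using rho_in rho_idem by auto
  let ?F = "{x \<in> topspace X. rho x = y}"
  have Feq: "?F = {x. (x, y) \<in> R\<^sup>*}"
    using rho_eq_iff[of _ y] rtrancl_topspace[of _ y] y by auto
  have "\<forall>x\<in>?F. \<exists>C. connectedin X C \<and> x \<in> C \<and> y \<in> C \<and> C \<subseteq> ?F"
    using connected_class[OF _ y(1)] unfolding Feq by blast
  from bchoice[OF this] obtain C where "\<forall>x\<in>?F. connectedin X (C x) \<and> x \<in> C x \<and> y \<in> C x \<and> C x \<subseteq> ?F" by (rule exE)
  then have C: "\<And>x. x \<in> ?F \<Longrightarrow> connectedin X (C x)" "\<And>x. x \<in> ?F \<Longrightarrow> x \<in> C x"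
    "\<And>x. x \<in> ?F \<Longrightarrow> y \<in> C x" "\<And>x. x \<in> ?F \<Longrightarrow> C x \<subseteq> ?F" by simp_all
  have "connectedin X (\<Union>(C ` ?F))"
  proof (rule connectedin_Union)
    show "\<Inter>(C ` ?F) \<noteq> {}" using C(3) by blast
  qed (use C in auto)
  moreover have "\<Union>(C ` ?F) = ?F" using C(2,4) by blast
  ultimately show "connectedin X ?F" by simp
qed

section \<open>The quotient as a graph with lengths measured by \<open>u\<close>\<close>

text \<open>Uses the level of \<open>u\<close> as the coordinate. All points of an edge at one level
  have the same class, so every choice of \<open>t\<close> gives the same value, see
  \<open>new_param_u\<close>.\<close>

definition new_param :: "'a graph_edge \<Rightarrow> real \<Rightarrow> 'a"
  where "new_param e y = rho (snd e (SOME t. t \<in> {0..fst e} \<and> u e t = y))"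

definition new_edge :: "'a graph_edge \<Rightarrow> 'a graph_edge"
  where "new_edge e = (u e (fst e), new_param e)"

definition new_edges :: "'a graph_edge set"
  where "new_edges = new_edge ` {e \<in> E. 0 < u e (fst e)}"

lemma new_param_u:
  assumes "e \<in> E" "t \<in> {0..fst e}" shows "new_param e (u e t) = rho (snd e t)"
proof -
  let ?t = "SOME s. s \<in> {0..fst e} \<and> u e s = u e t"
  have "?t \<in> {0..fst e} \<and> u e ?t = u e t" by (rule someI[of _ t]) (use assms in simp)
  then show ?thesis unfolding new_param_def rho_eq_iff using assms by (intro r_into_rtrancl RI) auto
qed

text \<open>A level strictly between the end levels is not attained at an end of the edge, so a
  chain starting there meets no vertex and never leaves the edge.\<close>

lemma interior_class:
  assumes "e \<in> E" "t \<in> {0..fst e}" "0 < u e t" "u e t < u e (fst e)" "(snd e t, z) \<in> R\<^sup>*"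
  obtains t' where "t' \<in> {0<..<fst e}" "z = snd e t'" "u e t' = u e t"
proof -
  have inside: "s \<in> {0<..<fst e}" if "s \<in> {0..fst e}" "u e s = u e t" for s
  proof -
    have "s \<noteq> 0" "s \<noteq> fst e" using that assms u_0[OF assms(1)] by auto
    then show ?thesis using that by auto
  qed
  have "\<exists>t'. t' \<in> {0<..<fst e} \<and> z = snd e t' \<and> u e t' = u e t"
    using assms(5)
  proof (induction rule: rtrancl_induct)
    case base
    then show ?case using inside assms(2) by blast
  next
    case (step y z)
    then obtain s where s: "s \<in> {0<..<fst e}" "y = snd e s" "u e s = u e t" by blast
    have "(snd e s, z) \<in> R" using step.hyps(2) s(2) by simp
    then obtain t' where t': "t' \<in> {0..fst e}" "z = snd e t'" "u e t' = u e s"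
      by (rule R_from_edge[OF assms(1) s(1)])
    then show ?case using inside[of t'] s(3) by auto
  qed
  then show ?thesis using that by blast
qed

lemma new_interior:
  assumes e: "e \<in> E" and y: "y \<in> {0<..<u e (fst e)}"
  obtains t where "t \<in> {0..fst e}" "u e t = y" "new_param e y = rho (snd e t)"
proof -
  have "y \<in> {u e 0..u e (fst e)}" using y u_0[OF e] by auto
  then obtain t where t: "t \<in> {0..fst e}" "u e t = y"
    using u_IVT[OF e order_refl less_imp_le[OF edge_pos[OF e]] order_refl] by metis
  show ?thesis using new_param_u[OF e t(1)] t by (intro that[of t]) simp_all
qed

text \<open>As a continuous surjection from a compact to a Hausdorff space, \<open>u e\<close> is a
  quotient map, so it suffices that the composite \<open>rho \<circ> snd e\<close> is
  continuous.\<close>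

lemma new_param_cont:
  assumes e: "e \<in> E" shows "continuous_map (top_of_set {0..u e (fst e)}) Q (new_param e)"
proof (rule continuous_compose_quotient_map)
  have im: "u e ` {0..fst e} = {0..u e (fst e)}"
  proof (intro equalityI subsetI)
    fix y assume "y \<in> {0..u e (fst e)}"
    then have "y \<in> {u e 0..u e (fst e)}" using u_0[OF e] by simp
    then obtain t where "t \<in> {0..fst e}" "u e t = y"
      using u_IVT[OF e order_refl less_imp_le[OF edge_pos[OF e]] order_refl] by metis
    then show "y \<in> u e ` {0..fst e}" by blast
  qed (use u_bounds[OF e] in auto)
  show "quotient_map (top_of_set {0..fst e}) (top_of_set {0..u e (fst e)}) (u e)"
  proof (rule continuous_imp_quotient_map)
    show "continuous_map (top_of_set {0..fst e}) (top_of_set {0..u e (fst e)}) (u e)"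
      using u_cont[OF e] im by auto
    show "compact_space (top_of_set {0..fst e})" by (simp add: compact_space_subtopology)
    show "Hausdorff_space (top_of_set {0..u e (fst e)})" by (simp add: Hausdorff_space_subtopology)
  qed (use im in auto)
  show "continuous_map (top_of_set {0..fst e}) Q (new_param e \<circ> u e)"
    by (rule continuous_map_eq[OF continuous_map_compose[OF edge_cont[OF e] rho_cont]])
       (use new_param_u[OF e] in auto)
qed

text \<open>By \<open>interior_class\<close>, points at strictly intermediate levels are identified
  only within their own edge and level. This yields injectivity, disjoint open edges and avoidance
  of vertices. Extreme levels, and edges on which \<open>u\<close> is constant, go to
  vertices.\<close>

lemma graph_Q: "graph_parametrization Q (rho ` V) new_edges"
  unfolding graph_parametrization_def
proof (intro conjI)
  show "Hausdorff_space Q" by (rule Hausdorff_Q)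
  show "finite (rho ` V)" using finite_V by simp
  show "rho ` V \<subseteq> topspace Q" using V_sub by (auto simp: topspace_Q)
  show "finite new_edges" using finite_E by (simp add: new_edges_def)
  obtain e0 where "e0 \<in> E" "0 < u e0 (fst e0)" using u_nontrivial by blast
  then show "new_edges \<noteq> {}" unfolding new_edges_def by blast
  have pos: "0 < fst e" if "e \<in> E" for e using edge_pos[OF that] .
  show "\<forall>(l, \<gamma>)\<in>new_edges. 0 < l \<and> continuous_map (top_of_set {0..l}) Q \<gamma> \<and> inj_on \<gamma> {0<..<l} \<and>
       \<gamma> 0 \<in> rho ` V \<and> \<gamma> l \<in> rho ` V \<and> \<gamma> ` {0<..<l} \<inter> rho ` V = {}"
  proof (rule ballI, clarify)
    fix l \<gamma> assume "(l, \<gamma>) \<in> new_edges"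
    then obtain e where e: "e \<in> E" "0 < u e (fst e)" "l = u e (fst e)" "\<gamma> = new_param e"
      by (auto simp: new_edges_def new_edge_def)
    have "inj_on \<gamma> {0<..<l}"
    proof (rule inj_onI)
      fix y y' assume yy: "y \<in> {0<..<l}" "y' \<in> {0<..<l}" "\<gamma> y = \<gamma> y'"
      obtain t where t: "t \<in> {0..fst e}" "u e t = y" "\<gamma> y = rho (snd e t)"
        using new_interior[OF e(1), of y] yy e by metis
      obtain t' where t': "t' \<in> {0..fst e}" "u e t' = y'" "\<gamma> y' = rho (snd e t')"
        using new_interior[OF e(1), of y'] yy e by metis
      have "(snd e t, snd e t') \<in> R\<^sup>*" using yy(3) t t' rho_eq_iff by metis
      then obtain s where s: "s \<in> {0<..<fst e}" "snd e t' = snd e s" "u e s = u e t"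
        using interior_class[OF e(1) t(1)] t(2) yy(1) e(3) by (metis greaterThanLessThan_iff)
      then have "t' = s" using edge_param_unique[OF e(1) e(1) s(1) t'(1)] by simp
      then show "y = y'" using s t t' by simp
    qed
    moreover have "\<gamma> 0 \<in> rho ` V" using new_param_u[OF e(1), of 0] u_0[OF e(1)] edge_0[OF e(1)] pos[OF e(1)] e by auto
    moreover have "\<gamma> l \<in> rho ` V" using new_param_u[OF e(1), of "fst e"] edge_l[OF e(1)] pos[OF e(1)] e by auto
    moreover have "\<gamma> ` {0<..<l} \<inter> rho ` V = {}"
    proof -
      have "\<gamma> y \<noteq> rho v" if y: "y \<in> {0<..<l}" and v: "v \<in> V" for y v
      proof
        assume a: "\<gamma> y = rho v"
        obtain t where t: "t \<in> {0..fst e}" "u e t = y" "\<gamma> y = rho (snd e t)"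
          using new_interior[OF e(1), of y] y e by metis
        have "(snd e t, v) \<in> R\<^sup>*" using a t rho_eq_iff by metis
        then obtain s where "s \<in> {0<..<fst e}" "v = snd e s"
          using interior_class[OF e(1) t(1)] t(2) y e(3) by (metis greaterThanLessThan_iff)
        then show False using edge_disj[OF e(1)] v by blast
      qed
      then show ?thesis by blast
    qed
    ultimately show "0 < l \<and> continuous_map (top_of_set {0..l}) Q \<gamma> \<and> inj_on \<gamma> {0<..<l} \<and>
       \<gamma> 0 \<in> rho ` V \<and> \<gamma> l \<in> rho ` V \<and> \<gamma> ` {0<..<l} \<inter> rho ` V = {}"
      using e new_param_cont[OF e(1)] by simp
  qed
  have oe: "open_edge (new_edge e) = new_param e ` {0<..<u e (fst e)}" for e
    by (simp add: open_edge_def new_edge_def)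
  show "pairwise (\<lambda>e e'. disjnt (open_edge e) (open_edge e')) new_edges"
  proof (rule pairwiseI)
    fix d d' assume "d \<in> new_edges" "d' \<in> new_edges" "d \<noteq> d'"
    then obtain e e' where e: "e \<in> E" "e' \<in> E" "d = new_edge e" "d' = new_edge e'" "e \<noteq> e'"
      unfolding new_edges_def by blast
    have False if x: "x \<in> open_edge d" "x \<in> open_edge d'" for x
    proof -
      obtain y y' where y: "y \<in> {0<..<u e (fst e)}" "x = new_param e y" "y' \<in> {0<..<u e' (fst e')}" "x = new_param e' y'"
        using x unfolding e oe by blast
      obtain t where t: "t \<in> {0..fst e}" "u e t = y" "new_param e y = rho (snd e t)"
        by (rule new_interior[OF e(1) y(1)])
      obtain t' where t': "t' \<in> {0..fst e'}" "u e' t' = y'" "new_param e' y' = rho (snd e' t')"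
        by (rule new_interior[OF e(2) y(3)])
      have "(snd e t, snd e' t') \<in> R\<^sup>*" using y t t' rho_eq_iff by metis
      then obtain s where s: "s \<in> {0<..<fst e}" "snd e' t' = snd e s"
        using interior_class[OF e(1) t(1)] t(2) y(1) by (metis greaterThanLessThan_iff)
      then show False using edge_param_unique[OF e(1,2) s(1) t'(1)] e(5) by simp
    qed
    then show "disjnt (open_edge d) (open_edge d')" unfolding disjnt_def by blast
  qed
  show "topspace Q = rho ` V \<union> (\<Union>e\<in>new_edges. open_edge e)"
  proof (intro equalityI subsetI)
    fix z assume "z \<in> topspace Q"
    then obtain x where x: "x \<in> topspace X" "z = rho x" by (auto simp: topspace_Q)
    from x(1) consider "x \<in> V" | e where "e \<in> E" "x \<in> snd e ` {0..fst e}" unfolding topspace_edges by blast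
    then show "z \<in> rho ` V \<union> (\<Union>e\<in>new_edges. open_edge e)"
    proof cases
      case 1
      then show ?thesis using x by blast
    next
      case 2
      then obtain t where t: "t \<in> {0..fst e}" "x = snd e t" by blast
      have ends: "0 \<in> {0..fst e}" "fst e \<in> {0..fst e}" using pos[OF 2(1)] by auto
      consider "u e t = 0" | "u e t = u e (fst e)" | "u e t \<in> {0<..<u e (fst e)}" using u_bounds[OF 2(1) t(1)] by force
      then show ?thesis
      proof cases
        case 1
        then have "(x, snd e 0) \<in> R" unfolding t(2) using RI[OF 2(1) t(1) ends(1)] u_0[OF 2(1)] by simp
        then have "z = rho (snd e 0)" unfolding x(2) rho_eq_iff by blast
        then show ?thesis using edge_0[OF 2(1)] by blast
      next
        case k: 2
        then have "(x, snd e (fst e)) \<in> R" unfolding t(2) using RI[OF 2(1) t(1) ends(2)] by simp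
        then have "z = rho (snd e (fst e))" unfolding x(2) rho_eq_iff by blast
        then show ?thesis using edge_l[OF 2(1)] by blast
      next
        case 3
        then have "z \<in> open_edge (new_edge e)" unfolding oe using new_param_u[OF 2(1) t(1)] x t by (metis imageI)
        moreover have "new_edge e \<in> new_edges" using 3 2(1) by (auto simp: new_edges_def)
        ultimately show ?thesis by blast
      qed
    qed
  next
    fix z assume "z \<in> rho ` V \<union> (\<Union>e\<in>new_edges. open_edge e)"
    then consider "z \<in> rho ` V" | e where "e \<in> E" "z \<in> open_edge (new_edge e)" unfolding new_edges_def by blast
    then show "z \<in> topspace Q"
    proof cases
      case 1
      then show ?thesis using V_sub by (auto simp: topspace_Q)
    next
      case 2
      then obtain y where y: "y \<in> {0<..<u e (fst e)}" "z = new_param e y" unfolding oe by blast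
      obtain t where "t \<in> {0..fst e}" "new_param e y = rho (snd e t)" by (rule new_interior[OF 2(1) y(1)])
      then show ?thesis using y edge_in[OF 2(1)] by (simp add: topspace_Q)
    qed
  qed
qed

lemma homeomorphic_rho:
  assumes "\<And>e. e \<in> E \<Longrightarrow> inj_on (u e) {0..fst e}"
  shows "homeomorphic_map X Q rho"
proof (rule continuous_imp_homeomorphic_map[OF rho_cont compact_space Hausdorff_Q])
  show "rho ` topspace X = topspace Q" by (simp add: topspace_Q)
  have "R \<subseteq> Id"
  proof (rule subrelI)
    fix x y assume "(x, y) \<in> R"
    then obtain e t t' where *: "e \<in> E" "t \<in> {0..fst e}" "t' \<in> {0..fst e}" "x = snd e t" "y = snd e t'" "u e t = u e t'"
      by (rule RE)
    then show "(x, y) \<in> Id" using inj_onD[OF assms[OF *(1)] *(6)] by simp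
  qed
  then have "x = y" if "(x, y) \<in> R\<^sup>*" for x y
    using rtrancl_mono[of R Id] that by auto
  then show "inj_on rho (topspace X)" using rho_eq_iff by (intro inj_onI) blast
qed

end

section \<open>The map induced on the quotient; injectivity in the transitive case\<close>

context collapse begin

definition scaled_branch :: "('a \<Rightarrow> 'a) \<Rightarrow> real \<Rightarrow> 'a graph_edge \<Rightarrow> real \<Rightarrow> real \<Rightarrow> 'a graph_edge \<Rightarrow> (real \<Rightarrow> real) \<Rightarrow> bool"
  where "scaled_branch f \<sigma> e s t e' \<phi> \<longleftrightarrow> branch f e s t e' \<phi> \<and>
    (\<forall>x\<in>{s..t}. \<forall>y\<in>{s..t}. x \<le> y \<longrightarrow> \<bar>u e' (\<phi> y) - u e' (\<phi> x)\<bar> = \<sigma> * (u e y - u e x))"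

lemma scaled_branchD:
  assumes "scaled_branch f \<sigma> e s t e' \<phi>"
  shows "e' \<in> all_edges" "mono_on {s..t} \<phi> \<or> antimono_on {s..t} \<phi>"
    and "x \<in> {s..t} \<Longrightarrow> \<phi> x \<in> {0..fst e'}" "x \<in> {s..t} \<Longrightarrow> f (snd e x) = snd e' (\<phi> x)"
    and "x \<in> {s..t} \<Longrightarrow> y \<in> {s..t} \<Longrightarrow> x \<le> y \<Longrightarrow> \<bar>u e' (\<phi> y) - u e' (\<phi> x)\<bar> = \<sigma> * (u e y - u e x)"
  using assms unfolding scaled_branch_def branch_def by simp_all

context
  fixes f :: "'a \<Rightarrow> 'a" and \<sigma> :: real and T :: "'a graph_edge \<Rightarrow> real set"
  assumes f: "continuous_map X X f" and \<sigma>: "0 < \<sigma>"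
    and T: "\<And>e. e \<in> E \<Longrightarrow> finite (T e)" "\<And>e. e \<in> E \<Longrightarrow> 0 \<in> T e" "\<And>e. e \<in> E \<Longrightarrow> fst e \<in> T e"
      "\<And>e. e \<in> E \<Longrightarrow> T e \<subseteq> {0..fst e}"
    and br: "\<And>e s t. e \<in> E \<Longrightarrow> s \<in> T e \<Longrightarrow> t \<in> T e \<Longrightarrow> s < t \<Longrightarrow> {s<..<t} \<inter> T e = {} \<Longrightarrow>
      \<exists>e' \<phi>. scaled_branch f \<sigma> e s t e' \<phi>"
begin

text \<open>Between consecutive cuts the scaling equation sends equal levels to equal levels of the
  target edge; on a target of length 0 the images even coincide. A longer segment is split at its
  cuts and the relations are chained.\<close>

lemma collapsed_segment:
  assumes e: "e \<in> E" and pq: "0 \<le> p" "p \<le> q" "q \<le> fst e" "u e p = u e q"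
  shows "(f (snd e p), f (snd e q)) \<in> R\<^sup>*"
  using pq
proof (induction "card (T e \<inter> {p<..<q})" arbitrary: p q rule: less_induct)
  case less
  have fin: "finite (T e \<inter> A)" for A using T(1)[OF e] by blast
  consider "p = q" | "p < q" "T e \<inter> {p<..<q} = {}" | c where "c \<in> T e" "p < c" "c < q"
    using less.prems(2) by (cases "p = q"; cases "T e \<inter> {p<..<q} = {}") auto
  then show ?case
  proof cases
    case 1
    then show ?thesis by simp
  next
    case 2
    have "{p<..<q} \<inter> T e = {}" using 2 by blast
    from finite_gap[OF T(1)[OF e] 2(1) this T(2)[OF e] less.prems(1) T(3)[OF e] less.prems(3)]
    obtain s t where st: "s \<in> T e" "t \<in> T e" "s \<le> p" "q \<le> t" "{s<..<t} \<inter> T e = {}" by metis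
    have "s < t" using st 2 by simp
    from br[OF e st(1,2) this st(5)] obtain e' \<phi> where b: "scaled_branch f \<sigma> e s t e' \<phi>" by blast
    note b = scaled_branchD[OF b]
    have in_st: "p \<in> {s..t}" "q \<in> {s..t}" using st 2 by auto
    have eq: "u e' (\<phi> p) = u e' (\<phi> q)" using b(5)[OF in_st] 2 less.prems by simp
    note fp = b(4)[OF in_st(1)] and fq = b(4)[OF in_st(2)]
    show ?thesis
    proof (cases "0 < fst e'")
      case True
      then have "e' \<in> E" using b(1) all_edges_pos by blast
      then have "(snd e' (\<phi> p), snd e' (\<phi> q)) \<in> R" using RI b(3) in_st eq by blast
      then show ?thesis unfolding fp fq by (rule r_into_rtrancl)
    next
      case False
      then have "\<phi> p = \<phi> q" using b(3)[OF in_st(1)] b(3)[OF in_st(2)] by auto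
      then show ?thesis unfolding fp fq by simp
    qed
  next
    case (3 c)
    have c: "u e p = u e c" "u e c = u e q"
      using uD[OF e less.prems(1), of c] uD[OF e, of c q] 3 less.prems by auto
    have sub1: "T e \<inter> {p<..<c} \<subset> T e \<inter> {p<..<q}" using 3 by auto
    have sub2: "T e \<inter> {c<..<q} \<subset> T e \<inter> {p<..<q}" using 3 by auto
    have "(f (snd e p), f (snd e c)) \<in> R\<^sup>*"
      using 3 less.prems c by (intro less.hyps psubset_card_mono[OF fin sub1]) auto
    moreover have "(f (snd e c), f (snd e q)) \<in> R\<^sup>*"
      using 3 less.prems c by (intro less.hyps psubset_card_mono[OF fin sub2]) auto
    ultimately show ?thesis by (rule rtrancl_trans)
  qed
qed

lemma f_respects: "(x, y) \<in> R\<^sup>* \<Longrightarrow> (f x, f y) \<in> R\<^sup>*"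
proof (induction rule: rtrancl_induct)
  case (step y z)
  obtain e t t' where *: "e \<in> E" "t \<in> {0..fst e}" "t' \<in> {0..fst e}" "y = snd e t" "z = snd e t'" "u e t = u e t'"
    using step.hyps(2) by (rule RE)
  have "(f y, f z) \<in> R\<^sup>*"
  proof (cases "t \<le> t'")
    case True
    then show ?thesis using collapsed_segment[OF *(1), of t t'] * by auto
  next
    case False
    then show ?thesis using collapsed_segment[OF *(1), of t' t] * rtrancl_sym by auto
  qed
  then show ?case using step.IH by simp
qed simp

lemma rho_f_rho: "rho (f (rho x)) = rho (f x)"
  using f_respects[OF rho_rel[of x]] rho_eq_iff by metis

lemma quotient_map_cont: "continuous_map Q Q (rho \<circ> f)"
proof (rule continuous_compose_quotient_map[OF quotient_rho])
  show "continuous_map X Q (rho \<circ> f \<circ> rho)"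
    by (rule continuous_map_eq[OF continuous_map_compose[OF f rho_cont]]) (simp add: rho_f_rho)
qed

text \<open>In the coordinates \<open>u e\<close> and \<open>u e'\<close> the scaling equation says
  that a branch is affine, with slope \<open>\<sigma>\<close> or \<open>- \<sigma>\<close> according
  to the direction of \<open>\<phi>\<close>.\<close>

lemma affine_slope_quotient: "affine_slope new_edges (rho \<circ> f) \<sigma>"
  unfolding affine_slope_def
proof
  fix d assume "d \<in> new_edges"
  then obtain e where e: "e \<in> E" "0 < u e (fst e)" "d = new_edge e" unfolding new_edges_def by blast
  have fd: "fst d = u e (fst e)" "snd d = new_param e" by (simp_all add: e new_edge_def)
  have "\<exists>e'\<in>new_edges. \<exists>a b. \<bar>a\<bar> = \<sigma> \<and> (\<forall>y\<in>{y0..y1}. a * y + b \<in> {0..fst e'} \<and> (rho \<circ> f) (new_param e y) = snd e' (a * y + b))"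
    if y: "y0 \<in> u e ` T e" "y1 \<in> u e ` T e" "y0 < y1" "{y0<..<y1} \<inter> u e ` T e = {}" for y0 y1
  proof -
    define A B where "A = {c \<in> T e. u e c = y0}" and "B = {c \<in> T e. u e c = y1}"
    have AB: "finite A" "A \<noteq> {}" "finite B" "B \<noteq> {}" using y T(1)[OF e(1)] by (auto simp: A_def B_def)
    \<comment> \<open>The last cut at level \<open>y0\<close> and the first cut at level
      \<open>y1\<close>. A cut strictly between them would have one of these levels, against the
      extremal choice, so a single branch covers the whole range of levels.\<close>
    define s t where "s = Max A" and "t = Min B"
    have s: "s \<in> T e" "u e s = y0" using Max_in[OF AB(1,2)] by (auto simp: s_def A_def)
    have t: "t \<in> T e" "u e t = y1" using Min_in[OF AB(3,4)] by (auto simp: t_def B_def)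
    have dom: "c \<in> {0..fst e}" if "c \<in> T e" for c using T(4)[OF e(1)] that by blast
    have st: "s < t"
    proof (rule ccontr)
      assume "\<not> s < t"
      then have "u e t \<le> u e s" using uD[OF e(1), of t s] dom[OF s(1)] dom[OF t(1)] by auto
      then show False using s t y by simp
    qed
    have "c \<notin> T e" if c: "c \<in> {s<..<t}" for c
    proof
      assume cT: "c \<in> T e"
      have "u e s \<le> u e c" "u e c \<le> u e t"
        using uD[OF e(1), of s c] uD[OF e(1), of c t] dom[OF s(1)] dom[OF t(1)] c by auto
      then have "u e c = y0 \<or> u e c = y1" using y(4) cT s t by force
      then show False
      proof
        assume "u e c = y0"
        then have "c \<le> s" unfolding s_def using AB cT by (intro Max_ge) (auto simp: A_def)
        then show False using c by simp
      next
        assume "u e c = y1"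
        then have "t \<le> c" unfolding t_def using AB cT by (intro Min_le) (auto simp: B_def)
        then show False using c by simp
      qed
    qed
    then have "{s<..<t} \<inter> T e = {}" by blast
    from br[OF e(1) s(1) t(1) st this] obtain e' \<phi> where b: "scaled_branch f \<sigma> e s t e' \<phi>" by blast
    note b = scaled_branchD[OF b]
    have ends: "s \<in> {s..t}" "t \<in> {s..t}" using st by auto
    have jump: "\<bar>u e' (\<phi> t) - u e' (\<phi> s)\<bar> = \<sigma> * (y1 - y0)" using b(5)[OF ends] st s t by simp
    then have pos: "0 < \<bar>u e' (\<phi> t) - u e' (\<phi> s)\<bar>" using \<sigma> y by simp
    \<comment> \<open>A nonzero jump of \<open>u e'\<close> shows that the target has positive
      length and is not contracted.\<close>
    have "fst e' \<noteq> 0" using pos b(3)[OF ends(1)] b(3)[OF ends(2)] by auto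
    then have e': "e' \<in> E" using b(1) all_edges_pos all_edges_nonneg by (metis less_eq_real_def)
    have "0 < u e' (fst e')"
      using pos u_bounds[OF e' b(3)[OF ends(1)]] u_bounds[OF e' b(3)[OF ends(2)]] by auto
    then have new: "new_edge e' \<in> new_edges" using e' by (simp add: new_edges_def)
    have "\<exists>a. \<bar>a\<bar> = \<sigma> \<and> (\<forall>x\<in>{s..t}. u e' (\<phi> x) - u e' (\<phi> s) = a * (u e x - u e s))"
      using b(2)
    proof
      assume m: "mono_on {s..t} \<phi>"
      have "u e' (\<phi> x) - u e' (\<phi> s) = \<sigma> * (u e x - u e s)" if x: "x \<in> {s..t}" for x
        using b(5)[OF ends(1) x] mono_onD[OF m ends(1) x] x b(3)[OF ends(1)] b(3)[OF x] uD[OF e', of "\<phi> s" "\<phi> x"] by auto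
      then show ?thesis using \<sigma> by (intro exI[of _ \<sigma>]) auto
    next
      assume m: "antimono_on {s..t} \<phi>"
      have "u e' (\<phi> x) - u e' (\<phi> s) = - \<sigma> * (u e x - u e s)" if x: "x \<in> {s..t}" for x
        using b(5)[OF ends(1) x] monotone_onD[OF m ends(1) x] x b(3)[OF ends(1)] b(3)[OF x] uD[OF e', of "\<phi> x" "\<phi> s"] by auto
      then show ?thesis using \<sigma> by (intro exI[of _ "- \<sigma>"]) auto
    qed
    then obtain a where a: "\<bar>a\<bar> = \<sigma>" "\<And>x. x \<in> {s..t} \<Longrightarrow> u e' (\<phi> x) - u e' (\<phi> s) = a * (u e x - u e s)" by blast
    define b' where "b' = u e' (\<phi> s) - a * y0"
    have "a * y + b' \<in> {0..fst (new_edge e')} \<and> (rho \<circ> f) (new_param e y) = snd (new_edge e') (a * y + b')"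
      if yy: "y \<in> {y0..y1}" for y
    proof -
      have "0 \<le> s" "t \<le> fst e" using dom[OF s(1)] dom[OF t(1)] by auto
      then obtain x where x: "x \<in> {s..t}" "u e x = y"
        using u_IVT[OF e(1) _ less_imp_le[OF st], of y] yy s t by metis
      have x': "x \<in> {0..fst e}" using x \<open>0 \<le> s\<close> \<open>t \<le> fst e\<close> by auto
      have val: "a * y + b' = u e' (\<phi> x)" using a(2)[OF x(1)] x(2) s(2) by (simp add: b'_def algebra_simps)
      have "(rho \<circ> f) (new_param e y) = rho (f (snd e x))"
        using new_param_u[OF e(1) x'] x(2) by (simp add: rho_f_rho)
      also have "\<dots> = new_param e' (u e' (\<phi> x))" using new_param_u[OF e' b(3)[OF x(1)]] b(4)[OF x(1)] by simp
      finally show ?thesis unfolding val using u_bounds[OF e' b(3)[OF x(1)]] by (simp add: new_edge_def)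
    qed
    then show ?thesis using new a(1) by blast
  qed
  then have "affine_cuts new_edges (rho \<circ> f) \<sigma> d (u e ` T e)"
    unfolding affine_cuts_def fd using T[OF e(1)] u_0[OF e(1)] u_bounds[OF e(1)]
    by (intro conjI ballI impI) (auto intro: rev_image_eqI)
  then show "\<exists>S. affine_cuts new_edges (rho \<circ> f) \<sigma> d S" ..
qed

end

text \<open>A dense orbit meets a collapsed segment at two different times, hence its image in the quotient
  is eventually periodic and cannot be dense.\<close>

lemma transitive_imp_inj:
  assumes f: "continuous_map X X f" and resp: "\<And>x. rho (f (rho x)) = rho (f x)"
    and trans: "transitive_map X f" and e: "e \<in> E"
  shows "inj_on (u e) {0..fst e}"
proof (rule ccontr)
  assume "\<not> inj_on (u e) {0..fst e}"
  then obtain a b where ab: "a \<in> {0..fst e}" "b \<in> {0..fst e}" "u e a = u e b" "a < b"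
    unfolding inj_on_def by (metis linorder_neqE_linordered_idom)
  define W where "W = snd e ` {a<..<b}"
  have Wo: "openin X W" unfolding W_def using ab by (intro openin_edge e) auto
  have W_class: "rho x = rho (snd e a)" if x: "x \<in> W" for x
  proof -
    obtain t where t: "t \<in> {a<..<b}" "x = snd e t" using x unfolding W_def by blast
    have "u e t = u e a" using uD[OF e, of a t] uD[OF e, of t b] t ab by auto
    then have "(x, snd e a) \<in> R" unfolding t(2) using t ab by (intro RI e) auto
    then show ?thesis unfolding rho_eq_iff by blast
  qed
  obtain x where x: "x \<in> topspace X" "X closure_of (range (\<lambda>n. (f ^^ n) x)) = topspace X"
    using trans unfolding transitive_map_def by blast
  have hit: "\<exists>n. (f ^^ n) x \<in> S" if S: "openin X S" "S \<noteq> {}" for S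
  proof -
    obtain s where "s \<in> S" "s \<in> topspace X" using S openin_subset by blast
    then have "s \<in> X closure_of (range (\<lambda>n. (f ^^ n) x))" using x by simp
    then show ?thesis using S(1) \<open>s \<in> S\<close> unfolding in_closure_of by blast
  qed
  have infW: "infinite W"
  proof -
    have "inj_on (snd e) {a<..<b}" by (rule inj_on_subset[OF edge_inj[OF e]]) (use ab in auto)
    then show ?thesis unfolding W_def using infinite_Ioo[OF ab(4)] by (simp add: finite_image_iff)
  qed
  have "W \<noteq> {}" using infW by auto
  from hit[OF Wo this] obtain n where n: "(f ^^ n) x \<in> W" by blast
  \<comment> \<open>Without the first visited point, \<open>W\<close> is still open and nonempty, so
    the orbit visits it at another point and hence at another time.\<close>
  have "closedin X {(f ^^ n) x}"
    using n openin_subset[OF Wo] Hausdorff by (intro closedin_Hausdorff_singleton) auto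
  then have "openin X (W - {(f ^^ n) x})" using Wo by (rule openin_diff[rotated])
  moreover have "W - {(f ^^ n) x} \<noteq> {}" using infW by (metis finite.emptyI infinite_remove)
  ultimately obtain m where m: "(f ^^ m) x \<in> W" "(f ^^ m) x \<noteq> (f ^^ n) x" using hit by blast
  define p q where "p = min m n" and "q = max m n"
  have pq: "p < q" "rho ((f ^^ p) x) = rho ((f ^^ q) x)"
  proof -
    have "m \<noteq> n" using m by auto
    then show "p < q" by (auto simp: p_def q_def)
    have "rho ((f ^^ m) x) = rho ((f ^^ n) x)" using W_class[OF m(1)] W_class[OF n] by simp
    then show "rho ((f ^^ p) x) = rho ((f ^^ q) x)" by (auto simp: p_def q_def min_def max_def)
  qed
  have step: "rho (f y) = rho (f z)" if "rho y = rho z" for y z using resp that by metis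
  have periodic: "rho ((f ^^ (p + k)) x) = rho ((f ^^ (q + k)) x)" for k
  proof (induction k)
    case 0
    then show ?case using pq(2) by simp
  next
    case (Suc k)
    then show ?case using step[OF Suc] by simp
  qed
  \<comment> \<open>Times from \<open>q\<close> on are reduced by \<open>q - p\<close>, so the orbit
    has finitely many classes. They form a closed set, and density makes it all of \<open>Q\<close>,
    which is infinite because it has an edge.\<close>
  have "rho ((f ^^ k) x) \<in> (\<lambda>k. rho ((f ^^ k) x)) ` {..<q}" for k
  proof (induction k rule: less_induct)
    case (less k)
    show ?case
    proof (cases "k < q")
      case False
      then have "rho ((f ^^ k) x) = rho ((f ^^ (p + (k - q))) x)" using periodic[of "k - q"] by simp
      moreover have "p + (k - q) < k" using False pq by simp
      ultimately show ?thesis using less.IH by metis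
    qed blast
  qed
  then have sub: "range (\<lambda>n. (f ^^ n) x) \<subseteq> {y. rho y \<in> (\<lambda>k. rho ((f ^^ k) x)) ` {..<q}}" by blast
  let ?F = "(\<lambda>k. rho ((f ^^ k) x)) ` {..<q}"
  have fX: "(f ^^ k) x \<in> topspace X" for k
    using x(1) continuous_map_image_subset_topspace[OF f] by (induction k) auto
  have "closedin Q ?F"
    by (rule closedin_Hausdorff_finite[OF Hausdorff_Q]) (use fX in \<open>auto simp: topspace_Q\<close>)
  then have "closedin X {y \<in> topspace X. rho y \<in> ?F}"
    by (rule closedin_continuous_map_preimage[OF rho_cont])
  moreover have "range (\<lambda>n. (f ^^ n) x) \<subseteq> {y \<in> topspace X. rho y \<in> ?F}" using sub fX by blast
  ultimately have "X closure_of (range (\<lambda>n. (f ^^ n) x)) \<subseteq> {y \<in> topspace X. rho y \<in> ?F}"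
    by (intro closure_of_minimal)
  then have "topspace X \<subseteq> {y \<in> topspace X. rho y \<in> ?F}" using x(2) by simp
  then have "topspace Q \<subseteq> ?F" unfolding topspace_Q by blast
  then have finQ: "finite (topspace Q)" by (rule finite_subset) simp
  interpret Qg: graph Q "rho ` V" new_edges by unfold_locales (rule graph_Q)
  obtain d where d: "d \<in> new_edges" using Qg.E_ne by blast
  have "snd d ` {0<..<fst d} \<subseteq> topspace Q" using Qg.edge_in[OF d] by fastforce
  then have "finite (snd d ` {0<..<fst d})" using finQ finite_subset by blast
  then show False using finite_image_iff[OF Qg.edge_inj[OF d]] infinite_Ioo[OF Qg.edge_pos[OF d]] by blast
qed

end


section \<open>Existence of a factor of constant slope\<close>

text \<open>The cuts form a grid of mesh half a Lebesgue number of the pulled back cover, so an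
  interval without interior grid points is short enough to fit into one member.\<close>

lemma Lebesgue_cuts:
  fixes l :: real
  assumes l: "0 \<le> l" and \<gamma>: "continuous_map (top_of_set {0..l}) X \<gamma>" and U: "open_cover X \<U>"
  obtains D where "finite D" "\<And>x y. 0 \<le> x \<Longrightarrow> x < y \<Longrightarrow> y \<le> l \<Longrightarrow> {x<..<y} \<inter> D = {} \<Longrightarrow> \<exists>U\<in>\<U>. \<gamma> ` {x..y} \<subseteq> U"
proof -
  define \<G> where "\<G> = {W. open W \<and> (\<exists>U\<in>\<U>. \<forall>t\<in>W \<inter> {0..l}. \<gamma> t \<in> U)}"
  have "{0..l} \<subseteq> \<Union>\<G>"
  proof
    fix t assume t: "t \<in> {0..l}"
    then have "\<gamma> t \<in> \<Union>\<U>" using continuous_map_image_subset_topspace[OF \<gamma>] U by (auto simp: open_cover_def)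
    then obtain U' where U': "U' \<in> \<U>" "\<gamma> t \<in> U'" by blast
    have "openin X U'" using U U' by (auto simp: open_cover_def)
    then have "openin (top_of_set {0..l}) {s \<in> topspace (top_of_set {0..l}). \<gamma> s \<in> U'}"
      by (rule openin_continuous_map_preimage[OF \<gamma>])
    then obtain W where W: "open W" "{s \<in> {0..l}. \<gamma> s \<in> U'} = {0..l} \<inter> W" by (auto simp: openin_open)
    have W_iff: "s \<in> W \<longleftrightarrow> \<gamma> s \<in> U'" if "s \<in> {0..l}" for s using W(2) that by (auto simp: set_eq_iff)
    then have "W \<in> \<G>" unfolding \<G>_def using U'(1) W(1) by auto
    moreover have "t \<in> W" using W_iff[OF t] U'(2) by simp
    ultimately show "t \<in> \<Union>\<G>" by blast
  qed
  moreover have "open W" if "W \<in> \<G>" for W using that by (simp add: \<G>_def)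
  ultimately obtain \<epsilon> where \<epsilon>: "0 < \<epsilon>" "\<And>x. x \<in> {0..l} \<Longrightarrow> \<exists>W\<in>\<G>. ball x \<epsilon> \<subseteq> W"
    by (rule Heine_Borel_lemma[OF compact_Icc]) (assumption | rule that)+
  define h where "h = \<epsilon> / 2"
  have h: "0 < h" "h < \<epsilon>" using \<epsilon> by (auto simp: h_def)
  define D where "D = (\<lambda>k. real k * h) ` {..nat \<lceil>l / h\<rceil>}"
  show ?thesis
  proof (rule that[of D])
    show "finite D" by (simp add: D_def)
    fix x y assume xy: "0 \<le> x" "x < y" "y \<le> l" "{x<..<y} \<inter> D = {}"
    have "y - x \<le> h"
    proof (rule ccontr)
      assume big: "\<not> y - x \<le> h"
      \<comment> \<open>The index of the first grid point strictly to the right of \<open>x\<close>,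
        at distance at most \<open>h\<close>.\<close>
      define k where "k = nat (\<lfloor>x / h\<rfloor> + 1)"
      have k: "real k = of_int \<lfloor>x / h\<rfloor> + 1" using xy h by (simp add: k_def)
      have "x / h < real k" "real k \<le> x / h + 1" unfolding k by linarith+
      then have kx: "x < real k * h" "real k * h \<le> x + h" using h by (simp_all add: field_simps)
      then have "real k * h < y" using big by simp
      moreover have "k \<le> nat \<lceil>l / h\<rceil>"
      proof -
        have "real k * h \<le> l" using \<open>real k * h < y\<close> xy by simp
        then have "real k \<le> l / h" using h by (simp add: field_simps)
        then show ?thesis by linarith
      qed
      ultimately have "real k * h \<in> {x<..<y} \<inter> D" using kx by (auto simp: D_def)
      then show False using xy by blast
    qed
    then have near: "{x..y} \<subseteq> ball x \<epsilon>" using h by (auto simp: dist_real_def)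
    obtain W where W: "W \<in> \<G>" "ball x \<epsilon> \<subseteq> W" using \<epsilon>(2)[of x] xy by auto
    then obtain U' where "U' \<in> \<U>" "\<forall>t\<in>W \<inter> {0..l}. \<gamma> t \<in> U'" unfolding \<G>_def by blast
    moreover have "{x..y} \<subseteq> W \<inter> {0..l}" using near W xy by auto
    ultimately show "\<exists>U\<in>\<U>. \<gamma> ` {x..y} \<subseteq> U" by blast
  qed
qed

section \<open>The interval system of a cut graph map and its entropy\<close>

locale cut_graph_map = graph X V E for X :: "'a topology" and V E +
  fixes f :: "'a \<Rightarrow> 'a" and T :: "'a graph_edge \<Rightarrow> real set"
    and tg :: "'a graph_edge \<times> real \<times> real \<Rightarrow> 'a graph_edge"
    and ph :: "'a graph_edge \<times> real \<times> real \<Rightarrow> real \<Rightarrow> real"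
  assumes f: "continuous_map X X f"
    and T: "e \<in> E \<Longrightarrow> finite (T e)" "e \<in> E \<Longrightarrow> 0 \<in> T e" "e \<in> E \<Longrightarrow> fst e \<in> T e" "e \<in> E \<Longrightarrow> T e \<subseteq> {0..fst e}"
    and br: "e \<in> E \<Longrightarrow> s \<in> T e \<Longrightarrow> t \<in> T e \<Longrightarrow> s < t \<Longrightarrow> {s<..<t} \<inter> T e = {} \<Longrightarrow>
      branch f e s t (tg (e, s, t)) (ph (e, s, t))"
begin

definition pieces :: "('a graph_edge \<times> real \<times> real) set"
  where "pieces = (SIGMA e:E. {(s, t). s \<in> T e \<and> t \<in> T e \<and> s < t \<and> {s<..<t} \<inter> T e = {}})"

lemma piecesD:
  assumes "p \<in> pieces"
  shows "fst p \<in> E" "fst (snd p) \<in> T (fst p)" "snd (snd p) \<in> T (fst p)" "fst (snd p) < snd (snd p)"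
    "{fst (snd p)<..<snd (snd p)} \<inter> T (fst p) = {}"
    "branch f (fst p) (fst (snd p)) (snd (snd p)) (tg p) (ph p)"
  using assms br by (auto simp: pieces_def)

lemma finite_pieces: "finite pieces"
proof (rule finite_subset)
  show "pieces \<subseteq> (SIGMA e:E. T e \<times> T e)" by (auto simp: pieces_def)
  show "finite (SIGMA e:E. T e \<times> T e)"
    using finite_E T(1) by (intro finite_SigmaI finite_cartesian_product) auto
qed

lemma T_dom: "e \<in> E \<Longrightarrow> c \<in> T e \<Longrightarrow> 0 \<le> c \<and> c \<le> fst e"
  using T(4) by (meson atLeastAtMost_iff subsetD)

sublocale S: interval_system all_edges fst pieces fst tg "\<lambda>p. fst (snd p)" "\<lambda>p. snd (snd p)" ph
proof
  show "finite all_edges" by (rule finite_all_edges)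
  show "finite pieces" by (rule finite_pieces)
  show "0 \<le> fst i" if "i \<in> all_edges" for i :: "'a graph_edge" using all_edges_nonneg[OF that] .
  fix p assume p: "p \<in> pieces"
  note p' = piecesD[OF p]
  note b = p'(6)[unfolded branch_def]
  show "fst p \<in> all_edges" using p'(1) by (simp add: all_edges_def)
  show "tg p \<in> all_edges" using b by blast
  show "0 \<le> fst (snd p)" "snd (snd p) \<le> fst (fst p)" using T_dom[OF p'(1)] p'(2,3) by auto
  show "fst (snd p) < snd (snd p)" by (rule p'(4))
  show "continuous_on {fst (snd p)..snd (snd p)} (ph p)" using b by blast
  show "ph p x \<in> {0..fst (tg p)}" if "x \<in> {fst (snd p)..snd (snd p)}" for x using b that by blast
  show "mono_on {fst (snd p)..snd (snd p)} (ph p) \<or> antimono_on {fst (snd p)..snd (snd p)} (ph p)" using b by blast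
  fix q assume q: "q \<in> pieces" "p \<noteq> q" "fst p = fst q"
  note q' = piecesD[OF q(1)]
  have 1: "fst (snd q) \<notin> {fst (snd p)<..<snd (snd p)}" "snd (snd q) \<notin> {fst (snd p)<..<snd (snd p)}"
    using p'(5) q'(2,3) q(3) by auto
  have 2: "fst (snd p) \<notin> {fst (snd q)<..<snd (snd q)}" "snd (snd p) \<notin> {fst (snd q)<..<snd (snd q)}"
    using q'(5) p'(2,3) q(3) by auto
  show "snd (snd p) \<le> fst (snd q) \<or> snd (snd q) \<le> fst (snd p)"
  proof (rule ccontr)
    assume a: "\<not> ?thesis"
    then have "fst (snd p) = fst (snd q)" "snd (snd p) = snd (snd q)" using 1 2 p'(4) q'(4) by auto
    then show False using q by (simp add: prod_eq_iff)
  qed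
next
  fix i :: "'a graph_edge" and x y :: real
  assume i: "i \<in> all_edges" and xy: "0 \<le> x" "x < y" "y \<le> fst i"
    and free: "\<And>p. p \<in> pieces \<Longrightarrow> fst p = i \<Longrightarrow> fst (snd p) \<notin> {x<..<y} \<and> snd (snd p) \<notin> {x<..<y}"
  have iE: "i \<in> E" using all_edges_pos[OF i] xy by simp
  \<comment> \<open>A cut strictly inside would be the left end of the gap that follows it, hence a
    branch end, which is excluded by \<open>free\<close>.\<close>
  have "c \<notin> {x<..<y}" if c: "c \<in> T i" for c
  proof
    assume cx: "c \<in> {x<..<y}"
    have yc: "0 < y - c" using cx by simp
    obtain \<epsilon> where \<epsilon>: "0 < \<epsilon>" "\<epsilon> \<le> y - c" "\<And>c'. c' \<in> T i \<Longrightarrow> c' \<noteq> c \<Longrightarrow> \<epsilon> \<le> \<bar>c' - c\<bar>"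
      using finite_avoid[OF T(1)[OF iE] yc] by metis
    have "c' \<notin> {c<..<c + \<epsilon>}" if "c' \<in> T i" for c' using \<epsilon>(3)[OF that] by (cases "c' = c") auto
    then have e: "{c<..<c + \<epsilon>} \<inter> T i = {}" by blast
    have "c < c + \<epsilon>" "0 \<le> c" "c + \<epsilon> \<le> fst i" using \<epsilon> cx xy by auto
    then obtain s t where st: "s \<in> T i" "t \<in> T i" "s \<le> c" "c + \<epsilon> \<le> t" "{s<..<t} \<inter> T i = {}"
      using finite_gap[OF T(1)[OF iE] _ e T(2)[OF iE] _ T(3)[OF iE]] by metis
    have "c \<notin> {s<..<t}" using c st(5) by blast
    then have "s = c" using st(3,4) \<epsilon>(1) by auto
    then have "(i, c, t) \<in> pieces" using iE st \<epsilon>(1) by (auto simp: pieces_def)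
    then show False using free[of "(i, c, t)"] cx by simp
  qed
  then have e: "{x<..<y} \<inter> T i = {}" by blast
  obtain s t where st: "s \<in> T i" "t \<in> T i" "s \<le> x" "y \<le> t" "{s<..<t} \<inter> T i = {}"
    using finite_gap[OF T(1)[OF iE] xy(2) e T(2)[OF iE] xy(1) T(3)[OF iE] xy(3)] by metis
  then have "(i, s, t) \<in> pieces" using iE xy by (auto simp: pieces_def)
  then show "\<exists>p\<in>pieces. fst p = i \<and> fst (snd p) \<le> x \<and> y \<le> snd (snd p)"
    using st by (intro bexI[of _ "(i, s, t)"]) auto
qed

definition cuts :: "'a graph_edge \<Rightarrow> real set"
  where "cuts e = (if e \<in> E then T e else {})"

lemma cuts_finite: "finite (cuts e)" by (simp add: cuts_def T(1))

lemma cuts_pieces: "p \<in> pieces \<Longrightarrow> fst (snd p) \<in> cuts (fst p) \<and> snd (snd p) \<in> cuts (fst p)"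
  using piecesD by (simp add: cuts_def)

text \<open>The coefficients of the generating function: up to end effects, the number of preimages
  of cuts under the \<open>n\<close>-th iterate.\<close>

definition growth :: "nat \<Rightarrow> real"
  where "growth n = S.mass ((S.transfer ^^ n) (S.cut_count cuts))"

lemma growth_nonneg: "0 \<le> growth n"
  unfolding growth_def by (intro S.mass_ge_0 S.transfer_pow_mono S.cut_count_mono cuts_finite)

lemma mass_transfer_le_growth:
  "S.monotone_family u \<Longrightarrow> S.mass ((S.transfer ^^ n) u) \<le> S.mass u * (real (card all_edges) + (\<Sum>k<n. growth k))"
  unfolding growth_def by (rule S.mass_transfer_pow_le) (use cuts_finite cuts_pieces in auto)

text \<open>The counting bound applied to the \<open>n\<close>-th transfer of the cut count itself;
  this is the hypothesis \<open>sub\<close> of \<open>critical_radius\<close>.\<close>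

lemma growth_submult: "growth (n + m) \<le> (real (card all_edges) + (\<Sum>k<m. growth k)) * growth n"
proof -
  have "growth (n + m) = S.mass ((S.transfer ^^ m) ((S.transfer ^^ n) (S.cut_count cuts)))"
    by (simp add: growth_def add.commute[of n m] funpow_add)
  also have "\<dots> \<le> S.mass ((S.transfer ^^ n) (S.cut_count cuts)) * (real (card all_edges) + (\<Sum>k<m. growth k))"
    by (intro mass_transfer_le_growth S.transfer_pow_mono S.cut_count_mono cuts_finite)
  finally show ?thesis by (simp add: growth_def mult.commute)
qed

text \<open>The cuts are refined until every gap lies in one member of the cover, and then a cover
  of the image pulls back with the same number of sets. The refinement depends on
  \<open>\<U>\<close>, but it affects only the constant \<open>M\<close>, the mass of the refined
  cut count; the growth is that of the original cuts.\<close>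

lemma subcover_number_growth:
  assumes U: "open_cover X \<U>"
  obtains M where "0 \<le> M" "\<And>n. real (subcover_number X (iterated_join X f \<U> n)) \<le>
    real (card all_edges) + (\<Sum>k<n. M * (real (card all_edges) + (\<Sum>j<k. growth j)))"
proof -
  have "\<forall>e\<in>E. \<exists>D. finite D \<and> (\<forall>x y. 0 \<le> x \<longrightarrow> x < y \<longrightarrow> y \<le> fst e \<longrightarrow> {x<..<y} \<inter> D = {} \<longrightarrow> (\<exists>U\<in>\<U>. snd e ` {x..y} \<subseteq> U))"
  proof
    fix e assume e: "e \<in> E"
    obtain D where "finite D" "\<And>x y. 0 \<le> x \<Longrightarrow> x < y \<Longrightarrow> y \<le> fst e \<Longrightarrow> {x<..<y} \<inter> D = {} \<Longrightarrow> \<exists>U\<in>\<U>. snd e ` {x..y} \<subseteq> U"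
      by (rule Lebesgue_cuts[OF less_imp_le[OF edge_pos[OF e]] edge_cont[OF e] U]) (rule that)
    then show "\<exists>D. finite D \<and> (\<forall>x y. 0 \<le> x \<longrightarrow> x < y \<longrightarrow> y \<le> fst e \<longrightarrow> {x<..<y} \<inter> D = {} \<longrightarrow> (\<exists>U\<in>\<U>. snd e ` {x..y} \<subseteq> U))"
      by (intro exI[of _ D]) simp
  qed
  from bchoice[OF this] obtain D where "\<forall>e\<in>E. finite (D e) \<and> (\<forall>x y. 0 \<le> x \<longrightarrow> x < y \<longrightarrow> y \<le> fst e \<longrightarrow> {x<..<y} \<inter> D e = {} \<longrightarrow> (\<exists>U\<in>\<U>. snd e ` {x..y} \<subseteq> U))"
    by (rule exE)
  then have D: "\<And>e. e \<in> E \<Longrightarrow> finite (D e)"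
    "\<And>e x y. e \<in> E \<Longrightarrow> 0 \<le> x \<Longrightarrow> x < y \<Longrightarrow> y \<le> fst e \<Longrightarrow> {x<..<y} \<inter> D e = {} \<Longrightarrow> \<exists>U\<in>\<U>. snd e ` {x..y} \<subseteq> U"
    by simp_all
  define C where "C e = cuts e \<union> (if e \<in> E then D e else {})" for e
  have Cfin: "finite (C e)" for e by (simp add: C_def cuts_finite D(1))
  define w where "w = S.cut_count C"
  have mw: "S.monotone_family w" unfolding w_def by (intro S.cut_count_mono Cfin)
  have fX: "f \<in> topspace X \<rightarrow> topspace X" using f continuous_map_funspace by blast
  note oc = open_cover_iterated_join[OF f U]
  have join_sub: "A \<subseteq> topspace X" if "A \<in> iterated_join X f \<U> n" for A n using that unfolding iterated_join_def by blast
  have in_X: "snd i t \<in> topspace X" if "i \<in> all_edges" "t \<in> {0..fst i}" for i t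
    using continuous_map_image_subset_topspace[OF all_edges_cont[OF that(1)]] that(2) by auto
  define R where "R n i x y k \<longleftrightarrow> (\<exists>\<V>\<subseteq>iterated_join X f \<U> n. finite \<V> \<and> real (card \<V>) \<le> k \<and> snd i ` {x..y} \<subseteq> \<Union>\<V>)"
    for n and i :: "'a graph_edge" and x y k
  have count: "R n i 0 (fst i) (1 + (\<Sum>k<n. (S.transfer ^^ k) w i (fst i) - (S.transfer ^^ k) w i 0))"
    if i: "i \<in> all_edges" for i n
    unfolding w_def
  proof (rule S.counting[where R = R and C = C])
    show "finite (C i)" for i by (rule Cfin)
    show "fst (snd p) \<in> C (fst p) \<and> snd (snd p) \<in> C (fst p)" if "p \<in> pieces" for p
      using cuts_pieces[OF that] by (simp add: C_def)
    show "R n i x y k'" if "R n i x y k" "k \<le> k'" for n i x y k k'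
      using that unfolding R_def by (meson order_trans)
    show "R 0 i x y 1" if "i \<in> all_edges" "0 \<le> x" "x \<le> y" "y \<le> fst i" for i x y
      unfolding R_def iterated_join_0 using in_X[OF that(1)] that by (intro exI[of _ "{topspace X}"]) auto
    show "R n i x x 1" if "i \<in> all_edges" "0 \<le> x" "x \<le> fst i" for n i x
    proof -
      have "snd i x \<in> \<Union>(iterated_join X f \<U> n)" using oc[of n] in_X[of i x] that by (simp add: open_cover_def)
      then obtain A where "A \<in> iterated_join X f \<U> n" "snd i x \<in> A" by blast
      then show ?thesis unfolding R_def by (intro exI[of _ "{A}"]) auto
    qed
    show "R n i x y (k + k')" if c: "x < c" "c < y" and R1: "R n i x c k" and R2: "R n i c y k'" for n i x c y k k'
    proof -
      obtain \<V> where V: "\<V> \<subseteq> iterated_join X f \<U> n" "finite \<V>" "real (card \<V>) \<le> k" "snd i ` {x..c} \<subseteq> \<Union>\<V>"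
        using R1 unfolding R_def by blast
      obtain \<V>' where V': "\<V>' \<subseteq> iterated_join X f \<U> n" "finite \<V>'" "real (card \<V>') \<le> k'" "snd i ` {c..y} \<subseteq> \<Union>\<V>'"
        using R2 unfolding R_def by blast
      have xy: "{x..y} = {x..c} \<union> {c..y}" using c by auto
      have "snd i ` {x..y} \<subseteq> \<Union>(\<V> \<union> \<V>')"
        unfolding xy image_Un Union_Un_distrib by (rule Un_mono[OF V(4) V'(4)])
      moreover have "real (card (\<V> \<union> \<V>')) \<le> k + k'" using card_Un_le[of \<V> \<V>'] V(3) V'(3) by linarith
      moreover have "\<V> \<union> \<V>' \<subseteq> iterated_join X f \<U> n" "finite (\<V> \<union> \<V>')" using V V' by auto
      ultimately show ?thesis unfolding R_def by blast
    qed
    fix n p x y k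
    assume p: "p \<in> pieces" and xy: "fst (snd p) \<le> x" "x < y" "y \<le> snd (snd p)" and free: "{x<..<y} \<inter> C (fst p) = {}"
      and Rn: "R n (tg p) (min (ph p x) (ph p y)) (max (ph p x) (ph p y)) k"
    note p' = piecesD[OF p]
    note b = p'(6)[unfolded branch_def]
    have dom: "0 \<le> x" "y \<le> fst (fst p)" using T_dom[OF p'(1)] p'(2,3) xy by force+
    have "{x<..<y} \<inter> D (fst p) = {}" using free p'(1) by (auto simp: C_def)
    from D(2)[OF p'(1) dom(1) xy(2) dom(2) this] obtain U' where U': "U' \<in> \<U>" "snd (fst p) ` {x..y} \<subseteq> U'" by blast
    obtain \<V> where V: "\<V> \<subseteq> iterated_join X f \<U> n" "finite \<V>" "real (card \<V>) \<le> k"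
      "snd (tg p) ` {min (ph p x) (ph p y)..max (ph p x) (ph p y)} \<subseteq> \<Union>\<V>"
      using Rn unfolding R_def by blast
    define \<Phi> where "\<Phi> B = {z \<in> topspace X. z \<in> U' \<and> f z \<in> B}" for B
    have "snd (fst p) ` {x..y} \<subseteq> \<Union>(\<Phi> ` \<V>)"
    proof
      fix z assume "z \<in> snd (fst p) ` {x..y}"
      then obtain r where r: "r \<in> {x..y}" "z = snd (fst p) r" by blast
      have rp: "r \<in> {fst (snd p)..snd (snd p)}" "x \<in> {fst (snd p)..snd (snd p)}" "y \<in> {fst (snd p)..snd (snd p)}"
        using r xy by auto
      have fz: "f z = snd (tg p) (ph p r)" using b rp r by blast
      have "ph p r \<in> {min (ph p x) (ph p y)..max (ph p x) (ph p y)}"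
        using S.\<phi>_mono[OF p]
      proof
        assume m: "mono_on {fst (snd p)..snd (snd p)} (ph p)"
        show ?thesis using mono_onD[OF m rp(2,1)] mono_onD[OF m rp(1,3)] r by auto
      next
        assume m: "antimono_on {fst (snd p)..snd (snd p)} (ph p)"
        show ?thesis using monotone_onD[OF m rp(2,1)] monotone_onD[OF m rp(1,3)] r by auto
      qed
      then have "f z \<in> \<Union>\<V>" unfolding fz using V(4) by blast
      moreover have "z \<in> U'" using U' r by blast
      moreover have "z \<in> topspace X" using r dom edge_in[OF p'(1), of r] by auto
      ultimately show "z \<in> \<Union>(\<Phi> ` \<V>)" by (auto simp: \<Phi>_def)
    qed
    moreover have "\<Phi> ` \<V> \<subseteq> iterated_join X f \<U> (Suc n)"
      using iterated_join_SucI[OF U'(1) _ fX] V(1) unfolding \<Phi>_def by blast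
    moreover have "real (card (\<Phi> ` \<V>)) \<le> k" using card_image_le[OF V(2), of \<Phi>] V(3) by linarith
    moreover have "finite (\<Phi> ` \<V>)" using V(2) by simp
    ultimately show "R (Suc n) (fst p) x y k" unfolding R_def by blast
  qed (use i all_edges_nonneg in auto)
  have bound: "real (subcover_number X (iterated_join X f \<U> n)) \<le>
    real (card all_edges) + (\<Sum>k<n. S.mass w * (real (card all_edges) + (\<Sum>j<k. growth j)))" for n
  proof -
    let ?b = "\<lambda>i. 1 + (\<Sum>k<n. (S.transfer ^^ k) w i (fst i) - (S.transfer ^^ k) w i 0)"
    have "\<forall>i\<in>all_edges. \<exists>\<V>. \<V> \<subseteq> iterated_join X f \<U> n \<and> finite \<V> \<and> real (card \<V>) \<le> ?b i \<and> snd i ` {0..fst i} \<subseteq> \<Union>\<V>"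
      using count[of _ n] unfolding R_def by blast
    from bchoice[OF this] obtain \<V> where "\<forall>i\<in>all_edges. \<V> i \<subseteq> iterated_join X f \<U> n \<and> finite (\<V> i) \<and> real (card (\<V> i)) \<le> ?b i \<and> snd i ` {0..fst i} \<subseteq> \<Union>(\<V> i)"
      by (rule exE)
    then have V: "\<And>i. i \<in> all_edges \<Longrightarrow> \<V> i \<subseteq> iterated_join X f \<U> n" "\<And>i. i \<in> all_edges \<Longrightarrow> finite (\<V> i)"
      "\<And>i. i \<in> all_edges \<Longrightarrow> real (card (\<V> i)) \<le> ?b i" "\<And>i. i \<in> all_edges \<Longrightarrow> snd i ` {0..fst i} \<subseteq> \<Union>(\<V> i)"
      by simp_all
    let ?W = "\<Union>i\<in>all_edges. \<V> i"
    have sub: "?W \<subseteq> iterated_join X f \<U> n" using V(1) by blast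
    have "\<Union>?W = topspace X"
    proof
      show "\<Union>?W \<subseteq> topspace X" using sub join_sub by blast
      show "topspace X \<subseteq> \<Union>?W"
      proof
        fix x assume "x \<in> topspace X"
        from all_edges_cover[OF this] obtain i t where it: "i \<in> all_edges" "t \<in> {0..fst i}" "x = snd i t" by blast
        then have "x \<in> \<Union>(\<V> i)" using V(4)[OF it(1)] by blast
        then show "x \<in> \<Union>?W" using it(1) by blast
      qed
    qed
    then have "subcover_number X (iterated_join X f \<U> n) \<le> card ?W"
      using V(2) finite_all_edges sub by (intro subcover_number_le) auto
    also have "\<dots> \<le> (\<Sum>i\<in>all_edges. card (\<V> i))" by (rule card_UN_le[OF finite_all_edges])
    finally have "real (subcover_number X (iterated_join X f \<U> n)) \<le> (\<Sum>i\<in>all_edges. real (card (\<V> i)))"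
      by (metis of_nat_le_iff of_nat_sum)
    also have "\<dots> \<le> (\<Sum>i\<in>all_edges. ?b i)" by (intro sum_mono V(3))
    also have "\<dots> = real (card all_edges) + (\<Sum>k<n. S.mass ((S.transfer ^^ k) w))"
      unfolding S.mass_def sum.distrib by (subst sum.swap) simp
    also have "\<dots> \<le> real (card all_edges) + (\<Sum>k<n. S.mass w * (real (card all_edges) + (\<Sum>j<k. growth j)))"
      by (intro add_left_mono sum_mono mass_transfer_le_growth mw)
    finally show ?thesis .
  qed
  show ?thesis by (rule that[OF S.mass_ge_0[OF mw] bound])
qed

text \<open>The bound for the subcover numbers takes partial sums of \<open>growth\<close> twice,
  which preserves convergence at \<open>z < 1\<close>. Hence these numbers times
  \<open>z ^ n\<close> stay bounded.\<close>

lemma topological_entropy_le: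
  assumes z: "0 < z" "z < 1" and sm: "summable (\<lambda>n. growth n * z ^ n)"
  shows "topological_entropy X f \<le> ereal (- ln z)"
  unfolding topological_entropy_def
proof (rule SUP_least)
  fix \<U> assume "\<U> \<in> {\<U>. open_cover X \<U>}"
  then have U: "open_cover X \<U>" by simp
  obtain M where M: "0 \<le> M" "\<And>n. real (subcover_number X (iterated_join X f \<U> n)) \<le>
    real (card all_edges) + (\<Sum>k<n. M * (real (card all_edges) + (\<Sum>j<k. growth j)))"
    by (rule subcover_number_growth[OF U]) (rule that)
  define N where "N n = subcover_number X (iterated_join X f \<U> n)" for n
  have geo: "summable (\<lambda>n. a * z ^ n)" for a :: real using z by (intro summable_mult summable_geometric) auto
  have "summable (\<lambda>n. real (card all_edges) * z ^ n + (\<Sum>j<n. growth j) * z ^ n)"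
    by (intro summable_add geo summable_partial_sums growth_nonneg z sm)
  then have "summable (\<lambda>n. M * (real (card all_edges) * z ^ n + (\<Sum>j<n. growth j) * z ^ n))" by (rule summable_mult)
  then have "summable (\<lambda>n. (M * (real (card all_edges) + (\<Sum>j<n. growth j))) * z ^ n)" by (simp add: algebra_simps)
  then have "summable (\<lambda>n. (\<Sum>k<n. M * (real (card all_edges) + (\<Sum>j<k. growth j))) * z ^ n)"
    using M(1) by (intro summable_partial_sums z) (auto intro!: mult_nonneg_nonneg add_nonneg_nonneg sum_nonneg growth_nonneg)
  then have "summable (\<lambda>n. real (card all_edges) * z ^ n + (\<Sum>k<n. M * (real (card all_edges) + (\<Sum>j<k. growth j))) * z ^ n)"
    by (intro summable_add geo)
  then have "Bseq (\<lambda>n. real (card all_edges) * z ^ n + (\<Sum>k<n. M * (real (card all_edges) + (\<Sum>j<k. growth j))) * z ^ n)"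
    using summable_imp_Bseq by blast
  then obtain B where B: "0 < B" "\<And>n. norm (real (card all_edges) * z ^ n + (\<Sum>k<n. M * (real (card all_edges) + (\<Sum>j<k. growth j))) * z ^ n) \<le> B"
    by (auto simp: Bseq_def)
  have NB: "real (N n) * z ^ n \<le> B" for n
  proof -
    have "real (N n) * z ^ n \<le> (real (card all_edges) + (\<Sum>k<n. M * (real (card all_edges) + (\<Sum>j<k. growth j)))) * z ^ n"
      unfolding N_def using z by (intro mult_right_mono M(2)) auto
    also have "\<dots> \<le> B" using B(2)[of n] by (simp add: distrib_right)
    finally show ?thesis .
  qed
  have N1: "1 \<le> N n" for n
  proof -
    obtain \<V> where V: "finite \<V>" "\<Union>\<V> = topspace X" "card \<V> = N n"
      unfolding N_def by (rule subcover_number_attained[OF compact_space open_cover_iterated_join[OF f U]])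
    obtain e where "e \<in> E" using E_ne by blast
    then have "snd e 0 \<in> \<Union>\<V>" using edge_0 V_sub V(2) by blast
    then have "\<V> \<noteq> {}" by blast
    then have "0 < card \<V>" using V(1) by (simp add: card_gt_0_iff)
    then show ?thesis using V(3) by simp
  qed
  have ineq: "ln (real (N n)) / real n \<le> ln B * (1 / real n) - ln z" if n: "0 < n" for n
  proof -
    have "ln (real (N n) * z ^ n) \<le> ln B" using NB[of n] N1[of n] z B(1) by (intro ln_mono) auto
    then have "ln (real (N n)) + real n * ln z \<le> ln B" using N1[of n] z by (simp add: ln_mult ln_realpow)
    then show ?thesis using n by (simp add: field_simps)
  qed
  have "limsup (\<lambda>n. ereal (ln (real (N n)) / real n)) \<le> limsup (\<lambda>n. ereal (ln B * (1 / real n) - ln z))"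
    by (intro Limsup_mono) (use ineq in \<open>auto simp: eventually_sequentially intro!: exI[of _ 1]\<close>)
  also have "(\<lambda>n. ln B * (1 / real n) - ln z) \<longlonglongrightarrow> ln B * 0 - ln z"
    by (intro tendsto_intros lim_1_over_n)
  then have "(\<lambda>n. ereal (ln B * (1 / real n) - ln z)) \<longlonglongrightarrow> ereal (- ln z)" by simp
  then have "limsup (\<lambda>n. ereal (ln B * (1 / real n) - ln z)) = ereal (- ln z)"
    by (intro lim_imp_Limsup) auto
  finally show "cover_entropy X f \<U> \<le> ereal (- ln z)" by (simp add: cover_entropy_def N_def)
qed

lemma constant_slope_quotient:
  assumes h: "topological_entropy X f = ereal (ln \<beta>)" and \<beta>: "1 < \<beta>"
  shows "\<exists>(Q :: 'a topology) g \<psi>.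
    finite_graph Q \<and> continuous_map Q Q g \<and> piecewise_monotone Q g \<and> constant_slope Q g \<beta> \<and>
    continuous_map X Q \<psi> \<and> monotone_map X Q \<psi> \<and> \<psi> ` topspace X = topspace Q \<and>
    (\<forall>x\<in>topspace X. \<psi> (f x) = g (\<psi> x)) \<and>
    (transitive_map X f \<longrightarrow> homeomorphic_map X Q \<psi>)"
proof -
  \<comment> \<open>Convergence at \<open>z\<close> bounds the entropy by \<open>- ln z\<close>, so
    the radius is at most \<open>1 / \<beta>\<close>. This gives both \<open>r < 1\<close> and
    \<open>\<beta> \<le> \<sigma>\<close>.\<close>
  have small: "z \<le> 1 / \<beta>" if z: "0 < z" "z < 1" "summable (\<lambda>n. growth n * z ^ n)" for z
  proof -
    have "ln \<beta> \<le> - ln z" using topological_entropy_le[OF z] h by simp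
    then have "ln (\<beta> * z) \<le> ln 1" using z \<beta> by (simp add: ln_mult)
    then have "\<beta> * z \<le> 1" using z \<beta> by (subst (asm) ln_le_cancel_iff) auto
    then show ?thesis using \<beta> by (simp add: field_simps)
  qed
  have "0 \<le> real (card all_edges)" "1 / \<beta> < 1" using \<beta> by auto
  then obtain r where r: "0 < r" "r \<le> 1 / \<beta>" "\<And>z. 0 \<le> z \<Longrightarrow> z < r \<Longrightarrow> summable (\<lambda>n. growth n * z ^ n)"
    "\<And>M r'. r' < r \<Longrightarrow> \<exists>z. 0 < z \<and> r' < z \<and> z < r \<and> M < (\<Sum>n. growth n * z ^ n)"
    by (rule critical_radius[OF growth_nonneg _ growth_submult _ small]) (assumption | rule that)+
  have w: "S.monotone_family (S.cut_count cuts)" by (intro S.cut_count_mono cuts_finite)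
  have w0: "S.cut_count cuts i 0 = 0" for i
  proof -
    have "{c \<in> cuts i. c < 0} = {}" using T_dom[of i] by (force simp: cuts_def split: if_splits)
    then show ?thesis unfolding S.cut_count_def by (metis card.empty of_nat_0)
  qed
  obtain u where u: "S.monotone_family u" "\<And>i. i \<in> all_edges \<Longrightarrow> u i 0 = 0" "S.mass u = 1"
    "\<And>i x. i \<in> all_edges \<Longrightarrow> x \<in> {0..fst i} \<Longrightarrow> u i x = r * S.transfer u i x"
    by (rule S.eigenfunction[OF w w0 r(1) r(3,4)[unfolded growth_def]]) (assumption | rule that)+
  define \<sigma> where "\<sigma> = 1 / r"
  have \<sigma>\<beta>: "\<beta> \<le> \<sigma>" using r(1,2) \<beta> by (simp add: \<sigma>_def field_simps)
  have \<sigma>: "1 < \<sigma>" "0 < \<sigma>" using \<sigma>\<beta> \<beta> by auto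
  \<comment> \<open>Within a branch, increments of the transfer are variations of the image, so the
    eigenvalue equation becomes a local scaling law.\<close>
  have scale: "\<bar>u (tg p) (ph p y) - u (tg p) (ph p x)\<bar> = \<sigma> * (u (fst p) y - u (fst p) x)"
    if p: "p \<in> pieces" "fst (snd p) \<le> x" "x \<le> y" "y \<le> snd (snd p)" for p x y
  proof -
    have "x \<in> {0..fst (fst p)}" "y \<in> {0..fst (fst p)}" using S.lo[OF p(1)] S.hi[OF p(1)] p by auto
    then show ?thesis
      using S.transfer_diff[OF u(1) p] u(4)[OF S.src[OF p(1)]] r(1) by (simp add: \<sigma>_def field_simps)
  qed
  have E_sub: "e \<in> all_edges" if "e \<in> E" for e using that by (simp add: all_edges_def)
  have "\<exists>e\<in>E. 0 < u e (fst e)"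
  proof (rule ccontr)
    assume no: "\<not> ?thesis"
    have "u i (fst i) - u i 0 \<le> 0" if i: "i \<in> all_edges" for i
    proof (cases "i \<in> E")
      case True
      then show ?thesis using no u(2)[OF i] by auto
    next
      case False
      then have "fst i = 0" using all_edges_pos[OF i] all_edges_nonneg[OF i] by (metis less_eq_real_def)
      then show ?thesis by simp
    qed
    then have "S.mass u \<le> 0" unfolding S.mass_def by (rule sum_nonpos)
    then show False using u(3) by simp
  qed
  then interpret C: collapse X V E u
  proof unfold_locales
    fix e assume e: "e \<in> E"
    show "continuous_on {0..fst e} (u e)" by (rule S.eigenfunction_continuous[OF u(1) \<sigma>(1) scale E_sub[OF e]])
    show "mono_on {0..fst e} (u e)" using u(1) E_sub[OF e] by (simp add: S.monotone_family_def)
    show "u e 0 = 0" by (rule u(2)[OF E_sub[OF e]])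
  qed
  have sb: "\<exists>e' \<phi>. C.scaled_branch f \<sigma> e s t e' \<phi>"
    if "e \<in> E" "s \<in> T e" "t \<in> T e" "s < t" "{s<..<t} \<inter> T e = {}" for e s t
  proof -
    have "(e, s, t) \<in> pieces" using that by (simp add: pieces_def)
    then have "C.scaled_branch f \<sigma> e s t (tg (e, s, t)) (ph (e, s, t))"
      unfolding C.scaled_branch_def using br[OF that] scale[of "(e, s, t)"] by simp
    then show ?thesis by blast
  qed
  let ?g = "C.rho \<circ> f"
  note dyn = f \<sigma>(2) T sb
  have aff: "affine_slope C.new_edges ?g \<sigma>" by (rule C.affine_slope_quotient[OF dyn])
  have gc: "continuous_map C.Q C.Q ?g" by (rule C.quotient_map_cont[OF dyn])
  have resp: "C.rho (f (C.rho x)) = C.rho (f x)" for x by (rule C.rho_f_rho[OF dyn])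
  interpret Q: graph C.Q "C.rho ` V" C.new_edges by unfold_locales (rule C.graph_Q)
  \<comment> \<open>The reverse inequality: the quotient has slope \<open>\<sigma>\<close>, and its
    entropy is at most that of \<open>f\<close>.\<close>
  have "ereal (ln \<sigma>) \<le> topological_entropy C.Q ?g" by (rule Q.topological_entropy_ge[OF aff \<sigma>(2) gc])
  also have "\<dots> \<le> topological_entropy X f"
    by (rule topological_entropy_factor[OF compact_space f C.rho_cont C.topspace_Q[symmetric]])
       (use gc continuous_map_funspace resp in auto)
  finally have "ln \<sigma> \<le> ln \<beta>" using h by simp
  then have "\<sigma> = \<beta>" using \<sigma> \<sigma>\<beta> \<beta> by simp
  have "finite_graph C.Q" unfolding finite_graph_def using C.graph_Q by blast
  moreover have "piecewise_monotone C.Q ?g" by (rule Q.affine_slope_imp_piecewise_monotone[OF aff \<sigma>(2) gc])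
  moreover have "constant_slope C.Q ?g \<beta>"
    using Q.affine_slope_imp_constant_slope[OF aff \<sigma>(2)] \<open>\<sigma> = \<beta>\<close> by simp
  moreover have "\<forall>x\<in>topspace X. C.rho (f x) = ?g (C.rho x)" using resp by simp
  moreover have "transitive_map X f \<longrightarrow> homeomorphic_map X C.Q C.rho"
    using C.homeomorphic_rho C.transitive_imp_inj[OF f resp] by blast
  ultimately show ?thesis using gc C.rho_cont C.monotone_rho C.topspace_Q by metis
qed

end

theorem theorem3:
  fixes G :: "'a topology" and f :: "'a \<Rightarrow> 'a" and \<beta> :: real
  assumes "finite_graph G"
    and "continuous_map G G f"
    and "piecewise_monotone G f"
    and "\<beta> > 0"
    and "topological_entropy G f = ereal (ln \<beta>)"
    and "ln \<beta> > 0"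
  shows "\<exists>(G' :: 'a topology) g \<psi>.
    finite_graph G' \<and>
    continuous_map G' G' g \<and> piecewise_monotone G' g \<and> constant_slope G' g \<beta> \<and>
    continuous_map G G' \<psi> \<and> monotone_map G G' \<psi> \<and> \<psi> ` topspace G = topspace G' \<and>
    (\<forall>x\<in>topspace G. \<psi> (f x) = g (\<psi> x)) \<and>
    (transitive_map G f \<longrightarrow> homeomorphic_map G G' \<psi>)"
proof -
  obtain V E where "graph_parametrization G V E" using assms(1) unfolding finite_graph_def by blast
  then interpret graph G V E by unfold_locales
  define ok where "ok e T \<longleftrightarrow> finite T \<and> 0 \<in> T \<and> fst e \<in> T \<and> T \<subseteq> {0..fst e} \<and>
    (\<forall>p q. 0 \<le> p \<longrightarrow> p < q \<longrightarrow> q \<le> fst e \<longrightarrow> {p<..<q} \<inter> T = {} \<longrightarrow> (\<exists>e' \<phi>. branch f e p q e' \<phi>))" for e T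
  have "\<forall>e\<in>E. \<exists>T. ok e T"
  proof
    fix e assume e: "e \<in> E"
    obtain T where "finite T" "0 \<in> T" "fst e \<in> T" "T \<subseteq> {0..fst e}"
      "\<And>p q. 0 \<le> p \<Longrightarrow> p < q \<Longrightarrow> q \<le> fst e \<Longrightarrow> {p<..<q} \<inter> T = {} \<Longrightarrow> \<exists>e' \<phi>. branch f e p q e' \<phi>"
      by (rule branches_exist[OF assms(2,3) e]) (rule that)
    then have "ok e T" by (simp add: ok_def)
    then show "\<exists>T. ok e T" ..
  qed
  from bchoice[OF this] obtain T where T: "\<forall>e\<in>E. ok e (T e)" by (rule exE)
  define br where "br z w \<longleftrightarrow> branch f (fst z) (fst (snd z)) (snd (snd z)) (fst w) (snd w)" for z and w :: "'a graph_edge \<times> (real \<Rightarrow> real)"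
  \<comment> \<open>Target edge and lift are chosen together as one total function of the gap, the
    form the locale expects.\<close>
  define F where "F z = (SOME w. br z w)" for z
  have F: "branch f e s t (fst (F (e, s, t))) (snd (F (e, s, t)))"
    if a: "e \<in> E" "s \<in> T e" "t \<in> T e" "s < t" "{s<..<t} \<inter> T e = {}" for e s t
  proof -
    have ok: "ok e (T e)" using T a(1) by blast
    then have "0 \<le> s" "t \<le> fst e" using a(2,3) unfolding ok_def by (meson atLeastAtMost_iff subsetD)+
    then have "\<exists>e' \<phi>. branch f e s t e' \<phi>" using ok a(4,5) unfolding ok_def by blast
    then obtain e' \<phi> where "branch f e s t e' \<phi>" by blast
    then have "br (e, s, t) (e', \<phi>)" by (simp add: br_def)
    then have "br (e, s, t) (F (e, s, t))" unfolding F_def by (rule someI)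
    then show ?thesis by (simp add: br_def)
  qed
  interpret cut_graph_map G V E f T "\<lambda>z. fst (F z)" "\<lambda>z. snd (F z)"
  proof
    fix e assume e: "e \<in> E"
    then have "ok e (T e)" using T by blast
    then show "finite (T e)" "0 \<in> T e" "fst e \<in> T e" "T e \<subseteq> {0..fst e}" by (simp_all add: ok_def)
  qed (use assms(2) F in auto)
  have "1 < \<beta>" using assms(4,6) by simp
  from constant_slope_quotient[OF assms(5) this] show ?thesis .
qed

end
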